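(* Let $n\in\{2,3\}$. There is a constant $C_1>0$ depending only on $n$ and $\Omega$, and there exist constants $\zeta,\omega>0$ depending only on $\Omega$ and the coefficients of the system, such that the following holds. Assume that the initial phase function $\phi_0$ and the initial temperature $\theta_0$ satisfy $$\|\phi_0\|_{L^\infty}\le 1,\qquad \|\theta_0\|_{L^\infty}\le \frac{1}{4C_1^2|b|}\sqrt{\frac{a\gamma\nu}{2\lambda_0}}.$$ If $(u,\phi,\theta)$ is a smooth solution to problem (P), then $$\frac{d\mathcal{E}}{dt}\le-\frac{\nu}{2}\|\nabla u\|^2-a\lambda_0\gamma\|\Delta\phi-F'(\phi)\|^2-k\zeta\|\Delta\theta\|^2\le 0,\qquad\forall\,t>0,$$ where $$\mathcal{E}(t)=\|u(t)\|^2+a\lambda_0\|\nabla\phi(t)\|^2+2a\lambda_0\int_\Omega F(\phi(t))\,dx+\zeta\|\nabla\theta(t)\|^2+\omega\|\theta(t)\|^2\ge0.$$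
   Context: Setting. $\Omega\subset\mathbb{R}^n$ is a bounded domain with smooth boundary $\Gamma$. The coefficients of the system are constants $\nu,\gamma,k,\lambda_0,a,\varepsilon>0$, $b\neq 0$, $\alpha,g\in\mathbb{R}$; $\mathbf{j}$ is a fixed unit vector (upward direction). $F(s)=\frac{1}{4\varepsilon^2}(s^2-1)^2$, $\lambda(s)=\lambda_0(a-bs)$. $\|\cdot\|$ is the $L^2(\Omega)$ norm; $(a\otimes b)_{ij}=a_ib_j$. Problem (P) (density normalized to $\rho=1$): for $(x,t)\in\Omega\times(0,+\infty)$, $$u_t+(u\cdot\nabla)u+\nabla p-\nu\Delta u=-\nabla\cdot\big[\lambda(\theta)\nabla\phi\otimes\nabla\phi-\lambda(\theta)(\tfrac12|\nabla\phi|^2+F(\phi))\mathbb{I}\big]-(1-\alpha\theta)g\mathbf{j},$$ $$\nabla\cdot u=0,\quad \phi_t+u\cdot\nabla\phi=\gamma(\Delta\phi-F'(\phi)),\quad \theta_t+u\cdot\nabla\theta=k\Delta\theta,$$ with $u=0$, $\phi=-1$, $\theta=0$ on $\Gamma\times(0,+\infty)$, and $u|_{t=0}=u_0$ (with $\nabla\cdot u_0=0$), $\phi|_{t=0}=\phi_0$, $\theta|_{t=0}=\theta_0$. *)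

theory Defs
  imports "HOL-Analysis.Analysis" "HOL-Probability.Essential_Supremum"
begin

section \<open>Smooth functions and smooth domains\<close>

primrec Ck_on :: "nat \<Rightarrow> ('a::real_normed_vector \<Rightarrow> 'b::real_normed_vector) \<Rightarrow> 'a set \<Rightarrow> bool" where
  "Ck_on 0 f S \<longleftrightarrow> continuous_on S f"
| "Ck_on (Suc m) f S \<longleftrightarrow>
     (\<forall>x\<in>S. f differentiable (at x)) \<and>
     (\<forall>v. Ck_on m (\<lambda>x. frechet_derivative f (at x) v) S)"

text \<open>The predicate \<open>Ck_on\<close> uses two-sided derivatives and is meant for open sets.  On an arbitrary
  set, such as the closure of a domain, a smooth function is one that coincides there with a
  function that is smooth on an open neighbourhood.\<close>

definition smooth_on :: "('a::real_normed_vector \<Rightarrow> 'b::real_normed_vector) \<Rightarrow> 'a set \<Rightarrow> bool" where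
  "smooth_on f S \<longleftrightarrow>
     (\<exists>W h. open W \<and> S \<subseteq> W \<and> (\<forall>m. Ck_on m h W) \<and> (\<forall>x\<in>S. f x = h x))"

text \<open>A smooth boundary: near each boundary point, the domain is a sublevel set of a smooth function
  without critical points.\<close>

definition bounded_smooth_domain :: "('a::euclidean_space) set \<Rightarrow> bool" where
  "bounded_smooth_domain \<Omega> \<longleftrightarrow>
     open \<Omega> \<and> connected \<Omega> \<and> \<Omega> \<noteq> {} \<and> bounded \<Omega> \<and>
     (\<forall>x\<in>frontier \<Omega>. \<exists>U \<rho>. open U \<and> x \<in> U \<and> smooth_on (\<rho> :: 'a \<Rightarrow> real) U \<and>
        (\<forall>y\<in>U. frechet_derivative \<rho> (at y) \<noteq> (\<lambda>v. 0)) \<and>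
        \<Omega> \<inter> U = {y\<in>U. \<rho> y < 0})"


section \<open>Differential operators\<close>

definition partial :: "'n::finite \<Rightarrow> (real^'n \<Rightarrow> 'b::real_normed_vector) \<Rightarrow> real^'n \<Rightarrow> 'b" where
  "partial i f x = frechet_derivative f (at x) (axis i 1)"

definition grad :: "(real^'n \<Rightarrow> real) \<Rightarrow> real^'n \<Rightarrow> real^'n" where
  "grad f x = (\<chi> i. partial i f x)"

definition vgrad :: "(real^'n \<Rightarrow> real^'n) \<Rightarrow> real^'n \<Rightarrow> real^'n^'n" where
  "vgrad v x = (\<chi> i j. partial j (\<lambda>y. v y $ i) x)"

definition divergence :: "(real^'n \<Rightarrow> real^'n) \<Rightarrow> real^'n \<Rightarrow> real" where
  "divergence v x = (\<Sum>i\<in>UNIV. partial i (\<lambda>y. v y $ i) x)"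

definition tensor_divergence :: "(real^'n \<Rightarrow> real^'n^'n) \<Rightarrow> real^'n \<Rightarrow> real^'n" where
  "tensor_divergence A x = (\<chi> i. \<Sum>j\<in>UNIV. partial j (\<lambda>y. A y $ i $ j) x)"

definition laplacian :: "(real^'n \<Rightarrow> 'b::real_normed_vector) \<Rightarrow> real^'n \<Rightarrow> 'b" where
  "laplacian f x = (\<Sum>i\<in>UNIV. partial i (partial i f) x)"

definition convect :: "(real^'n \<Rightarrow> real^'n) \<Rightarrow> (real^'n \<Rightarrow> 'b::real_normed_vector) \<Rightarrow> real^'n \<Rightarrow> 'b" where
  "convect v f x = (\<Sum>i\<in>UNIV. (v x $ i) *\<^sub>R partial i f x)"

definition outer :: "real^'n \<Rightarrow> real^'n \<Rightarrow> real^'n^'n" where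
  "outer v w = (\<chi> i j. v $ i * w $ j)"


section \<open>Norms\<close>

text \<open>On \<open>real^'n^'n\<close> the library norm is the Frobenius norm.\<close>

definition L2_norm :: "(real^'n) set \<Rightarrow> (real^'n \<Rightarrow> 'b::real_normed_vector) \<Rightarrow> real" where
  "L2_norm \<Omega> f = sqrt (LINT x:\<Omega>|lborel. (norm (f x))\<^sup>2)"

definition Linf_norm :: "(real^'n) set \<Rightarrow> (real^'n \<Rightarrow> real) \<Rightarrow> ereal" where
  "Linf_norm \<Omega> f = esssup (restrict_space lborel \<Omega>) (\<lambda>x. ereal \<bar>f x\<bar>)"


section \<open>The system\<close>

definition FF :: "real \<Rightarrow> real \<Rightarrow> real" where
  "FF \<epsilon> s = 1 / (4 * \<epsilon>\<^sup>2) * (s\<^sup>2 - 1)\<^sup>2"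

definition surface_tension :: "real \<Rightarrow> real \<Rightarrow> real \<Rightarrow> real \<Rightarrow> real" where
  "surface_tension l0 a b s = l0 * (a - b * s)"

definition stress ::
  "real \<Rightarrow> real \<Rightarrow> real \<Rightarrow> real \<Rightarrow> (real^'n \<Rightarrow> real) \<Rightarrow> (real^'n \<Rightarrow> real) \<Rightarrow> real^'n \<Rightarrow> real^'n^'n" where
  "stress l0 a b \<epsilon> \<phi> \<theta> x =
     surface_tension l0 a b (\<theta> x) *\<^sub>R outer (grad \<phi> x) (grad \<phi> x)
     - (surface_tension l0 a b (\<theta> x) * (1/2 * (norm (grad \<phi> x))\<^sup>2 + FF \<epsilon> (\<phi> x))) *\<^sub>R mat 1"

text \<open>Only continuity is imposed on solutions at time 0, so the initial velocity need not be
  differentiable and its divergence is taken in the sense of distributions.\<close>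

definition weakly_divergence_free :: "(real^'n) set \<Rightarrow> (real^'n \<Rightarrow> real^'n) \<Rightarrow> bool" where
  "weakly_divergence_free \<Omega> v \<longleftrightarrow>
     (\<forall>\<psi> K. smooth_on \<psi> UNIV \<and> compact K \<and> K \<subseteq> \<Omega> \<and> (\<forall>x. x \<notin> K \<longrightarrow> \<psi> x = 0)
        \<longrightarrow> (LINT x:\<Omega>|lborel. v x \<bullet> grad \<psi> x) = 0)"

text \<open>Smooth solutions are smooth up to the spatial boundary for positive times; velocity, phase and
  temperature are moreover continuous up to time 0, where they attain the initial data.  No
  compatibility of the data beyond what this entails is required.\<close>

definition smooth_solution ::
  "(real^'n) set \<Rightarrow> real \<Rightarrow> real \<Rightarrow> real \<Rightarrow> real \<Rightarrow> real \<Rightarrow> real \<Rightarrow> real \<Rightarrow> real \<Rightarrow> real \<Rightarrow> real^'n \<Rightarrow>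
   (real^'n \<Rightarrow> real^'n) \<Rightarrow> (real^'n \<Rightarrow> real) \<Rightarrow> (real^'n \<Rightarrow> real) \<Rightarrow>
   (real \<Rightarrow> real^'n \<Rightarrow> real^'n) \<Rightarrow> (real \<Rightarrow> real^'n \<Rightarrow> real) \<Rightarrow> (real \<Rightarrow> real^'n \<Rightarrow> real) \<Rightarrow> bool" where
  "smooth_solution \<Omega> \<nu> \<gamma> k l0 a \<epsilon> b \<alpha> g j u0 \<phi>0 \<theta>0 u \<phi> \<theta> \<longleftrightarrow>
     (\<exists>p :: real \<Rightarrow> real^'n \<Rightarrow> real.
       smooth_on (\<lambda>(t, x). u t x) ({0<..} \<times> closure \<Omega>) \<and>
       smooth_on (\<lambda>(t, x). \<phi> t x) ({0<..} \<times> closure \<Omega>) \<and>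
       smooth_on (\<lambda>(t, x). \<theta> t x) ({0<..} \<times> closure \<Omega>) \<and>
       smooth_on (\<lambda>(t, x). p t x) ({0<..} \<times> closure \<Omega>) \<and>
       continuous_on ({0..} \<times> closure \<Omega>) (\<lambda>(t, x). u t x) \<and>
       continuous_on ({0..} \<times> closure \<Omega>) (\<lambda>(t, x). \<phi> t x) \<and>
       continuous_on ({0..} \<times> closure \<Omega>) (\<lambda>(t, x). \<theta> t x) \<and>
       (\<forall>t>0. \<forall>x\<in>\<Omega>.
          vector_derivative (\<lambda>s. u s x) (at t) + convect (u t) (u t) x + grad (p t) x
              - \<nu> *\<^sub>R laplacian (u t) x
            = - tensor_divergence (stress l0 a b \<epsilon> (\<phi> t) (\<theta> t)) x
              - ((1 - \<alpha> * \<theta> t x) * g) *\<^sub>R j \<and>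
          divergence (u t) x = 0 \<and>
          deriv (\<lambda>s. \<phi> s x) t + convect (u t) (\<phi> t) x
            = \<gamma> * (laplacian (\<phi> t) x - deriv (FF \<epsilon>) (\<phi> t x)) \<and>
          deriv (\<lambda>s. \<theta> s x) t + convect (u t) (\<theta> t) x = k * laplacian (\<theta> t) x) \<and>
       (\<forall>t>0. \<forall>x\<in>frontier \<Omega>. u t x = 0 \<and> \<phi> t x = -1 \<and> \<theta> t x = 0) \<and>
       weakly_divergence_free \<Omega> u0 \<and>
       (\<forall>x\<in>\<Omega>. u 0 x = u0 x \<and> \<phi> 0 x = \<phi>0 x \<and> \<theta> 0 x = \<theta>0 x))"

definition energy ::
  "(real^'n) set \<Rightarrow> real \<Rightarrow> real \<Rightarrow> real \<Rightarrow> real \<Rightarrow> real \<Rightarrow>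
   (real \<Rightarrow> real^'n \<Rightarrow> real^'n) \<Rightarrow> (real \<Rightarrow> real^'n \<Rightarrow> real) \<Rightarrow> (real \<Rightarrow> real^'n \<Rightarrow> real) \<Rightarrow> real \<Rightarrow> real" where
  "energy \<Omega> l0 a \<epsilon> \<zeta> \<omega> u \<phi> \<theta> t =
     (L2_norm \<Omega> (u t))\<^sup>2 + a * l0 * (L2_norm \<Omega> (grad (\<phi> t)))\<^sup>2
     + 2 * a * l0 * (LINT x:\<Omega>|lborel. FF \<epsilon> (\<phi> t x))
     + \<zeta> * (L2_norm \<Omega> (grad (\<theta> t)))\<^sup>2 + \<omega> * (L2_norm \<Omega> (\<theta> t))\<^sup>2"

end

theory Submission
  imports Defs
begin

text \<open>Testing the equations with \<open>u\<close>, \<open>\<mu> = \<Delta>\<phi> - F'(\<phi>)\<close>, \<open>\<Delta>\<theta>\<close> and \<open>\<theta>\<close> cancels all terms except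
  \<open>\<integral> \<theta> (\<nabla>\<phi> \<otimes> \<nabla>\<phi>) : \<nabla>u\<close>, \<open>\<integral> (\<nabla>\<theta> \<otimes> \<nabla>\<theta>) : \<nabla>u\<close> and the buoyancy.  The maximum principle gives
  \<open>\<bar>\<phi>\<bar> \<le> 1\<close> and the smallness of \<open>\<theta>\<close>.  The second term is then absorbed through
  \<open>\<parallel>\<nabla>\<theta>\<parallel>\<^sub>4\<^sup>2 \<le> C \<parallel>\<theta>\<parallel>\<^sub>\<infinity> \<parallel>\<Delta>\<theta>\<parallel>\<close> and a small \<open>\<zeta>\<close>, the buoyancy through the Poincare inequality and a large \<open>\<omega>\<close>.

  The first term is the delicate one: \<open>C\<^sub>1\<close> may not depend on \<open>\<epsilon>\<close>, and \<open>\<parallel>\<nabla>\<phi>\<parallel>\<^sub>4\<^sup>2\<close> is not bounded by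
  \<open>\<parallel>\<mu>\<parallel>\<close> uniformly in \<open>\<epsilon>\<close>.  A Bernstein-type argument, applied to
  \<open>P = exp (- B \<rho>) \<bar>\<nabla>w\<bar>\<^sup>2 + A w\<^sup>2\<close> with \<open>w = \<phi> + 1\<close> and a defining function \<open>\<rho>\<close> of the domain, shows that on the
  set where \<open>\<bar>\<nabla>\<phi>\<bar>\<close> exceeds a constant \<open>K(\<epsilon>)\<close> the \<open>L\<^sup>4\<close> norm of \<open>\<nabla>\<phi>\<close> is controlled by \<open>\<mu>\<close> with a universal
  constant.  On the remaining set \<open>\<theta>\<^sup>2 \<bar>\<nabla>\<phi>\<bar>\<^sup>4 \<le> K(\<epsilon>)\<^sup>4 \<theta>\<^sup>2\<close>, which a large \<open>\<omega>\<close> absorbs.\<close>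



section \<open>Calculus of \<open>C\<^sup>k\<close> functions\<close>

text \<open>The obstacle is the size and sign of the reaction. A Hessian bound by \<mu> alone has to
  pass through \<open>\<Delta>\<phi> = \<mu> + F'(\<phi>)\<close>, whose last term is of order
  \<open>1 / \<epsilon>\<^sup>2\<close>. In the divergence of the Bernstein field the third
  derivatives of \<open>w\<close> cancel, and the nonlinearity survives only as \<open>F''\<close>
  times the squared gradient, with \<open>F''\<close> at least
  \<open>- 1 / \<epsilon>\<^sup>2\<close>, and inside \<open>A w \<Delta>w\<close>. The summand
  \<open>A w\<^sup>2\<close> of \<open>P\<close> supplies \<open>A\<close> times the squared
  gradient against the former at the price of the latter, a price that is affordable only where the
  gradient is large; hence the truncation. Truncating in \<open>P\<close> rather than in the squared
  gradient matters because the field starts from half the gradient of \<open>P\<close>: the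
  derivative of the truncation then multiplies a quadratic expression in that gradient, and
  completing the square costs only a multiple of \<open>\<mu>\<^sup>2\<close>. Surface integrals are
  never formed. A cutoff in the defining function takes their place, so only the sign of the
  boundary flux is used.\<close>

lemma has_frechet_derivative:
  "f differentiable (at x) \<Longrightarrow> (f has_derivative frechet_derivative f (at x)) (at x)"
  using frechet_derivative_works by blast

lemma frechet_derivative_eqI:
  "(f has_derivative f') (at x) \<Longrightarrow> frechet_derivative f (at x) = f'"
  using frechet_derivative_at by metis

lemma frechet_derivative_cong_open:
  assumes "open S" "x \<in> S" "\<And>y. y \<in> S \<Longrightarrow> f y = g y"
  shows "frechet_derivative f (at x) = frechet_derivative g (at x)"
proof -
  have "(f has_derivative D) (at x) = (g has_derivative D) (at x)" for D
    using assms has_derivative_transform_within_open[of f D x UNIV S g]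
      has_derivative_transform_within_open[of g D x UNIV S f] by auto
  then show ?thesis by (simp add: frechet_derivative_def)
qed

lemma differentiable_cong_open:
  assumes "open S" "x \<in> S" "\<And>y. y \<in> S \<Longrightarrow> f y = g y" "f differentiable (at x)"
  shows "g differentiable (at x)"
  using assms has_derivative_transform_within_open[of f _ x UNIV S g]
  unfolding differentiable_def by blast

lemma Ck_on_imp_continuous_on: "Ck_on m f S \<Longrightarrow> continuous_on S f"
  by (cases m) (auto intro!: continuous_at_imp_continuous_on differentiable_imp_continuous_within)

lemma Ck_on_differentiable: "Ck_on (Suc m) f S \<Longrightarrow> x \<in> S \<Longrightarrow> f differentiable (at x)"
  by simp

lemma Ck_on_SucD: "Ck_on (Suc m) f S \<Longrightarrow> Ck_on m f S"
  by (induction m arbitrary: f) (use Ck_on_imp_continuous_on[of "Suc 0"] in auto)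

lemma Ck_on_subset: "Ck_on m f S \<Longrightarrow> T \<subseteq> S \<Longrightarrow> Ck_on m f T"
  by (induction m arbitrary: f) (auto intro: continuous_on_subset)

lemma Ck_on_cong:
  assumes "Ck_on m f S" "open S" "\<And>x. x \<in> S \<Longrightarrow> f x = g x"
  shows "Ck_on m g S"
  using assms
proof (induction m arbitrary: f g)
  case 0
  then show ?case using continuous_on_cong[of S S f g] by simp
next
  case (Suc m)
  have "frechet_derivative f (at x) v = frechet_derivative g (at x) v" if "x \<in> S" for x v
    using frechet_derivative_cong_open[OF \<open>open S\<close> that] Suc.prems(3) by metis
  then have "Ck_on m (\<lambda>x. frechet_derivative g (at x) v) S" for v
    using Suc.IH[of "\<lambda>x. frechet_derivative f (at x) v"] Suc.prems by auto
  moreover have "g differentiable (at x)" if "x \<in> S" for x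
    by (rule differentiable_cong_open[OF \<open>open S\<close> that, of f]) (use Suc.prems that in auto)
  ultimately show ?case by simp
qed

lemma Ck_on_Un:
  assumes "open S" "open T" "Ck_on m f S" "Ck_on m f T"
  shows "Ck_on m f (S \<union> T)"
  using assms(3,4) by (induction m arbitrary: f) (auto intro: continuous_on_open_Un assms)

text \<open>\<open>Ck_on\<close> recurses on \<open>frechet_derivative\<close>, a choice operator.
  This rule accepts any explicit family of derivatives instead; the closure rules for linear maps,
  sums, bilinear products and compositions are inductions through it.\<close>

lemma Ck_on_SucI:
  assumes "open S" "\<And>x. x \<in> S \<Longrightarrow> (f has_derivative f' x) (at x)"
    "\<And>v. Ck_on m (\<lambda>x. f' x v) S"
  shows "Ck_on (Suc m) f S"
proof -
  have "Ck_on m (\<lambda>x. frechet_derivative f (at x) v) S" for v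
    using assms(2) by (intro Ck_on_cong[OF assms(3)[of v] \<open>open S\<close>]) (simp add: frechet_derivative_eqI[OF assms(2)])
  then show ?thesis using assms(2) by (auto simp: differentiable_def)
qed

lemma Ck_on_const [intro, simp]: "Ck_on m (\<lambda>x. c) S"
  by (induction m arbitrary: c) auto

lemma Ck_on_bounded_linear_compose:
  assumes "open S" "bounded_linear L" "Ck_on m f S"
  shows "Ck_on m (\<lambda>x. L (f x)) S"
  using assms(3)
proof (induction m arbitrary: f)
  case 0
  then show ?case using bounded_linear.continuous_on[OF assms(2)] by auto
next
  case (Suc m)
  show ?case
    using Suc
    by (intro Ck_on_SucI[where f' = "\<lambda>x v. L (frechet_derivative f (at x) v)"] assms
        bounded_linear.has_derivative[OF assms(2)] has_frechet_derivative Suc.IH) auto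
qed

lemma Ck_on_ident [intro, simp]: "Ck_on m (\<lambda>x. x) S"
  by (cases m) auto

lemma Ck_on_add:
  assumes "open S" "Ck_on m f S" "Ck_on m g S"
  shows "Ck_on m (\<lambda>x. f x + g x) S"
  using assms(2,3)
proof (induction m arbitrary: f g)
  case 0
  then show ?case by (auto intro: continuous_on_add)
next
  case (Suc m)
  then show ?case
    by (intro Ck_on_SucI[where f' = "\<lambda>x v. frechet_derivative f (at x) v + frechet_derivative g (at x) v"]
        assms has_derivative_add has_frechet_derivative Suc.IH) auto
qed

text \<open>The derivative of a bilinear expression is a sum of bilinear expressions, so one
  induction serves products, scalar multiples and inner products. The undifferentiated factor has to
  be lowered from order \<open>Suc m\<close> to \<open>m\<close> before the induction hypothesis
  applies.\<close>

lemma Ck_on_bilinear: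
  assumes "open S" "bounded_bilinear p" "Ck_on m f S" "Ck_on m g S"
  shows "Ck_on m (\<lambda>x. p (f x) (g x)) S"
  using assms(3,4)
proof (induction m arbitrary: f g)
  case 0
  then show ?case by (auto intro: bounded_bilinear.continuous_on[OF assms(2)])
next
  case (Suc m)
  then have fg: "Ck_on m f S" "Ck_on m g S" by (auto dest: Ck_on_SucD simp del: Ck_on.simps)
  show ?case using Suc fg
    by (intro Ck_on_SucI[where f' = "\<lambda>x v. p (f x) (frechet_derivative g (at x) v) +
          p (frechet_derivative f (at x) v) (g x)"] Ck_on_add
        assms bounded_bilinear.FDERIV[OF assms(2)] has_frechet_derivative Suc.IH) auto
qed

lemmas Ck_on_mult = Ck_on_bilinear[OF _ bounded_bilinear_mult]
lemmas Ck_on_scaleR = Ck_on_bilinear[OF _ bounded_bilinear_scaleR]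
lemmas Ck_on_inner = Ck_on_bilinear[OF _ bounded_bilinear_inner]

lemma Ck_on_minus: "open S \<Longrightarrow> Ck_on m f S \<Longrightarrow> Ck_on m (\<lambda>x. - f x) S"
  by (rule Ck_on_bounded_linear_compose) (auto intro: bounded_linear_minus bounded_linear_ident)

lemma Ck_on_diff: "open S \<Longrightarrow> Ck_on m f S \<Longrightarrow> Ck_on m g S \<Longrightarrow> Ck_on m (\<lambda>x. f x - g x) S"
  using Ck_on_add[of S m f "\<lambda>x. - g x"] Ck_on_minus[of S m g] by simp

lemma Ck_on_sum:
  assumes "open S" "\<And>i. i \<in> I \<Longrightarrow> Ck_on m (f i) S"
  shows "Ck_on m (\<lambda>x. \<Sum>i\<in>I. f i x) S"
  using assms(2) by (induction I rule: infinite_finite_induct) (auto intro: Ck_on_add assms)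

lemma Ck_on_power:
  fixes f :: "'a::real_normed_vector \<Rightarrow> real"
  shows "open S \<Longrightarrow> Ck_on m f S \<Longrightarrow> Ck_on m (\<lambda>x. f x ^ k) S"
  by (induction k) (auto intro: Ck_on_mult)

lemma Ck_on_nth: "open S \<Longrightarrow> Ck_on m f S \<Longrightarrow> Ck_on m (\<lambda>x. f x $ i) S"
  by (rule Ck_on_bounded_linear_compose) (auto intro: bounded_linear_vec_nth)

lemma vec_eq_sum_axis: "(x :: real^'n) = (\<Sum>i\<in>UNIV. x $ i *\<^sub>R axis i 1)"
  by (metis (no_types) basis_expansion scalar_mult_eq_scaleR)

lemma Ck_on_vec:
  fixes f :: "'a::real_normed_vector \<Rightarrow> real^'n"
  assumes "open S" "\<And>i. Ck_on m (\<lambda>x. f x $ i) S"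
  shows "Ck_on m f S"
proof -
  have "Ck_on m (\<lambda>x. \<Sum>i\<in>UNIV. f x $ i *\<^sub>R axis i 1) S"
    by (intro Ck_on_sum Ck_on_scaleR assms Ck_on_const)
  then show ?thesis by (subst (asm) vec_eq_sum_axis[symmetric])
qed

lemma Ck_on_compose_real:
  fixes f :: "'a::real_normed_vector \<Rightarrow> real" and g :: "real \<Rightarrow> real"
  assumes "open S" "Ck_on m f S" "Ck_on m g V" "f ` S \<subseteq> V"
  shows "Ck_on m (\<lambda>x. g (f x)) S"
  using assms(2,3)
proof (induction m arbitrary: g)
  case 0
  then show ?case using assms(4) continuous_on_compose2 by (auto intro: continuous_on_compose2)
next
  case (Suc m)
  have f: "Ck_on m f S" using Suc.prems by (auto dest: Ck_on_SucD simp del: Ck_on.simps)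
  show ?case
  proof (rule Ck_on_SucI[where f' = "\<lambda>x v. frechet_derivative f (at x) v * frechet_derivative g (at (f x)) 1"])
    fix x assume x: "x \<in> S"
    have g: "g differentiable (at (f x))" using Suc.prems(2) x assms(4) by auto
    have "frechet_derivative g (at (f x)) w = w * frechet_derivative g (at (f x)) 1" for w
      using linear_frechet_derivative[OF g] linear_cmul[of "frechet_derivative g (at (f x))" w 1] by simp
    then show "((\<lambda>x. g (f x)) has_derivative (\<lambda>v. frechet_derivative f (at x) v * frechet_derivative g (at (f x)) 1)) (at x)"
      using has_derivative_compose[OF has_frechet_derivative[of f x] has_frechet_derivative[OF g]] Suc.prems(1) x
      by (metis (no_types, lifting) Ck_on_differentiable ext)
  next
    fix v
    have "Ck_on m (\<lambda>x. frechet_derivative g (at (f x)) 1) S"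
      using Suc.IH[of "\<lambda>y. frechet_derivative g (at y) 1"] f Suc.prems(2) by simp
    then show "Ck_on m (\<lambda>x. frechet_derivative f (at x) v * frechet_derivative g (at (f x)) 1) S"
      using Suc.prems(1) by (intro Ck_on_mult assms(1)) auto
  qed (rule assms(1))
qed

lemma Ck_on_SucI_real:
  fixes g :: "real \<Rightarrow> real"
  assumes "open S" "\<And>s. s \<in> S \<Longrightarrow> (g has_real_derivative g' s) (at s)" "Ck_on m g' S"
  shows "Ck_on (Suc m) g S"
  using assms by (intro Ck_on_SucI[where f' = "\<lambda>x v. g' x * v"] Ck_on_mult)
    (auto simp: has_field_derivative_def)

lemma Ck_on_exp: "Ck_on m (exp :: real \<Rightarrow> real) UNIV"
  by (induction m) (auto intro!: continuous_intros Ck_on_SucI_real derivative_eq_intros simp del: Ck_on.simps(2))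

lemma Ck_on_frechet_derivative:
  "Ck_on (Suc m) f S \<Longrightarrow> Ck_on m (\<lambda>x. frechet_derivative f (at x) v) S"
  by simp

text \<open>The derivative of a slice feeds \<open>(0, v)\<close> to the derivative of
  \<open>f\<close>, and that directional derivative is again a function on \<open>W\<close> of one
  order less, to which the induction hypothesis applies.\<close>

lemma Ck_on_slice:
  fixes f :: "'a::real_normed_vector \<times> 'b::real_normed_vector \<Rightarrow> 'c::real_normed_vector"
  assumes "open W" "Ck_on m f W"
  shows "Ck_on m (\<lambda>x. f (t, x)) {x. (t, x) \<in> W}"
  using assms(2)
proof (induction m arbitrary: f)
  case 0
  then show ?case by (auto intro!: continuous_on_compose2[of W f] continuous_intros)
next
  case (Suc m)
  have op: "open {x. (t, x) \<in> W}"
    using open_vimage[OF \<open>open W\<close>, of "\<lambda>x. (t, x)"] by (simp add: vimage_def continuous_intros)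
  show ?case
  proof (rule Ck_on_SucI[OF op, where f' = "\<lambda>x v. frechet_derivative f (at (t, x)) (0, v)"])
    fix x assume "x \<in> {x. (t, x) \<in> W}"
    then have f: "(f has_derivative frechet_derivative f (at (t, x))) (at (t, x))"
      using Suc.prems by (auto intro: has_frechet_derivative)
    show "((\<lambda>x. f (t, x)) has_derivative (\<lambda>v. frechet_derivative f (at (t, x)) (0, v))) (at x)"
      by (rule has_derivative_compose[of "\<lambda>x. (t, x)" "\<lambda>v. (0, v)" x UNIV f,
            OF has_derivative_Pair[OF has_derivative_const has_derivative_ident] f])
  qed (use Suc in auto)
qed

lemma has_derivative_line:
  assumes "(f has_derivative f') (at (x + s *\<^sub>R v))"
  shows "((\<lambda>s. f (x + s *\<^sub>R v)) has_vector_derivative f' v) (at s)"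
proof -
  have "((\<lambda>s. f (x + s *\<^sub>R v)) has_derivative (\<lambda>h. f' (h *\<^sub>R v))) (at s)"
    by (rule has_derivative_compose[of "\<lambda>s. x + s *\<^sub>R v" "\<lambda>h. h *\<^sub>R v"])
      (use assms in \<open>auto intro!: derivative_eq_intros\<close>)
  then show ?thesis
    using linear_cmul[OF has_derivative_linear[OF assms]] by (simp add: has_vector_derivative_def)
qed

lemma has_derivative_line_real:
  fixes f :: "'a::real_normed_vector \<Rightarrow> real"
  assumes "(f has_derivative f') (at (x + s *\<^sub>R v))"
  shows "((\<lambda>s. f (x + s *\<^sub>R v)) has_real_derivative f' v) (at s)"
  using has_derivative_line[OF assms] by (simp add: has_real_derivative_iff_has_vector_derivative)

section \<open>Symmetry of second derivatives\<close>

text \<open>The mean value theorem is used twice: in direction \<open>u\<close> for the increment of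
  \<open>f\<close> along \<open>h *\<^sub>R v\<close>, then in direction \<open>v\<close> for the
  directional derivative that results.\<close>

lemma second_difference_mvt:
  fixes f :: "'a::real_normed_vector \<Rightarrow> real"
  assumes B: "\<And>s t. 0 \<le> s \<Longrightarrow> s \<le> h \<Longrightarrow> 0 \<le> t \<Longrightarrow> t \<le> h \<Longrightarrow> x + s *\<^sub>R u + t *\<^sub>R v \<in> W"
    and f: "Ck_on (Suc (Suc 0)) f W" and "h > 0"
  obtains s t where "0 < s" "s < h" "0 < t" "t < h"
    "f (x + h *\<^sub>R u + h *\<^sub>R v) - f (x + h *\<^sub>R u) - f (x + h *\<^sub>R v) + f x =
     h * h * frechet_derivative (\<lambda>y. frechet_derivative f (at y) u) (at (x + s *\<^sub>R u + t *\<^sub>R v)) v"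
proof -
  let ?d = "\<lambda>y. frechet_derivative f (at y) u"
  define g where "g s = f (x + s *\<^sub>R u + h *\<^sub>R v) - f (x + s *\<^sub>R u)" for s
  have f1: "f differentiable (at y)" if "y \<in> W" for y using f that by simp
  have f2: "?d differentiable (at y)" if "y \<in> W" for y using f that by simp
  have g: "DERIV g s :> ?d (x + s *\<^sub>R u + h *\<^sub>R v) - ?d (x + s *\<^sub>R u)" if "0 \<le> s" "s \<le> h" for s
  proof -
    have "((\<lambda>s. f (x + h *\<^sub>R v + s *\<^sub>R u)) has_real_derivative ?d (x + h *\<^sub>R v + s *\<^sub>R u)) (at s)"
      using B[of s h] that by (intro has_derivative_line_real has_frechet_derivative f1) (simp add: add_ac)
    moreover have "((\<lambda>s. f (x + s *\<^sub>R u)) has_real_derivative ?d (x + s *\<^sub>R u)) (at s)"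
      using B[of s 0] that by (intro has_derivative_line_real has_frechet_derivative f1) (simp add: add_ac)
    ultimately show ?thesis unfolding g_def by (auto intro!: derivative_eq_intros simp: add_ac)
  qed
  obtain s where s: "0 < s" "s < h" "g h - g 0 = h * (?d (x + s *\<^sub>R u + h *\<^sub>R v) - ?d (x + s *\<^sub>R u))"
    using MVT2[OF \<open>h > 0\<close> g] by auto
  have "((\<lambda>t. ?d (x + s *\<^sub>R u + t *\<^sub>R v)) has_real_derivative
      frechet_derivative ?d (at (x + s *\<^sub>R u + t *\<^sub>R v)) v) (at t)" if "0 \<le> t" "t \<le> h" for t
    using B[of s t] that s by (intro has_derivative_line_real has_frechet_derivative f2) auto
  from MVT2[of 0 h "\<lambda>t. ?d (x + s *\<^sub>R u + t *\<^sub>R v)", OF \<open>h > 0\<close> this]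
  obtain t where t: "0 < t" "t < h" "?d (x + s *\<^sub>R u + h *\<^sub>R v) - ?d (x + s *\<^sub>R u) =
      h * frechet_derivative ?d (at (x + s *\<^sub>R u + t *\<^sub>R v)) v" by auto
  show ?thesis
    using that[OF s(1,2) t(1,2)] s(3) t(3) by (simp add: g_def algebra_simps)
qed

text \<open>The second difference over a small parallelogram is symmetric in \<open>u\<close> and
  \<open>v\<close>, and \<open>second_difference_mvt\<close> equates it with either mixed derivative
  at some nearby point. By continuity these are within \<open>e\<close> of their values at
  \<open>x\<close>, which therefore cannot be \<open>2 * e\<close> apart.\<close>

lemma frechet_derivative_commute:
  fixes f :: "'a::real_normed_vector \<Rightarrow> real"
  assumes "open W" "Ck_on (Suc (Suc 0)) f W" "x \<in> W"
  shows "frechet_derivative (\<lambda>y. frechet_derivative f (at y) u) (at x) v =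
         frechet_derivative (\<lambda>y. frechet_derivative f (at y) v) (at x) u"
    (is "?a x = ?b x")
proof (rule ccontr)
  assume neq: "?a x \<noteq> ?b x"
  define e where "e = \<bar>?a x - ?b x\<bar> / 2"
  have e: "e > 0" using neq by (simp add: e_def)
  have "continuous_on W ?a" "continuous_on W ?b"
    using assms(2) by auto
  then have "isCont ?a x" "isCont ?b x"
    using assms continuous_on_eq_continuous_at by blast+
  then obtain d1 d2 where d: "d1 > 0" "\<And>y. dist y x < d1 \<Longrightarrow> \<bar>?a y - ?a x\<bar> < e"
      "d2 > 0" "\<And>y. dist y x < d2 \<Longrightarrow> \<bar>?b y - ?b x\<bar> < e"
    using e unfolding continuous_at_eps_delta dist_real_def by metis
  obtain d3 where d3: "d3 > 0" "ball x d3 \<subseteq> W" using assms open_contains_ball by blast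
  define r where "r = min d1 (min d2 d3)"
  \<comment> \<open>Keeps the parallelogram of side \<open>h\<close> in the ball of radius
    \<open>r\<close>; the summand 1 makes the denominator positive even when \<open>u\<close> and
    \<open>v\<close> vanish.\<close>
  define h where "h = r / (norm u + norm v + 1) / 2"
  have r: "r > 0" using d d3 by (simp add: r_def)
  have h: "h > 0" using r by (auto simp: h_def intro!: divide_pos_pos add_nonneg_pos)
  have near: "dist (x + s *\<^sub>R u + t *\<^sub>R v) x < r" if "0 \<le> s" "s \<le> h" "0 \<le> t" "t \<le> h" for s t
  proof -
    have "dist (x + s *\<^sub>R u + t *\<^sub>R v) x \<le> s * norm u + t * norm v"
      using norm_triangle_ineq[of "s *\<^sub>R u" "t *\<^sub>R v"] that by (simp add: dist_norm add.assoc)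
    also have "\<dots> \<le> h * norm u + h * norm v"
      using that by (intro add_mono mult_right_mono) auto
    also have "\<dots> < h * (norm u + norm v + 1)" using h by (simp add: algebra_simps)
    also have "\<dots> = r / 2"
      using add_nonneg_pos[of "norm u + norm v" 1] by (simp add: h_def field_simps)
    finally show ?thesis using r by simp
  qed
  then have W: "x + s *\<^sub>R u + t *\<^sub>R v \<in> W" if "0 \<le> s" "s \<le> h" "0 \<le> t" "t \<le> h" for s t
    using that d3 by (fastforce simp: r_def dist_commute)
  obtain s t where st: "0 < s" "s < h" "0 < t" "t < h"
    "f (x + h *\<^sub>R u + h *\<^sub>R v) - f (x + h *\<^sub>R u) - f (x + h *\<^sub>R v) + f x = h * h * ?a (x + s *\<^sub>R u + t *\<^sub>R v)"
    using second_difference_mvt[OF W assms(2) h] by blast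
  have W': "x + s *\<^sub>R v + t *\<^sub>R u \<in> W" if "0 \<le> s" "s \<le> h" "0 \<le> t" "t \<le> h" for s t
    using W[of t s] that by (simp add: add_ac)
  obtain s' t' where st': "0 < s'" "s' < h" "0 < t'" "t' < h"
    "f (x + h *\<^sub>R v + h *\<^sub>R u) - f (x + h *\<^sub>R v) - f (x + h *\<^sub>R u) + f x = h * h * ?b (x + s' *\<^sub>R v + t' *\<^sub>R u)"
    using second_difference_mvt[OF W' assms(2) h] by blast
  have "h * h * ?a (x + s *\<^sub>R u + t *\<^sub>R v) = h * h * ?b (x + s' *\<^sub>R v + t' *\<^sub>R u)"
    using st(5) st'(5) by (simp only: add_ac)
  then have "?a (x + s *\<^sub>R u + t *\<^sub>R v) = ?b (x + s' *\<^sub>R v + t' *\<^sub>R u)" using h by simp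
  moreover have "\<bar>?a (x + s *\<^sub>R u + t *\<^sub>R v) - ?a x\<bar> < e"
    using near[of s t] st by (intro d) (auto simp: r_def)
  moreover have "\<bar>?b (x + s' *\<^sub>R v + t' *\<^sub>R u) - ?b x\<bar> < e"
    using near[of t' s'] st' by (intro d) (auto simp: r_def add_ac)
  ultimately have "\<bar>?a x - ?b x\<bar> < 2 * e" by linarith
  then show False by (simp add: e_def)
qed


section \<open>Gradient and divergence\<close>

lemma partial_eq_grad: "partial i f x = grad f x $ i"
  by (simp add: grad_def)

lemma frechet_derivative_eq_grad:
  assumes "f differentiable (at x)"
  shows "frechet_derivative f (at x) v = grad f x \<bullet> v"
proof -
  have l: "linear (frechet_derivative f (at x))" by (rule linear_frechet_derivative[OF assms])
  have "frechet_derivative f (at x) v = frechet_derivative f (at x) (\<Sum>i\<in>UNIV. v $ i *\<^sub>R axis i 1)"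
    by (simp flip: vec_eq_sum_axis)
  also have "\<dots> = (\<Sum>i\<in>UNIV. v $ i * frechet_derivative f (at x) (axis i 1))"
    by (simp add: linear_sum[OF l] linear_cmul[OF l])
  also have "\<dots> = grad f x \<bullet> v"
    by (simp add: grad_def partial_def inner_vec_def mult.commute)
  finally show ?thesis .
qed

lemma has_derivative_grad:
  "f differentiable (at x) \<Longrightarrow> (f has_derivative (\<lambda>v. grad f x \<bullet> v)) (at x)"
  by (metis (no_types, lifting) ext frechet_derivative_eq_grad has_frechet_derivative)

lemma grad_eqI: "(f has_derivative (\<lambda>v. g \<bullet> v)) (at x) \<Longrightarrow> grad f x = g"
  by (simp add: grad_def partial_def frechet_derivative_eqI vec_eq_iff inner_axis)

lemma grad_cong_open:
  "open S \<Longrightarrow> x \<in> S \<Longrightarrow> (\<And>y. y \<in> S \<Longrightarrow> f y = g y) \<Longrightarrow> grad f x = grad g x"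
  unfolding grad_def partial_def by (simp add: frechet_derivative_cong_open[of S x f g])

lemma partial_cong_open:
  "open S \<Longrightarrow> x \<in> S \<Longrightarrow> (\<And>y. y \<in> S \<Longrightarrow> f y = g y) \<Longrightarrow> partial i f x = partial i g x"
  unfolding partial_def by (simp add: frechet_derivative_cong_open[of S x f g])

lemma grad_const: "grad (\<lambda>x. c) x = 0"
  by (rule grad_eqI) (simp add: has_derivative_const)

lemma grad_add:
  "f differentiable (at x) \<Longrightarrow> g differentiable (at x) \<Longrightarrow> grad (\<lambda>y. f y + g y) x = grad f x + grad g x"
  by (rule grad_eqI) (auto simp: inner_add_left intro!: has_derivative_add has_derivative_grad)

lemma grad_diff:
  "f differentiable (at x) \<Longrightarrow> g differentiable (at x) \<Longrightarrow> grad (\<lambda>y. f y - g y) x = grad f x - grad g x"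
  by (rule grad_eqI) (auto simp: inner_diff_left intro!: has_derivative_diff has_derivative_grad)

lemma grad_mult:
  assumes "f differentiable (at x)" "g differentiable (at x)"
  shows "grad (\<lambda>y. f y * g y) x = f x *\<^sub>R grad g x + g x *\<^sub>R grad f x"
  by (rule grad_eqI) (use has_derivative_mult[OF assms[THEN has_derivative_grad]] in
      \<open>simp add: inner_add_left mult.commute\<close>)

lemma grad_compose:
  assumes "f differentiable (at x)" "(g has_real_derivative d) (at (f x))"
  shows "grad (\<lambda>y. g (f y)) x = d *\<^sub>R grad f x"
  by (rule grad_eqI)
    (use has_derivative_compose[OF has_derivative_grad[OF assms(1)] assms(2)[unfolded has_field_derivative_def]]
      in simp)

lemma grad_sum:
  assumes "\<And>i. i \<in> I \<Longrightarrow> f i differentiable (at x)"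
  shows "grad (\<lambda>y. \<Sum>i\<in>I. f i y) x = (\<Sum>i\<in>I. grad (f i) x)"
  by (rule grad_eqI) (use assms in \<open>auto simp: inner_sum_left intro!: has_derivative_sum has_derivative_grad\<close>)

lemma partial_mult:
  fixes f g :: "real^'n \<Rightarrow> real"
  shows "f differentiable (at x) \<Longrightarrow> g differentiable (at x) \<Longrightarrow>
    partial i (\<lambda>y. f y * g y) x = f x * partial i g x + g x * partial i f x"
  by (simp add: partial_eq_grad grad_mult)

lemma partial_sum:
  fixes f :: "'b \<Rightarrow> real^'n \<Rightarrow> real"
  shows "(\<And>k. k \<in> I \<Longrightarrow> f k differentiable (at x)) \<Longrightarrow>
    partial i (\<lambda>y. \<Sum>k\<in>I. f k y) x = (\<Sum>k\<in>I. partial i (f k) x)"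
  by (simp add: partial_eq_grad grad_sum)

lemma grad_nth_coord: "grad (\<lambda>y. y $ i) x = axis i 1"
  by (rule grad_eqI) (use bounded_linear_imp_has_derivative[OF bounded_linear_vec_nth, of i "at x"] in
      \<open>simp add: inner_axis'\<close>)

lemma differentiable_nth: "v differentiable (at x) \<Longrightarrow> (\<lambda>y. v y $ i) differentiable (at x)"
  unfolding differentiable_def by (blast intro: bounded_linear.has_derivative[OF bounded_linear_vec_nth])

lemma vgrad_nth: "vgrad v x $ i = grad (\<lambda>y. v y $ i) x"
  by (simp add: vgrad_def grad_def)

lemma divergence_eq_vgrad: "divergence v x = (\<Sum>i\<in>UNIV. vgrad v x $ i $ i)"
  by (simp add: divergence_def vgrad_def)

lemma divergence_cong_open:
  "open S \<Longrightarrow> x \<in> S \<Longrightarrow> (\<And>y. y \<in> S \<Longrightarrow> f y = g y) \<Longrightarrow> divergence f x = divergence g x"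
  unfolding divergence_def by (intro sum.cong refl partial_cong_open[of S x]) auto

lemma divergence_add:
  "v differentiable (at x) \<Longrightarrow> w differentiable (at x) \<Longrightarrow>
    divergence (\<lambda>y. v y + w y) x = divergence v x + divergence w x"
  by (simp add: divergence_def partial_eq_grad grad_add differentiable_nth sum.distrib)

lemma divergence_diff:
  "v differentiable (at x) \<Longrightarrow> w differentiable (at x) \<Longrightarrow>
    divergence (\<lambda>y. v y - w y) x = divergence v x - divergence w x"
  by (simp add: divergence_def partial_eq_grad grad_diff differentiable_nth sum_subtractf)

lemma divergence_scaleR:
  "f differentiable (at x) \<Longrightarrow> v differentiable (at x) \<Longrightarrow>
    divergence (\<lambda>y. f y *\<^sub>R v y) x = f x * divergence v x + grad f x \<bullet> v x"
  by (simp add: divergence_def partial_eq_grad grad_mult differentiable_nth sum.distrib sum_distrib_left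
      inner_vec_def mult.commute)

lemma laplacian_eq_divergence: "laplacian f x = divergence (grad f) x"
  by (simp add: laplacian_def divergence_def grad_def)

lemma grad_inner:
  assumes "v differentiable (at x)" "w differentiable (at x)"
  shows "grad (\<lambda>y. v y \<bullet> w y) x = transpose (vgrad v x) *v w x + transpose (vgrad w x) *v v x"
proof -
  have "grad (\<lambda>y. v y \<bullet> w y) x = grad (\<lambda>y. \<Sum>i\<in>UNIV. v y $ i * w y $ i) x"
    by (simp add: inner_vec_def)
  also have "\<dots> = (\<Sum>i\<in>UNIV. v x $ i *\<^sub>R grad (\<lambda>y. w y $ i) x + w x $ i *\<^sub>R grad (\<lambda>y. v y $ i) x)"
    using assms by (subst grad_sum) (auto intro!: differentiable_mult differentiable_nth sum.cong grad_mult)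
  also have "\<dots> = transpose (vgrad v x) *v w x + transpose (vgrad w x) *v v x"
    by (simp add: vec_eq_iff matrix_vector_mult_def transpose_def vgrad_nth sum.distrib mult.commute)
  finally show ?thesis .
qed

lemma Ck_on_partial: "Ck_on (Suc m) f S \<Longrightarrow> Ck_on m (partial i f) S"
  unfolding partial_def[abs_def] by simp

lemma Ck_on_grad: "open S \<Longrightarrow> Ck_on (Suc m) f S \<Longrightarrow> Ck_on m (grad f) S"
  by (intro Ck_on_vec) (auto simp: Ck_on_partial simp flip: partial_eq_grad simp del: Ck_on.simps)

lemma Ck_on_vgrad_nth: "open S \<Longrightarrow> Ck_on (Suc m) v S \<Longrightarrow> Ck_on m (\<lambda>x. vgrad v x $ i $ j) S"
  by (simp add: vgrad_def Ck_on_partial Ck_on_nth del: Ck_on.simps)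

lemma Ck_on_divergence: "open S \<Longrightarrow> Ck_on (Suc m) v S \<Longrightarrow> Ck_on m (divergence v) S"
  unfolding divergence_def[abs_def] by (intro Ck_on_sum Ck_on_partial Ck_on_nth)

lemma Ck_on_laplacian:
  fixes f :: "real^'n \<Rightarrow> real"
  shows "open S \<Longrightarrow> Ck_on (Suc (Suc m)) f S \<Longrightarrow> Ck_on m (laplacian f) S"
  unfolding laplacian_eq_divergence[abs_def] by (intro Ck_on_divergence Ck_on_grad)

lemma partial_commute:
  fixes f :: "real^'n \<Rightarrow> real"
  assumes "open S" "Ck_on (Suc (Suc 0)) f S" "x \<in> S"
  shows "partial i (partial j f) x = partial j (partial i f) x"
  unfolding partial_def[abs_def] by (rule frechet_derivative_commute[OF assms])

lemma hessian_symmetric: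
  assumes "open S" "Ck_on (Suc (Suc 0)) f S" "x \<in> S"
  shows "transpose (vgrad (grad f) x) = vgrad (grad f) x"
  using partial_commute[OF assms]
  by (simp add: vec_eq_iff transpose_def vgrad_def grad_def)

lemma norm_matrix_sq: "(norm (A :: real^'n^'m))\<^sup>2 = (\<Sum>i\<in>UNIV. \<Sum>j\<in>UNIV. (A $ i $ j)\<^sup>2)"
  by (simp add: norm_vec_def L2_set_def sum_nonneg)

lemma norm_matrix_vector_mult_le: "norm ((A :: real^'n^'m) *v x) \<le> norm A * norm x"
proof -
  have "(norm (A *v x))\<^sup>2 = (\<Sum>i\<in>UNIV. (A $ i \<bullet> x)\<^sup>2)"
    by (simp add: norm_vec_def L2_set_def sum_nonneg matrix_vector_mult_def inner_vec_def)
  also have "\<dots> \<le> (\<Sum>i\<in>UNIV. (norm (A $ i))\<^sup>2 * (norm x)\<^sup>2)"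
    by (intro sum_mono) (metis Cauchy_Schwarz_ineq power2_norm_eq_inner)
  also have "\<dots> = (norm A * norm x)\<^sup>2"
    by (simp add: power_mult_distrib sum_distrib_right[symmetric] norm_vec_def[of A] L2_set_def sum_nonneg)
  finally show ?thesis by (rule power2_le_imp_le) simp
qed

text \<open>Cauchy-Schwarz against the vector of ones bounds the squared trace by the squared
  diagonal entries, which are part of the Frobenius norm. In this way the Hessian controls the
  Laplacian.\<close>

lemma matrix_trace_sq_le:
  fixes A :: "real^'n^'n"
  shows "(\<Sum>i\<in>UNIV. A $ i $ i)\<^sup>2 \<le> CARD('n) * (norm A)\<^sup>2"
proof -
  have "(\<Sum>i\<in>UNIV. 1 * A $ i $ i)\<^sup>2 \<le> (\<Sum>i\<in>(UNIV :: 'n set). 1\<^sup>2) * (\<Sum>i\<in>UNIV. (A $ i $ i)\<^sup>2)"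
    by (rule Cauchy_Schwarz_ineq_sum)
  also have "(\<Sum>i\<in>UNIV. (A $ i $ i)\<^sup>2) \<le> (\<Sum>i\<in>UNIV. \<Sum>j\<in>UNIV. (A $ i $ j)\<^sup>2)"
    by (intro sum_mono) (rule member_le_sum, auto)
  finally show ?thesis by (simp add: norm_matrix_sq)
qed

lemma laplacian_sq_le:
  fixes f :: "real^'n \<Rightarrow> real"
  shows "(laplacian f x)\<^sup>2 \<le> CARD('n) * (norm (vgrad (grad f) x))\<^sup>2"
  unfolding laplacian_eq_divergence divergence_eq_vgrad by (rule matrix_trace_sq_le)

lemma grad_norm_grad_sq:
  assumes "open S" "Ck_on (Suc (Suc 0)) f S" "x \<in> S"
  shows "grad (\<lambda>y. (norm (grad f y))\<^sup>2) x = 2 *\<^sub>R (vgrad (grad f) x *v grad f x)"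
proof -
  have "grad f differentiable (at x)"
    using Ck_on_grad[OF assms(1,2)] assms(3) by (rule Ck_on_differentiable)
  then show ?thesis
    by (simp add: power2_norm_eq_inner grad_inner hessian_symmetric[OF assms] scaleR_2)
qed

text \<open>Bochner's identity: by \<open>grad_norm_grad_sq\<close> the field is half the gradient
  of the squared gradient norm. Commuting derivatives turns the third-order terms into the gradient
  of the Laplacian and the products of second derivatives into squares.\<close>

lemma divergence_hessian_grad:
  assumes S: "open S" "x \<in> S" and f: "Ck_on (Suc (Suc (Suc 0))) f S"
  shows "divergence (\<lambda>y. vgrad (grad f) y *v grad f y) x =
    (norm (vgrad (grad f) x))\<^sup>2 + grad f x \<bullet> grad (laplacian f) x"
proof -
  have f2: "Ck_on (Suc (Suc 0)) f S" using f by (rule Ck_on_SucD)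
  have d1: "partial i f differentiable (at x)" for i
    using Ck_on_partial[OF f2] S(2) by (rule Ck_on_differentiable)
  have d2: "partial j (partial i f) differentiable (at x)" for i j
    using Ck_on_partial[OF Ck_on_partial[OF f]] S(2) by (rule Ck_on_differentiable)
  have comm: "partial i (partial j (partial i f)) x = partial j (partial i (partial i f)) x" for i j
    by (rule partial_commute[OF S(1) Ck_on_partial[OF f] S(2)])
  have "divergence (\<lambda>y. vgrad (grad f) y *v grad f y) x =
     (\<Sum>i\<in>UNIV. partial i (\<lambda>y. \<Sum>j\<in>UNIV. partial j (partial i f) y * partial j f y) x)"
    by (simp add: divergence_def matrix_vector_mult_def vgrad_def grad_def)
  also have "\<dots> = (\<Sum>i\<in>UNIV. \<Sum>j\<in>UNIV. partial j (partial i f) x * partial i (partial j f) x +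
      partial j f x * partial i (partial j (partial i f)) x)"
    using d1 d2 by (simp add: partial_sum partial_mult)
  also have "\<dots> = (\<Sum>i\<in>UNIV. \<Sum>j\<in>UNIV. (partial j (partial i f) x)\<^sup>2) +
      (\<Sum>i\<in>UNIV. \<Sum>j\<in>UNIV. partial j f x * partial j (partial i (partial i f)) x)"
  proof -
    have "partial j (partial i f) x * partial i (partial j f) x + partial j f x * partial i (partial j (partial i f)) x =
        (partial j (partial i f) x)\<^sup>2 + partial j f x * partial j (partial i (partial i f)) x" for i j
      using comm[of i j] partial_commute[OF S(1) f2 S(2), of i j] by (simp add: power2_eq_square)
    then show ?thesis by (simp add: sum.distrib)
  qed
  also have "(\<Sum>i\<in>UNIV. \<Sum>j\<in>UNIV. partial j f x * partial j (partial i (partial i f)) x) =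
      (\<Sum>j\<in>UNIV. partial j f x * (\<Sum>i\<in>UNIV. partial j (partial i (partial i f)) x))"
    by (subst sum.swap) (simp add: sum_distrib_left)
  also have "\<dots> = grad f x \<bullet> grad (laplacian f) x"
    using d2 by (simp add: inner_vec_def laplacian_def[abs_def] partial_sum flip: partial_eq_grad)
  finally show ?thesis
    by (simp add: norm_matrix_sq vgrad_def grad_def)
qed

section \<open>Cutoff functions\<close>

text \<open>Only the kink needs care: there the difference quotient is at most
  \<open>\<bar>h\<bar> ^ Suc n\<close>, which tends to 0.\<close>

lemma has_real_derivative_max_power:
  "((\<lambda>s. (max 0 (s - K)) ^ Suc (Suc n)) has_real_derivative real (Suc (Suc n)) * (max 0 (s - K)) ^ Suc n) (at s)"
proof -
  consider "s < K" | "s > K" | "s = K" by linarith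
  then show ?thesis
  proof cases
    case 1
    have "((\<lambda>s. 0) has_real_derivative 0) (at s)" by simp
    then have "((\<lambda>s. (max 0 (s - K)) ^ Suc (Suc n)) has_real_derivative 0) (at s)"
      by (rule DERIV_cong_ev[THEN iffD1, rotated -1, OF _ refl _ refl])
        (use 1 in \<open>auto intro!: eventually_mono[OF eventually_nhds_in_open[of "{..<K}"]]\<close>)
    then show ?thesis using 1 by simp
  next
    case 2
    have "((\<lambda>s. (s - K) ^ Suc (Suc n)) has_real_derivative real (Suc (Suc n)) * (s - K) ^ Suc n) (at s)"
      by (rule derivative_eq_intros refl | simp)+
    then have "((\<lambda>s. (max 0 (s - K)) ^ Suc (Suc n)) has_real_derivative real (Suc (Suc n)) * (s - K) ^ Suc n) (at s)"
      by (rule DERIV_cong_ev[THEN iffD1, rotated -1, OF _ refl _ refl])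
        (use 2 in \<open>auto intro!: eventually_mono[OF eventually_nhds_in_open[of "{K<..}"]]\<close>)
    then show ?thesis using 2 by simp
  next
    case 3
    have "((\<lambda>h. max 0 h ^ Suc (Suc n) / h) \<longlongrightarrow> 0) (at (0::real))"
    proof (rule Lim_null_comparison)
      show "\<forall>\<^sub>F h in at (0::real). norm (max 0 h ^ Suc (Suc n) / h) \<le> \<bar>h\<bar> ^ Suc n"
        by (rule always_eventually) (auto simp: max_def mult_nonpos_nonneg)
      have "((\<lambda>h::real. \<bar>h\<bar> ^ Suc n) \<longlongrightarrow> \<bar>0\<bar> ^ Suc n) (at 0)" by (intro tendsto_intros)
      then show "((\<lambda>h::real. \<bar>h\<bar> ^ Suc n) \<longlongrightarrow> 0) (at 0)" by simp
    qed
    then show ?thesis using 3 by (simp add: DERIV_def)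
  qed
qed

text \<open>\<open>K\<close> is both the threshold and the width of the transition. It is used in
  two regimes: \<open>K\<close> tending to 0 with \<open>s = - \<rho> x\<close>, where it localizes
  to the interior of the domain, and a fixed level \<open>K\<close> with \<open>s\<close> a gradient
  quantity, where it truncates from below. The rational profile makes the derivative bounds
  explicit.\<close>

definition cutoff :: "real \<Rightarrow> real \<Rightarrow> real" where
  "cutoff K s = (max 0 (s - K))\<^sup>2 / ((max 0 (s - K))\<^sup>2 + K\<^sup>2)"

definition cutoff_deriv :: "real \<Rightarrow> real \<Rightarrow> real" where
  "cutoff_deriv K s = 2 * max 0 (s - K) * K\<^sup>2 / ((max 0 (s - K))\<^sup>2 + K\<^sup>2)\<^sup>2"

lemma has_real_derivative_cutoff:
  assumes "K > 0"
  shows "(cutoff K has_real_derivative cutoff_deriv K s) (at s)"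
proof -
  have d: "((\<lambda>s. (max 0 (s - K))\<^sup>2) has_real_derivative 2 * max 0 (s - K)) (at s)"
    using has_real_derivative_max_power[of K 0 s] by (simp add: numeral_2_eq_2)
  have pos: "(max 0 (s - K))\<^sup>2 + K\<^sup>2 \<noteq> 0" using assms by (simp add: add_nonneg_eq_0_iff)
  show ?thesis unfolding cutoff_def[abs_def] cutoff_deriv_def
    by (rule DERIV_cong[OF DERIV_divide[OF d DERIV_add[OF d DERIV_const] pos]])
      (simp add: power2_eq_square[of "_ + _"] algebra_simps)
qed

lemma Ck_on_cutoff: "K > 0 \<Longrightarrow> Ck_on (Suc 0) (cutoff K) UNIV"
proof (rule Ck_on_SucI_real[OF _ has_real_derivative_cutoff])
  assume "K > 0"
  then have "(max 0 (s - K))\<^sup>2 + K\<^sup>2 \<noteq> 0" for s by (simp add: add_nonneg_eq_0_iff)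
  then show "Ck_on 0 (cutoff_deriv K) UNIV"
    unfolding cutoff_deriv_def[abs_def] by (auto intro!: continuous_intros)
qed auto

lemma cutoff_bounds: "0 \<le> cutoff K s" "cutoff K s \<le> 1"
proof -
  have "x / (x + y) \<le> 1" if "x \<ge> 0" "y \<ge> 0" for x y :: real
    using that by (cases "x + y = 0") (auto simp: divide_le_eq)
  then show "0 \<le> cutoff K s" "cutoff K s \<le> 1" by (simp_all add: cutoff_def)
qed

lemma cutoff_eq_0: "s \<le> K \<Longrightarrow> cutoff K s = 0"
  by (simp add: cutoff_def max_def)

lemma cutoff_deriv_nonneg: "0 \<le> cutoff_deriv K s"
  by (simp add: cutoff_deriv_def)

lemma cutoff_deriv_eq_0: "s \<le> K \<Longrightarrow> cutoff_deriv K s = 0"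
  by (simp add: cutoff_deriv_def max_def)

lemma cutoff_ge_half:
  assumes "K > 0" "s \<ge> 2 * K"
  shows "cutoff K s \<ge> 1 / 2"
proof -
  have "K\<^sup>2 \<le> (s - K)\<^sup>2" using assms by (intro power_mono) auto
  moreover have "K\<^sup>2 > 0" using assms by simp
  ultimately show ?thesis using assms by (simp add: cutoff_def pos_le_divide_eq add_pos_pos)
qed

text \<open>With \<open>m = s - K\<close> and \<open>N = m\<^sup>2 + K\<^sup>2\<close>, everything
  follows from \<open>2 * m * K \<le> N\<close> and \<open>s\<^sup>2 \<le> 2 * N\<close>. The first
  bound makes boundary errors of order \<open>\<rho>\<^sup>2\<close> vanish with the width of the
  cutoff, the second is the condition on \<open>T'\<close> in \<open>hessian_estimate\<close>, and
  the third lets the derivative of a truncation be absorbed by the truncation itself.\<close>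

lemma cutoff_deriv_bounds:
  assumes "K > 0"
  shows "cutoff_deriv K s * s\<^sup>2 \<le> 2 * K" "s * cutoff_deriv K s \<le> 2"
    "(s * cutoff_deriv K s)\<^sup>2 \<le> 8 * cutoff K s"
proof -
  have "cutoff_deriv K s * s\<^sup>2 \<le> 2 * K \<and> s * cutoff_deriv K s \<le> 2 \<and>
      (s * cutoff_deriv K s)\<^sup>2 \<le> 8 * cutoff K s"
  proof (cases "s \<le> K")
    case True
    then show ?thesis using assms by (simp add: cutoff_deriv_eq_0 cutoff_bounds)
  next
    case False
    define m where "m = s - K"
    define N where "N = m\<^sup>2 + K\<^sup>2"
    have m: "m > 0" "s = m + K" "max 0 (s - K) = m" using False by (auto simp: m_def)
    have N: "N > 0" using assms m by (simp add: N_def add_pos_pos)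
    have d: "cutoff_deriv K s = 2 * m * K\<^sup>2 / N\<^sup>2" and c: "cutoff K s = m\<^sup>2 / N"
      unfolding cutoff_deriv_def cutoff_def m(3) N_def by simp_all
    have mK: "2 * m * K \<le> N"
      using sum_squares_bound[of m K] by (simp add: N_def)
    have sN: "s\<^sup>2 \<le> 2 * N" using mK by (simp add: m(2) N_def power2_sum)
    have K2: "K\<^sup>2 \<le> N" by (simp add: N_def)
    have s0: "s > 0" using assms m by simp
    have "2 * m * K\<^sup>2 * s\<^sup>2 \<le> (N * K) * (2 * N)"
      using mult_mono[OF mult_right_mono[OF mK, of K] sN] assms N by (simp add: power2_eq_square mult.assoc)
    then have 1: "cutoff_deriv K s * s\<^sup>2 \<le> 2 * K"
      using N by (simp add: d divide_simps power2_eq_square mult_ac)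
    have "s * (2 * m * K\<^sup>2) = (2 * m * K) * (m * K) + (2 * m * K) * K\<^sup>2"
      by (simp add: m(2) power2_eq_square algebra_simps)
    also have "\<dots> \<le> N * N + N * N"
      using assms m mK K2 N by (intro add_mono mult_mono) auto
    finally have 2: "s * cutoff_deriv K s \<le> 2"
      using N by (simp add: d divide_simps power2_eq_square)
    have "(s * (2 * m * K\<^sup>2))\<^sup>2 = s\<^sup>2 * (4 * m\<^sup>2) * (K\<^sup>2 * K\<^sup>2)"
      by (simp add: power2_eq_square)
    also have "\<dots> \<le> 2 * N * (4 * m\<^sup>2) * (N * N)"
      using sN K2 N by (intro mult_mono) auto
    finally have 3: "(s * cutoff_deriv K s)\<^sup>2 \<le> 8 * cutoff K s"
      using N by (simp add: d c power_divide divide_simps power2_eq_square mult_ac)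
    from 1 2 3 show ?thesis by simp
  qed
  then show "cutoff_deriv K s * s\<^sup>2 \<le> 2 * K" "s * cutoff_deriv K s \<le> 2"
    "(s * cutoff_deriv K s)\<^sup>2 \<le> 8 * cutoff K s" by auto
qed

section \<open>The divergence theorem\<close>

lemma set_integrable_closure:
  fixes f :: "real^'n \<Rightarrow> real"
  assumes "open \<Omega>" "bounded \<Omega>" "continuous_on (closure \<Omega>) f"
  shows "set_integrable lborel \<Omega> f"
proof (rule set_integrable_subset)
  show "set_integrable lborel (closure \<Omega>) f"
    unfolding set_integrable_def using assms by (intro borel_integrable_compact) auto
qed (use assms closure_subset in auto)

lemma set_lebesgue_integral_sum:
  fixes f :: "'i \<Rightarrow> 'a \<Rightarrow> real"
  assumes "\<And>i. i \<in> I \<Longrightarrow> set_integrable M A (f i)"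
  shows "(LINT x:A|M. (\<Sum>i\<in>I. f i x)) = (\<Sum>i\<in>I. LINT x:A|M. f i x)"
  using assms unfolding set_lebesgue_integral_def set_integrable_def
  by (simp add: sum_distrib_left)

text \<open>By translation invariance of Lebesgue measure the difference quotients
  \<open>q k\<close> integrate to 0. They converge to the partial derivative and are dominated by a
  constant on a fixed ball.\<close>

lemma integral_partial_eq_0:
  fixes f :: "real^'n \<Rightarrow> real"
  assumes f: "Ck_on (Suc 0) f UNIV" and K: "compact K" "\<And>x. x \<notin> K \<Longrightarrow> f x = 0"
  shows "(LINT x|lborel. partial i f x) = 0"
proof -
  define e :: "real^'n" where "e = axis i 1"
  define t where "t k = inverse (real (Suc k))" for k
  define q where "q k x = (f (t k *\<^sub>R e + x) - f x) / t k" for k x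
  have t: "0 < t k" "t k \<le> 1" for k by (auto simp: t_def inverse_le_1_iff)
  have norm_e: "norm e = 1" by (simp add: e_def)
  have contD: "continuous_on UNIV (partial i f)"
    using Ck_on_partial[OF f] by simp
  have contf: "continuous_on UNIV f" using f by (rule Ck_on_imp_continuous_on)
  have D0: "partial i f x = 0" if "x \<notin> K" for x
  proof -
    have "partial i f x = partial i (\<lambda>x. 0) x"
      using K that by (intro partial_cong_open[of "- K"]) (auto simp: compact_imp_closed)
    then show ?thesis by (simp add: partial_eq_grad grad_const)
  qed
  obtain R where R: "\<And>x. x \<in> K \<Longrightarrow> norm x \<le> R"
    using compact_imp_bounded[OF K(1)] by (auto simp: bounded_iff)
  have "bounded (partial i f ` K)"
    using K(1) contD by (intro compact_imp_bounded compact_continuous_image) (auto intro: continuous_on_subset)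
  then obtain B where B: "B > 0" "\<And>x. x \<in> K \<Longrightarrow> \<bar>partial i f x\<bar> \<le> B"
    by (auto simp: bounded_pos)
  then have B': "\<bar>partial i f x\<bar> \<le> B" for x by (cases "x \<in> K") (auto simp: D0)
  have d: "((\<lambda>s. f (x + s *\<^sub>R e)) has_real_derivative partial i f (x + s *\<^sub>R e)) (at s)" for x s
    unfolding partial_def e_def using f
    by (intro has_derivative_line_real has_frechet_derivative) auto
  have qB: "\<bar>q k x\<bar> \<le> B" for k x
  proof -
    obtain z where "f (x + t k *\<^sub>R e) - f (x + 0 *\<^sub>R e) = (t k - 0) * partial i f (x + z *\<^sub>R e)"
      using MVT2[OF t(1) d[of x]] by blast
    then have "q k x = partial i f (x + z *\<^sub>R e)" using t[of k] by (simp add: q_def add.commute)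
    then show ?thesis using B' by simp
  qed
  \<comment> \<open>The increments \<open>t k\<close> are at most 1, so all quotients vanish outside
    one ball, independently of \<open>k\<close>.\<close>
  have q0: "q k x = 0" if "norm x > R + 1" for k x
  proof -
    have "norm x \<le> norm (t k *\<^sub>R e + x) + norm (t k *\<^sub>R e)"
      using norm_triangle_ineq4[of "t k *\<^sub>R e + x" "t k *\<^sub>R e"] by simp
    then have "norm (t k *\<^sub>R e + x) > R" using that t[of k] norm_e by simp
    then have "f (t k *\<^sub>R e + x) = 0" "f x = 0" using K(2) R that by force+
    then show ?thesis by (simp add: q_def)
  qed
  have intf: "integrable lborel f"
  proof -
    have "integrable lborel (\<lambda>x. indicator K x *\<^sub>R f x)"
      using contf by (intro borel_integrable_compact K) (auto intro: continuous_on_subset)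
    moreover have "(\<lambda>x. indicator K x *\<^sub>R f x) = f" using K(2) by (auto simp: indicator_def fun_eq_iff)
    ultimately show ?thesis by simp
  qed
  have fb: "f \<in> borel_measurable borel" using contf by (rule borel_measurable_continuous_onI)
  have shift: "integrable lborel (\<lambda>x. f (c + x))" "(LINT x|lborel. f (c + x)) = (LINT x|lborel. f x)" for c
    using integrable_distr_eq[of "(+) c" lborel borel f] integral_distr[of "(+) c" lborel borel f] fb intf
    by (simp_all add: lborel_distr_plus)
  have intq: "(LINT x|lborel. q k x) = 0" for k
    using shift intf by (simp add: q_def)
  have "(\<lambda>k. LINT x|lborel. q k x) \<longlonglongrightarrow> (LINT x|lborel. partial i f x)"
  proof (rule integral_dominated_convergence)
    show "integrable lborel (\<lambda>x :: real^'n. indicator (cball 0 (R + 1)) x *\<^sub>R B)"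
      by (intro borel_integrable_compact continuous_on_const compact_cball)
    show "AE x in lborel. norm (q k x) \<le> indicator (cball 0 (R + 1)) x *\<^sub>R B" for k
      using qB[of k] q0[of _ k] by (intro AE_I2) (auto simp: indicator_def)
    show "AE x in lborel. (\<lambda>k. q k x) \<longlonglongrightarrow> partial i f x"
    proof (rule AE_I2)
      fix x
      have "((\<lambda>h. (f (x + h *\<^sub>R e) - f x) / h) \<longlongrightarrow> partial i f x) (at 0)"
        using d[of x 0] by (simp add: DERIV_def)
      moreover have "filterlim t (at 0) sequentially"
        unfolding filterlim_at using t LIMSEQ_inverse_real_of_nat
        by (auto simp: t_def[abs_def])
      ultimately have "(\<lambda>k. (f (x + t k *\<^sub>R e) - f x) / t k) \<longlonglongrightarrow> partial i f x"
        by (rule filterlim_compose)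
      then show "(\<lambda>k. q k x) \<longlonglongrightarrow> partial i f x" by (simp add: q_def add.commute)
    qed
    show "partial i f \<in> borel_measurable lborel"
      using borel_measurable_continuous_onI[OF contD] by simp
    show "q k \<in> borel_measurable lborel" for k
      using borel_measurable_integrable[OF shift(1)] borel_measurable_integrable[OF intf]
      unfolding q_def[abs_def] by (intro borel_measurable_divide borel_measurable_diff) auto
  qed
  then show ?thesis using LIMSEQ_unique tendsto_const unfolding intq by blast
qed

text \<open>One global defining function replaces boundary charts: the weight, the cutoff near the
  boundary and the normal direction are all read off from it. Curvature enters through its Hessian,
  hence two derivatives.\<close>

locale smooth_domain =
  fixes \<Omega> :: "(real^'n) set" and \<rho> :: "real^'n \<Rightarrow> real"
  assumes bounded_Omega: "bounded \<Omega>"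
    and Ck_rho: "Ck_on (Suc (Suc 0)) \<rho> UNIV"
    and Omega_eq: "\<Omega> = {x. \<rho> x < 0}"
    and grad_rho_nonzero: "x \<in> frontier \<Omega> \<Longrightarrow> grad \<rho> x \<noteq> 0"
begin

lemma continuous_rho: "continuous_on S \<rho>"
  using Ck_on_imp_continuous_on[OF Ck_rho] continuous_on_subset by blast

lemma open_Omega: "open \<Omega>"
  unfolding Omega_eq by (intro open_Collect_less continuous_rho continuous_intros)

lemma compact_closure: "compact (closure \<Omega>)"
  using bounded_Omega by (simp add: compact_closure)

lemma rho_le_0: "x \<in> closure \<Omega> \<Longrightarrow> \<rho> x \<le> 0"
proof -
  have "closed {x. \<rho> x \<le> 0}" by (intro closed_Collect_le continuous_rho continuous_intros)
  moreover have "\<Omega> \<subseteq> {x. \<rho> x \<le> 0}" by (auto simp: Omega_eq)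
  ultimately show "x \<in> closure \<Omega> \<Longrightarrow> \<rho> x \<le> 0" using closure_minimal by blast
qed

lemma frontier_iff: "x \<in> frontier \<Omega> \<longleftrightarrow> x \<in> closure \<Omega> \<and> x \<notin> \<Omega>"
  by (simp add: frontier_def interior_open open_Omega)

lemma closure_cases: "x \<in> closure \<Omega> \<Longrightarrow> x \<in> \<Omega> \<or> x \<in> frontier \<Omega>"
  by (auto simp: frontier_iff)

lemma rho_frontier: "x \<in> frontier \<Omega> \<Longrightarrow> \<rho> x = 0"
  using rho_le_0[of x] frontier_iff[of x] Omega_eq by force

lemma integrable_Omega: "continuous_on (closure \<Omega>) f \<Longrightarrow> set_integrable lborel \<Omega> f" for f :: "real^'n \<Rightarrow> real"
  by (rule set_integrable_closure[OF open_Omega bounded_Omega])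

text \<open>The field \<open>cutoff d (- \<rho> x) *\<^sub>R Z x\<close>, extended by 0, is
  \<open>C^1\<close> with compact support, so its divergence integrates to 0; the product rule
  splits this into the two sides.\<close>

lemma integral_cutoff_divergence:
  assumes W: "open W" "closure \<Omega> \<subseteq> W" and Z: "Ck_on (Suc 0) Z W" and "d > 0"
  shows "(LINT x:\<Omega>|lborel. cutoff d (- \<rho> x) * divergence Z x) =
         (LINT x:\<Omega>|lborel. cutoff_deriv d (- \<rho> x) * (grad \<rho> x \<bullet> Z x))"
proof -
  define c where "c x = cutoff d (- \<rho> x)" for x
  define Y where "Y x = (if x \<in> \<Omega> then c x *\<^sub>R Z x else 0)" for x
  have \<Omega>W: "\<Omega> \<subseteq> W" using W closure_subset by blast
  have rho1: "Ck_on (Suc 0) \<rho> UNIV" using Ck_rho by (rule Ck_on_SucD)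
  have c1: "Ck_on (Suc 0) c UNIV"
    unfolding c_def[abs_def]
    by (rule Ck_on_compose_real[OF open_UNIV Ck_on_minus[OF open_UNIV rho1] Ck_on_cutoff[OF \<open>d > 0\<close>]]) simp
  have cd: "c differentiable (at x)" for x using c1 by simp
  have gc: "grad c x = - cutoff_deriv d (- \<rho> x) *\<^sub>R grad \<rho> x" for x
  proof -
    have r: "\<rho> differentiable (at x)" using rho1 by simp
    have "grad (\<lambda>y. 0 - \<rho> y) x = 0 - grad \<rho> x" using r by (subst grad_diff) (auto simp: grad_const)
    moreover have "(\<lambda>y. - \<rho> y) differentiable (at x)" using r by (rule differentiable_minus)
    ultimately show ?thesis
      unfolding c_def[abs_def] using has_real_derivative_cutoff[OF \<open>d > 0\<close>]
      by (subst grad_compose[where d = "cutoff_deriv d (- \<rho> x)"]) auto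
  qed
  have op: "open {x. \<rho> x > - d}" by (intro open_Collect_less continuous_rho continuous_intros)
  have c0: "c x = 0" if "\<rho> x > - d" for x using that by (simp add: c_def cutoff_eq_0)
  \<comment> \<open>The open sets \<open>\<Omega>\<close> and \<open>{x. \<rho> x > - d}\<close>
    cover the space, and on the second one the cutoff, hence \<open>Y\<close>, is 0.\<close>
  have Y: "Ck_on (Suc 0) Y UNIV"
  proof -
    have "Ck_on (Suc 0) Y \<Omega>"
      by (rule Ck_on_cong[OF Ck_on_scaleR[OF open_Omega Ck_on_subset[OF c1] Ck_on_subset[OF Z \<Omega>W]] open_Omega])
        (auto simp: Y_def)
    moreover have "Ck_on (Suc 0) Y {x. \<rho> x > - d}"
      by (rule Ck_on_cong[OF Ck_on_const[of _ 0] op]) (auto simp: Y_def c0)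
    ultimately have "Ck_on (Suc 0) Y (\<Omega> \<union> {x. \<rho> x > - d})" by (intro Ck_on_Un open_Omega op)
    moreover have "\<Omega> \<union> {x. \<rho> x > - d} = UNIV" using \<open>d > 0\<close> by (auto simp: Omega_eq)
    ultimately show ?thesis by simp
  qed
  have K: "compact (closure \<Omega> \<inter> {x. \<rho> x \<le> - d})"
    by (intro compact_Int_closed compact_closure closed_Collect_le continuous_rho continuous_intros)
  have Y0: "Y x = 0" if "x \<notin> closure \<Omega> \<inter> {x. \<rho> x \<le> - d}" for x
    using that closure_subset[of \<Omega>] c0[of x] by (auto simp: Y_def)
  have intY: "(LINT x|lborel. partial i (\<lambda>y. Y y $ i) x) = 0" for i
    by (rule integral_partial_eq_0[OF Ck_on_nth[OF open_UNIV Y] K]) (simp add: Y0)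
  have contY: "continuous_on UNIV (partial i (\<lambda>y. Y y $ i))" for i
    using Ck_on_imp_continuous_on[OF Ck_on_partial[OF Ck_on_nth[OF open_UNIV Y]]] .
  have pY0: "partial i (\<lambda>y. Y y $ i) x = 0" if "x \<notin> \<Omega>" for i x
  proof -
    have "partial i (\<lambda>y. Y y $ i) x = partial i (\<lambda>y. 0) x"
      by (rule partial_cong_open[OF op]) (use that \<open>d > 0\<close> c0 in \<open>auto simp: Omega_eq Y_def\<close>)
    then show ?thesis by (simp add: partial_eq_grad grad_const)
  qed
  have int0: "(LINT x:\<Omega>|lborel. partial i (\<lambda>y. Y y $ i) x) = 0" for i
  proof -
    have "(LINT x:\<Omega>|lborel. partial i (\<lambda>y. Y y $ i) x) = (LINT x|lborel. partial i (\<lambda>y. Y y $ i) x)"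
      unfolding set_lebesgue_integral_def by (rule Bochner_Integration.integral_cong) (auto simp: indicator_def pY0)
    then show ?thesis using intY by simp
  qed
  have "(LINT x:\<Omega>|lborel. divergence Y x) = (\<Sum>i\<in>UNIV. (LINT x:\<Omega>|lborel. partial i (\<lambda>y. Y y $ i) x))"
    unfolding divergence_def
    by (rule set_lebesgue_integral_sum) (auto intro!: integrable_Omega intro: continuous_on_subset[OF contY])
  then have "(LINT x:\<Omega>|lborel. divergence Y x) = 0" using int0 by simp
  moreover have "divergence Y x = c x * divergence Z x - cutoff_deriv d (- \<rho> x) * (grad \<rho> x \<bullet> Z x)"
    if "x \<in> \<Omega>" for x
  proof -
    have "divergence Y x = divergence (\<lambda>y. c y *\<^sub>R Z y) x"
      by (rule divergence_cong_open[OF open_Omega that]) (simp add: Y_def)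
    also have "\<dots> = c x * divergence Z x + grad c x \<bullet> Z x"
      using that \<Omega>W Z by (intro divergence_scaleR cd) auto
    finally show ?thesis by (simp add: gc)
  qed
  ultimately have "(LINT x:\<Omega>|lborel. c x * divergence Z x - cutoff_deriv d (- \<rho> x) * (grad \<rho> x \<bullet> Z x)) = 0"
    by (metis (no_types, lifting) open_Omega lborelD set_lebesgue_integral_cong borel_open)
  moreover have "set_integrable lborel \<Omega> (\<lambda>x. c x * divergence Z x)"
    using Ck_on_imp_continuous_on[OF c1] Ck_on_imp_continuous_on[OF Ck_on_divergence[OF W(1) Z]] W(2)
    by (intro integrable_Omega continuous_on_mult) (auto intro: continuous_on_subset)
  moreover have "set_integrable lborel \<Omega> (\<lambda>x. cutoff_deriv d (- \<rho> x) * (grad \<rho> x \<bullet> Z x))"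
  proof (intro integrable_Omega continuous_on_mult continuous_on_inner)
    have "(max 0 (s - d))\<^sup>2 + d\<^sup>2 \<noteq> 0" for s using \<open>d > 0\<close> by (simp add: add_nonneg_eq_0_iff)
    then show "continuous_on (closure \<Omega>) (\<lambda>x. cutoff_deriv d (- \<rho> x))"
      unfolding cutoff_deriv_def by (auto intro!: continuous_intros continuous_rho)
    show "continuous_on (closure \<Omega>) (grad \<rho>)"
      using Ck_on_imp_continuous_on[OF Ck_on_grad[OF open_UNIV rho1]] continuous_on_subset by blast
    show "continuous_on (closure \<Omega>) Z"
      using Ck_on_imp_continuous_on[OF Z] W(2) continuous_on_subset by blast
  qed
  ultimately show ?thesis by (simp add: set_integral_diff c_def)
qed

end


lemma continuous_on_cutoff: "K > 0 \<Longrightarrow> continuous_on S (cutoff K)"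
  using Ck_on_imp_continuous_on[OF Ck_on_cutoff] continuous_on_subset by blast

lemma continuous_on_cutoff_deriv:
  assumes "K > 0" shows "continuous_on S (cutoff_deriv K)"
proof -
  have "(max 0 (s - K))\<^sup>2 + K\<^sup>2 \<noteq> 0" for s using assms by (simp add: add_nonneg_eq_0_iff)
  then show ?thesis unfolding cutoff_deriv_def[abs_def] by (auto intro!: continuous_intros)
qed

lemma cutoff_tendsto_1:
  assumes "s > 0" "d \<longlonglongrightarrow> 0" "\<And>k. d k > 0"
  shows "(\<lambda>k. cutoff (d k) s) \<longlonglongrightarrow> 1"
proof -
  have "(\<lambda>k. (max 0 (s - d k))\<^sup>2 / ((max 0 (s - d k))\<^sup>2 + (d k)\<^sup>2)) \<longlonglongrightarrow>
      (max 0 (s - 0))\<^sup>2 / ((max 0 (s - 0))\<^sup>2 + 0\<^sup>2)"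
    using assms by (intro tendsto_intros) auto
  then show ?thesis using assms(1) by (simp add: cutoff_def)
qed

context smooth_domain
begin

lemma set_integrable_1: "set_integrable lborel \<Omega> (\<lambda>x. c :: real)"
  by (intro integrable_Omega continuous_on_const)

lemma sets_Omega [measurable, simp]: "\<Omega> \<in> sets lborel" "\<Omega> \<in> sets borel"
  using open_Omega by auto

lemma integral_mono_closure:
  fixes f g :: "real^'n \<Rightarrow> real"
  assumes "continuous_on (closure \<Omega>) f" "continuous_on (closure \<Omega>) g" "\<And>x. x \<in> \<Omega> \<Longrightarrow> f x \<le> g x"
  shows "(LINT x:\<Omega>|lborel. f x) \<le> (LINT x:\<Omega>|lborel. g x)"
  by (rule set_integral_mono) (use assms integrable_Omega in auto)

lemma integral_linear:
  fixes f g :: "real^'n \<Rightarrow> real"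
  assumes "continuous_on (closure \<Omega>) f" "continuous_on (closure \<Omega>) g"
  shows "(LINT x:\<Omega>|lborel. a * f x + b * g x) = a * (LINT x:\<Omega>|lborel. f x) + b * (LINT x:\<Omega>|lborel. g x)"
  using assms[THEN integrable_Omega] by (simp add: set_integral_add set_integrable_mult_right)

lemma cutoff_integral_tendsto:
  fixes f :: "real^'n \<Rightarrow> real"
  assumes "continuous_on (closure \<Omega>) f" "d \<longlonglongrightarrow> 0" "\<And>k. d k > 0"
  shows "(\<lambda>k. LINT x:\<Omega>|lborel. cutoff (d k) (- \<rho> x) * f x) \<longlonglongrightarrow> (LINT x:\<Omega>|lborel. f x)"
  unfolding set_lebesgue_integral_def
proof (rule integral_dominated_convergence)
  have i: "set_integrable lborel \<Omega> f" by (rule integrable_Omega[OF assms(1)])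
  show "(\<lambda>x. indicator \<Omega> x *\<^sub>R f x) \<in> borel_measurable lborel"
    using i unfolding set_integrable_def by (rule borel_measurable_integrable)
  show "(\<lambda>x. indicator \<Omega> x *\<^sub>R (cutoff (d k) (- \<rho> x) * f x)) \<in> borel_measurable lborel" for k
  proof -
    have "set_integrable lborel \<Omega> (\<lambda>x. cutoff (d k) (- \<rho> x) * f x)"
      by (intro integrable_Omega continuous_on_mult assms(1)
          continuous_on_compose2[OF continuous_on_cutoff[OF assms(3), of UNIV]]) (auto intro!: continuous_intros continuous_rho)
    then show ?thesis unfolding set_integrable_def by (rule borel_measurable_integrable)
  qed
  show "integrable lborel (\<lambda>x. indicator \<Omega> x *\<^sub>R \<bar>f x\<bar>)"
    using set_integrable_abs[OF i] by (simp add: set_integrable_def)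
  show "AE x in lborel. norm (indicator \<Omega> x *\<^sub>R (cutoff (d k) (- \<rho> x) * f x)) \<le> indicator \<Omega> x *\<^sub>R \<bar>f x\<bar>" for k
    using cutoff_bounds[of "d k"] by (intro AE_I2) (auto simp: indicator_def abs_mult mult_left_le_one_le)
  show "AE x in lborel. (\<lambda>k. indicator \<Omega> x *\<^sub>R (cutoff (d k) (- \<rho> x) * f x)) \<longlonglongrightarrow> indicator \<Omega> x *\<^sub>R f x"
  proof (rule AE_I2)
    fix x
    show "(\<lambda>k. indicator \<Omega> x *\<^sub>R (cutoff (d k) (- \<rho> x) * f x)) \<longlonglongrightarrow> indicator \<Omega> x *\<^sub>R f x"
    proof (cases "x \<in> \<Omega>")
      case True
      then have "(\<lambda>k. cutoff (d k) (- \<rho> x) * f x) \<longlonglongrightarrow> 1 * f x"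
        using assms by (intro tendsto_mult cutoff_tendsto_1 tendsto_const) (auto simp: Omega_eq)
      then show ?thesis using True by simp
    qed simp
  qed
qed

text \<open>The cutoff \<open>cutoff d (- \<rho>)\<close> replaces the surface integral: its gradient is a nonnegative multiple
  of \<open>- grad \<rho>\<close>, and the case \<open>Z = grad \<rho>\<close> bounds its total mass uniformly in \<open>d\<close>.\<close>

lemma integral_divergence_nonpos:
  assumes W: "open W" "closure \<Omega> \<subseteq> W" and Z: "Ck_on (Suc 0) Z W"
    and sgn: "\<And>x. x \<in> frontier \<Omega> \<Longrightarrow> grad \<rho> x \<bullet> Z x \<le> 0"
  shows "(LINT x:\<Omega>|lborel. divergence Z x) \<le> 0"
proof -
  let ?q = "grad \<rho>"
  have q: "Ck_on (Suc 0) ?q UNIV" by (rule Ck_on_grad[OF open_UNIV Ck_rho])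
  have cq: "continuous_on S ?q" for S
    using Ck_on_imp_continuous_on[OF q] continuous_on_subset by blast
  have cZ: "continuous_on (closure \<Omega>) Z"
    using Ck_on_imp_continuous_on[OF Z] W(2) continuous_on_subset by blast
  have cdZ: "continuous_on (closure \<Omega>) (divergence Z)"
    using Ck_on_imp_continuous_on[OF Ck_on_divergence[OF W(1) Z]] W(2) continuous_on_subset by blast
  have cdq: "continuous_on (closure \<Omega>) (divergence ?q)"
    using Ck_on_imp_continuous_on[OF Ck_on_divergence[OF open_UNIV q]] continuous_on_subset by blast
  \<comment> \<open>The slack \<open>e\<close> makes the sign condition strict on the boundary; it
    is sent to 0 at the end.\<close>
  have "(LINT x:\<Omega>|lborel. divergence Z x) \<le> e * (LINT x:\<Omega>|lborel. divergence ?q x)" if "e > 0" for e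
  proof -
    \<comment> \<open>Where the outward flux reaches the slack. This set is compact and misses the
      boundary, so \<open>\<rho>\<close> stays away from 0 on it.\<close>
    define A where "A = {x \<in> closure \<Omega>. e * (norm (?q x))\<^sup>2 \<le> ?q x \<bullet> Z x}"
    have "compact A"
    proof -
      have "A = closure \<Omega> \<inter> (\<lambda>x. ?q x \<bullet> Z x - e * (norm (?q x))\<^sup>2) -` {0..}"
        by (auto simp: A_def)
      then have "closed A"
        by (simp only:) (intro continuous_closed_preimage continuous_intros cq cZ closed_closure closed_atLeast)
      then have "compact (closure \<Omega> \<inter> A)" by (rule compact_Int_closed[OF compact_closure])
      moreover have "closure \<Omega> \<inter> A = A" by (auto simp: A_def)
      ultimately show ?thesis by simp
    qed
    have A\<Omega>: "\<rho> x < 0" if "x \<in> A" for x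
    proof (rule ccontr)
      assume "\<not> \<rho> x < 0"
      then have "x \<in> frontier \<Omega>" using that Omega_eq frontier_iff[of x] by (simp add: A_def)
      moreover from this have "e * (norm (?q x))\<^sup>2 > 0" using grad_rho_nonzero \<open>e > 0\<close> by simp
      ultimately show False using that sgn[of x] by (simp add: A_def)
    qed
    \<comment> \<open>The comparison is with \<open>(\<rho> x)\<^sup>2\<close> rather than with a
      constant, because by \<open>cutoff_deriv_bounds(1)\<close> the pointwise error is then
      \<open>2 * C * d k\<close>, which tends to 0.\<close>
    obtain C where C: "C \<ge> 0" "\<And>x. x \<in> A \<Longrightarrow> ?q x \<bullet> Z x \<le> C * (\<rho> x)\<^sup>2"
    proof (cases "A = {}")
      case False
      have "continuous_on A (\<lambda>x. (?q x \<bullet> Z x) / (\<rho> x)\<^sup>2)"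
      proof (intro continuous_on_divide continuous_on_inner continuous_on_power cq continuous_rho)
        show "continuous_on A Z" by (rule continuous_on_subset[OF cZ]) (auto simp: A_def)
        show "\<forall>x\<in>A. (\<rho> x)\<^sup>2 \<noteq> 0" using A\<Omega> by fastforce
      qed
      from continuous_attains_sup[OF \<open>compact A\<close> False this]
      obtain y where y: "\<And>x. x \<in> A \<Longrightarrow> (?q x \<bullet> Z x) / (\<rho> x)\<^sup>2 \<le> (?q y \<bullet> Z y) / (\<rho> y)\<^sup>2" by blast
      show ?thesis
      proof (rule that[of "max 0 ((?q y \<bullet> Z y) / (\<rho> y)\<^sup>2)"])
        fix x assume x: "x \<in> A"
        then have "(\<rho> x)\<^sup>2 > 0" using A\<Omega> by fastforce
        moreover have "(?q x \<bullet> Z x) / (\<rho> x)\<^sup>2 \<le> max 0 ((?q y \<bullet> Z y) / (\<rho> y)\<^sup>2)" using y[OF x] by simp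
        ultimately show "?q x \<bullet> Z x \<le> max 0 ((?q y \<bullet> Z y) / (\<rho> y)\<^sup>2) * (\<rho> x)\<^sup>2"
          by (simp add: pos_divide_le_eq)
      qed simp
    qed (use that[of 0] in auto)
    define d where "d k = inverse (real (Suc k))" for k
    have d: "d \<longlonglongrightarrow> 0" "\<And>k. d k > 0"
      unfolding d_def[abs_def] by (rule LIMSEQ_inverse_real_of_nat) simp
    have le: "(LINT x:\<Omega>|lborel. cutoff (d k) (- \<rho> x) * divergence Z x) \<le>
        e * (LINT x:\<Omega>|lborel. cutoff (d k) (- \<rho> x) * divergence ?q x) + d k * (LINT x:\<Omega>|lborel. C * 2)" for k
    proof -
      let ?t = "\<lambda>x. cutoff_deriv (d k) (- \<rho> x)"
      have ct: "continuous_on (closure \<Omega>) ?t"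
        by (rule continuous_on_compose2[OF continuous_on_cutoff_deriv[OF d(2), of UNIV]])
          (auto intro!: continuous_intros continuous_rho)
      have "(LINT x:\<Omega>|lborel. ?t x * (?q x \<bullet> Z x)) \<le>
          (LINT x:\<Omega>|lborel. e * (?t x * (?q x \<bullet> ?q x)) + d k * (C * 2))"
      proof (rule integral_mono_closure)
        fix x assume x: "x \<in> \<Omega>"
        have t0: "?t x \<ge> 0" by (rule cutoff_deriv_nonneg)
        have "?q x \<bullet> Z x \<le> e * (?q x \<bullet> ?q x) + C * (\<rho> x)\<^sup>2"
        proof (cases "x \<in> A")
          case True
          then show ?thesis using C(2)[OF True] \<open>e > 0\<close> by (simp add: add_increasing)
        next
          case False
          then have "?q x \<bullet> Z x \<le> e * (?q x \<bullet> ?q x)"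
            using x closure_subset by (auto simp: A_def power2_norm_eq_inner)
          then show ?thesis using C(1) by (simp add: add_increasing2)
        qed
        then have "?t x * (?q x \<bullet> Z x) \<le> ?t x * (e * (?q x \<bullet> ?q x) + C * (\<rho> x)\<^sup>2)"
          using t0 by (rule mult_left_mono)
        also have "\<dots> = e * (?t x * (?q x \<bullet> ?q x)) + C * (?t x * (- \<rho> x)\<^sup>2)" by (simp add: algebra_simps)
        also have "\<dots> \<le> e * (?t x * (?q x \<bullet> ?q x)) + C * (2 * d k)"
          using cutoff_deriv_bounds(1)[OF d(2)] C(1) by (intro add_left_mono mult_left_mono)
        finally show "?t x * (?q x \<bullet> Z x) \<le> e * (?t x * (?q x \<bullet> ?q x)) + d k * (C * 2)" by (simp only: mult_ac)
      qed (intro continuous_intros ct cq cZ)+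
      also have "\<dots> = e * (LINT x:\<Omega>|lborel. ?t x * (?q x \<bullet> ?q x)) + d k * (LINT x:\<Omega>|lborel. C * 2)"
        by (intro integral_linear continuous_intros ct cq)
      finally show ?thesis
        using integral_cutoff_divergence[OF W Z d(2)] integral_cutoff_divergence[OF open_UNIV _ q d(2)]
        by simp
    qed
    have "(\<lambda>k. LINT x:\<Omega>|lborel. cutoff (d k) (- \<rho> x) * divergence Z x) \<longlonglongrightarrow> (LINT x:\<Omega>|lborel. divergence Z x)"
      by (rule cutoff_integral_tendsto[OF cdZ d])
    moreover have "(\<lambda>k. e * (LINT x:\<Omega>|lborel. cutoff (d k) (- \<rho> x) * divergence ?q x) + d k * (LINT x:\<Omega>|lborel. C * 2))
        \<longlonglongrightarrow> e * (LINT x:\<Omega>|lborel. divergence ?q x) + 0 * (LINT x:\<Omega>|lborel. C * 2)"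
      by (intro tendsto_intros cutoff_integral_tendsto cdq d)
    ultimately have "(LINT x:\<Omega>|lborel. divergence Z x) \<le>
        e * (LINT x:\<Omega>|lborel. divergence ?q x) + 0 * (LINT x:\<Omega>|lborel. C * 2)"
      by (rule LIMSEQ_le) (use le in blast)
    then show ?thesis by simp
  qed
  then have "\<forall>\<^sub>F e in at_right 0. (LINT x:\<Omega>|lborel. divergence Z x) \<le> e * (LINT x:\<Omega>|lborel. divergence ?q x)"
    by (auto simp: eventually_at_filter)
  moreover have "((\<lambda>e. e * (LINT x:\<Omega>|lborel. divergence ?q x)) \<longlongrightarrow> 0 * (LINT x:\<Omega>|lborel. divergence ?q x)) (at_right 0)"
    by (intro tendsto_intros)
  ultimately have "(LINT x:\<Omega>|lborel. divergence Z x) \<le> 0 * (LINT x:\<Omega>|lborel. divergence ?q x)"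
    by (intro tendsto_lowerbound[where F = "at_right (0::real)"]) auto
  then show ?thesis by simp
qed

lemma integral_divergence_eq_0:
  assumes W: "open W" "closure \<Omega> \<subseteq> W" and Z: "Ck_on (Suc 0) Z W"
    and Z0: "\<And>x. x \<in> frontier \<Omega> \<Longrightarrow> Z x = 0"
  shows "(LINT x:\<Omega>|lborel. divergence Z x) = 0"
proof (rule antisym)
  have "(LINT x:\<Omega>|lborel. divergence (\<lambda>y. (-1) *\<^sub>R Z y) x) \<le> 0"
    by (rule integral_divergence_nonpos[OF W]) (auto simp: Z0 intro!: Ck_on_minus W Z simp del: Ck_on.simps)
  moreover have "divergence (\<lambda>y. (-1) *\<^sub>R Z y) x = - divergence Z x" if "x \<in> \<Omega>" for x
    using divergence_scaleR[of "\<lambda>y. -1" x Z] Z that W(2) closure_subset[of \<Omega>] by (auto simp: grad_const)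
  then have "(LINT x:\<Omega>|lborel. divergence (\<lambda>y. (-1) *\<^sub>R Z y) x) = (LINT x:\<Omega>|lborel. - divergence Z x)"
    by (intro set_lebesgue_integral_cong) auto
  ultimately show "0 \<le> (LINT x:\<Omega>|lborel. divergence Z x)" by (simp add: set_lebesgue_integral_def)
qed (rule integral_divergence_nonpos[OF W Z], simp add: Z0)

section \<open>Functions vanishing on the boundary\<close>

text \<open>No curve inside the boundary is constructed. A short segment through
  \<open>x + t *\<^sub>R v\<close> in direction \<open>grad \<rho> x\<close> starts in the domain
  and ends outside, so it meets the boundary at some
  \<open>x + t *\<^sub>R (v + c *\<^sub>R grad \<rho> x)\<close> with
  \<open>\<bar>c\<bar> \<le> e\<close>. There \<open>f\<close> is 0, and its linearization at
  \<open>x\<close> bounds the derivative along \<open>v\<close> by a quantity that vanishes with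
  \<open>e\<close>.\<close>

lemma tangential_derivative_eq_0:
  assumes x: "x \<in> frontier \<Omega>" and f: "f differentiable (at x)"
    and f0: "\<And>y. y \<in> frontier \<Omega> \<Longrightarrow> f y = 0" and v: "grad \<rho> x \<bullet> v = 0"
  shows "grad f x \<bullet> v = 0"
proof -
  let ?q = "grad \<rho> x" and ?D = "\<lambda>v. grad f x \<bullet> v"
  have rx: "\<rho> x = 0" using x by (rule rho_frontier)
  have q: "?q \<bullet> ?q > 0" using grad_rho_nonzero[OF x] by simp
  have rd: "\<rho> differentiable (at x)" using Ck_rho by simp
  have line: "((\<lambda>s. \<rho> (x + s *\<^sub>R u)) has_real_derivative ?q \<bullet> u) (at 0)" for u
    using has_derivative_line_real[of \<rho> _ x 0 u] has_derivative_grad[OF rd] by simp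
  have bound: "\<bar>?D v\<bar> \<le> e * (\<bar>?D ?q\<bar> + norm v + e * norm ?q)" if e: "e > 0" for e
  proof -
    obtain d1 where d1: "d1 > 0" "\<And>h. 0 < h \<Longrightarrow> h < d1 \<Longrightarrow> \<rho> (x + h *\<^sub>R (v - e *\<^sub>R ?q)) < 0"
      using DERIV_neg_dec_right[OF line[of "v - e *\<^sub>R ?q"]] e q v by (auto simp: inner_diff_right rx)
    obtain d2 where d2: "d2 > 0" "\<And>h. 0 < h \<Longrightarrow> h < d2 \<Longrightarrow> \<rho> (x + h *\<^sub>R (v + e *\<^sub>R ?q)) > 0"
      using DERIV_pos_inc_right[OF line[of "v + e *\<^sub>R ?q"]] e q v by (auto simp: inner_add_right rx)
    obtain d3 where d3: "d3 > 0"
      "\<And>y. norm (y - x) < d3 \<Longrightarrow> \<bar>f y - f x - ?D (y - x)\<bar> \<le> e * norm (y - x)"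
      using has_derivative_grad[OF f] e unfolding has_derivative_at_alt by auto
    define M where "M = norm v + e * norm ?q"
    have M: "M \<ge> 0" using e by (simp add: M_def)
    \<comment> \<open>Keeps both end points on their sides of the boundary and the crossing point
      within distance \<open>d3\<close> of \<open>x\<close>, since \<open>M + 1\<close> exceeds the
      displacement per unit of \<open>t\<close>.\<close>
    define t where "t = min d1 (min d2 (d3 / (M + 1))) / 2"
    have t: "0 < t" "t < d1" "t < d2" "t * (M + 1) < d3"
    proof -
      have p: "min a (min b c) / 2 < c" if "a > 0" "b > 0" "c > 0" for a b c :: real
        using that by (auto simp: min_def)
      show "0 < t" "t < d1" "t < d2" using d1(1) d2(1) d3(1) M by (auto simp: t_def min_def)
      have "t < d3 / (M + 1)" unfolding t_def using d1(1) d2(1) d3(1) M by (intro p) auto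
      then show "t * (M + 1) < d3" using M by (simp add: pos_less_divide_eq)
    qed
    let ?a = "x + t *\<^sub>R (v - e *\<^sub>R ?q)" and ?b = "x + t *\<^sub>R (v + e *\<^sub>R ?q)"
    have "closed_segment ?a ?b \<inter> frontier \<Omega> \<noteq> {}"
    proof (rule connected_Int_frontier)
      have "?a \<in> \<Omega>" "?b \<notin> \<Omega>" using d1(2)[of t] d2(2)[of t] t by (auto simp: Omega_eq)
      then show "closed_segment ?a ?b \<inter> \<Omega> \<noteq> {}" "closed_segment ?a ?b - \<Omega> \<noteq> {}" by auto
    qed auto
    then obtain u where u: "0 \<le> u" "u \<le> 1" "(1 - u) *\<^sub>R ?a + u *\<^sub>R ?b \<in> frontier \<Omega>"
      by (auto simp: closed_segment_def)
    define c where "c = (2 * u - 1) * e"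
    have c: "\<bar>c\<bar> \<le> e" using u(1,2) e by (auto simp: c_def abs_mult)
    have y: "(1 - u) *\<^sub>R ?a + u *\<^sub>R ?b = x + t *\<^sub>R (v + c *\<^sub>R ?q)" by (simp add: c_def vec_eq_iff algebra_simps)
    have nrm: "norm (v + c *\<^sub>R ?q) \<le> M"
      using norm_triangle_ineq[of v "c *\<^sub>R ?q"] mult_right_mono[OF c, of "norm ?q"] by (simp add: M_def)
    then have "t * norm (v + c *\<^sub>R ?q) \<le> t * (M + 1)" using t(1) by (intro mult_left_mono) auto
    then have "t * norm (v + c *\<^sub>R ?q) < d3" using t(4) by (rule le_less_trans)
    then have "\<bar>f (x + t *\<^sub>R (v + c *\<^sub>R ?q)) - f x - ?D (t *\<^sub>R (v + c *\<^sub>R ?q))\<bar> \<le> e * (t * norm (v + c *\<^sub>R ?q))"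
      using d3(2)[of "x + t *\<^sub>R (v + c *\<^sub>R ?q)"] t by simp
    moreover have "f (x + t *\<^sub>R (v + c *\<^sub>R ?q)) = 0" "f x = 0" using u(3) f0 x by (simp_all add: y)
    ultimately have "\<bar>?D (t *\<^sub>R (v + c *\<^sub>R ?q))\<bar> \<le> e * (t * norm (v + c *\<^sub>R ?q))"
      by (metis abs_minus_cancel diff_0 diff_self)
    then have "t * \<bar>?D (v + c *\<^sub>R ?q)\<bar> \<le> t * (e * norm (v + c *\<^sub>R ?q))"
      using t(1) by (simp only: inner_scaleR_right abs_mult abs_of_pos mult.left_commute[of e])
    then have "\<bar>?D (v + c *\<^sub>R ?q)\<bar> \<le> e * norm (v + c *\<^sub>R ?q)" using t(1) by simp
    also have "\<dots> \<le> e * M" using nrm e by simp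
    finally have "\<bar>?D v + c * ?D ?q\<bar> \<le> e * M" by (simp add: inner_add_right)
    moreover have "\<bar>c * ?D ?q\<bar> \<le> e * \<bar>?D ?q\<bar>" using c by (simp add: abs_mult mult_right_mono)
    ultimately show ?thesis by (simp add: M_def algebra_simps)
  qed
  have "\<bar>?D v\<bar> \<le> 0"
  proof (rule tendsto_lowerbound[of _ _ "at_right (0::real)"])
    have "((\<lambda>e. e * (\<bar>?D ?q\<bar> + norm v + e * norm ?q)) \<longlongrightarrow> 0 * (\<bar>?D ?q\<bar> + norm v + 0 * norm ?q)) (at_right 0)"
      by (intro tendsto_intros)
    then show "((\<lambda>e. e * (\<bar>?D ?q\<bar> + norm v + e * norm ?q)) \<longlongrightarrow> 0) (at_right 0)" by simp
    show "\<forall>\<^sub>F e in at_right 0. \<bar>?D v\<bar> \<le> e * (\<bar>?D ?q\<bar> + norm v + e * norm ?q)"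
      using bound by (auto simp: eventually_at_filter)
  qed simp
  then show ?thesis by simp
qed

text \<open>The part of \<open>grad f x\<close> orthogonal to \<open>grad \<rho> x\<close> is
  tangential, so its inner product with \<open>grad f x\<close>, which is its own squared norm, is
  0.\<close>

lemma grad_parallel:
  assumes x: "x \<in> frontier \<Omega>" and f: "f differentiable (at x)"
    and f0: "\<And>y. y \<in> frontier \<Omega> \<Longrightarrow> f y = 0"
  shows "\<exists>s. grad f x = s *\<^sub>R grad \<rho> x"
proof -
  let ?q = "grad \<rho> x"
  define s where "s = (grad f x \<bullet> ?q) / (?q \<bullet> ?q)"
  define v where "v = grad f x - s *\<^sub>R ?q"
  have "?q \<bullet> v = 0" using grad_rho_nonzero[OF x]
    by (simp add: v_def s_def inner_diff_right inner_commute)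
  moreover from this have "grad f x \<bullet> v = 0" by (intro tangential_derivative_eq_0[OF x f] f0) auto
  ultimately have "v \<bullet> v = 0" by (simp add: v_def inner_diff_left)
  then show ?thesis by (auto simp: v_def)
qed

text \<open>The tangential part \<open>y\<close> of \<open>\<bar>grad \<rho>\<bar>\<^sup>2 grad w\<close> vanishes on the boundary and is orthogonal to
  \<open>grad \<rho>\<close> everywhere, so its divergence vanishes there as well.\<close>

lemma boundary_hessian:
  assumes W: "open W" "closure \<Omega> \<subseteq> W" and w: "Ck_on (Suc (Suc 0)) w W"
    and w0: "\<And>y. y \<in> frontier \<Omega> \<Longrightarrow> w y = 0" and x: "x \<in> frontier \<Omega>"
    and s: "grad w x = s *\<^sub>R grad \<rho> x"
  shows "grad \<rho> x \<bullet> (vgrad (grad w) x *v grad \<rho> x) - laplacian w x * (norm (grad \<rho> x))\<^sup>2 =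
    s * (grad \<rho> x \<bullet> (vgrad (grad \<rho>) x *v grad \<rho> x) - laplacian \<rho> x * (norm (grad \<rho> x))\<^sup>2)"
proof -
  let ?q = "grad \<rho>" and ?g = "grad w"
  define y where "y z = (norm (?q z))\<^sup>2 *\<^sub>R ?g z - (?q z \<bullet> ?g z) *\<^sub>R ?q z" for z
  have fW: "z \<in> W" if "z \<in> frontier \<Omega>" for z using that W by (auto simp: frontier_iff)
  have rho: "Ck_on (Suc (Suc 0)) \<rho> W" using Ck_rho by (rule Ck_on_subset) simp
  have q1: "Ck_on (Suc 0) ?q W" and g1: "Ck_on (Suc 0) ?g W"
    by (intro Ck_on_grad W rho w)+
  note dq = Ck_on_differentiable[OF q1] and dg = Ck_on_differentiable[OF g1]
  have n1: "Ck_on (Suc 0) (\<lambda>z. (norm (?q z))\<^sup>2) W"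
    unfolding power2_norm_eq_inner by (intro Ck_on_inner W q1)
  have i1: "Ck_on (Suc 0) (\<lambda>z. ?q z \<bullet> ?g z) W" by (intro Ck_on_inner W q1 g1)
  have a1: "Ck_on (Suc 0) (\<lambda>z. (norm (?q z))\<^sup>2 *\<^sub>R ?g z) W" and b1: "Ck_on (Suc 0) (\<lambda>z. (?q z \<bullet> ?g z) *\<^sub>R ?q z) W"
    by (intro Ck_on_scaleR W q1 g1 n1 i1)+
  have y1: "Ck_on (Suc 0) y W"
    unfolding y_def[abs_def] by (intro Ck_on_diff W a1 b1)
  have wd: "w differentiable (at z)" if "z \<in> W" for z
    by (rule Ck_on_differentiable[OF Ck_on_SucD[OF w] that])
  have y0: "y z = 0" if z: "z \<in> frontier \<Omega>" for z
  proof -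
    obtain s where "?g z = s *\<^sub>R ?q z" using grad_parallel[OF z wd w0] fW[OF z] by auto
    then show ?thesis by (simp add: y_def power2_norm_eq_inner)
  qed
  have xW: "x \<in> W" by (rule fW[OF x])
  \<comment> \<open>Each component of \<open>y\<close> vanishes on the boundary, so the Jacobian of
    \<open>y\<close> at \<open>x\<close> has rank at most one, with rows
    \<open>c i *\<^sub>R grad \<rho> x\<close>. Differentiating
    \<open>y z \<bullet> grad \<rho> z = 0\<close> then shows that its trace is 0.\<close>
  have "\<exists>c. grad (\<lambda>z. y z $ i) x = c *\<^sub>R ?q x" for i
    by (rule grad_parallel[OF x differentiable_nth[OF Ck_on_differentiable[OF y1 xW]]]) (simp add: y0)
  then obtain c where c: "\<And>i. grad (\<lambda>z. y z $ i) x = c i *\<^sub>R ?q x" by metis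
  have "grad (\<lambda>z. y z \<bullet> ?q z) x = transpose (vgrad y x) *v ?q x + transpose (vgrad ?q x) *v y x"
    by (rule grad_inner[OF Ck_on_differentiable[OF y1 xW] dq[OF xW]])
  moreover have "(\<lambda>z. y z \<bullet> ?q z) = (\<lambda>z. 0)"
  proof
    show "y z \<bullet> ?q z = 0" for z
      by (simp add: y_def inner_diff_left power2_norm_eq_inner inner_commute[of "?g z" "?q z"])
  qed
  ultimately have "transpose (vgrad y x) *v ?q x = 0" by (simp add: grad_const y0 x)
  moreover have "(transpose (vgrad y x) *v ?q x) = (\<Sum>i\<in>UNIV. c i * ?q x $ i) *\<^sub>R ?q x"
    by (simp add: vec_eq_iff matrix_vector_mult_def transpose_def vgrad_nth c sum_distrib_left sum_distrib_right mult_ac)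
  ultimately have "(\<Sum>i\<in>UNIV. c i * ?q x $ i) = 0" using grad_rho_nonzero[OF x] by simp
  then have dy: "divergence y x = 0" by (simp add: divergence_eq_vgrad vgrad_nth c)
  \<comment> \<open>The same divergence by the product rule, which brings in the Hessians of
    \<open>w\<close> and \<open>\<rho>\<close>; equating it with 0 gives the claim.\<close>
  have dy': "divergence y x = (norm (?q x))\<^sup>2 * laplacian w x + (2 *\<^sub>R (vgrad ?q x *v ?q x)) \<bullet> ?g x
      - ((?q x \<bullet> ?g x) * laplacian \<rho> x + (vgrad ?q x *v ?g x + vgrad ?g x *v ?q x) \<bullet> ?q x)"
    unfolding y_def[abs_def]
    by (subst divergence_diff[OF a1[THEN Ck_on_differentiable, OF xW] b1[THEN Ck_on_differentiable, OF xW]],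
        subst divergence_scaleR[OF n1[THEN Ck_on_differentiable, OF xW] dg[OF xW]],
        subst divergence_scaleR[OF i1[THEN Ck_on_differentiable, OF xW] dq[OF xW]],
        subst grad_norm_grad_sq[OF W(1) rho xW], subst grad_inner[OF dq[OF xW] dg[OF xW]])
      (simp add: laplacian_eq_divergence hessian_symmetric[OF W(1) rho xW] hessian_symmetric[OF W(1) w xW])
  define a h where "a = ?q x \<bullet> (vgrad ?q x *v ?q x)" and "h = ?q x \<bullet> (vgrad ?g x *v ?q x)"
  have 1: "(2 *\<^sub>R (vgrad ?q x *v ?q x)) \<bullet> ?g x = 2 * (s * a)"
    by (simp add: s a_def inner_commute[of "vgrad ?q x *v ?q x"])
  have 2: "(vgrad ?q x *v ?g x + vgrad ?g x *v ?q x) \<bullet> ?q x = s * a + h"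
    by (simp add: s a_def h_def matrix_vector_mult_scaleR inner_add_left
        inner_commute[of "vgrad ?q x *v ?q x"] inner_commute[of "vgrad ?g x *v ?q x"])
  have 3: "?q x \<bullet> ?g x = s * (norm (?q x))\<^sup>2" by (simp add: s power2_norm_eq_inner)
  have "0 = (norm (?q x))\<^sup>2 * laplacian w x + 2 * (s * a) - (s * (norm (?q x))\<^sup>2 * laplacian \<rho> x + (s * a + h))"
    using dy dy' unfolding 1 2 3 by simp
  then show ?thesis unfolding a_def[symmetric] h_def[symmetric] by (simp add: algebra_simps)
qed

end


section \<open>A global defining function\<close>

text \<open>The cube is the lowest integer power of the positive part that is \<open>C^2\<close>,
  the regularity demanded of a defining function.\<close>

lemma Ck_on_max_cube: "Ck_on (Suc (Suc 0)) (\<lambda>s::real. (max 0 s) ^ 3) UNIV"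
proof -
  have 2: "((\<lambda>s::real. (max 0 s) ^ 2) has_real_derivative 2 * max 0 s) (at s)" for s
    using has_real_derivative_max_power[of 0 0 s] by (simp add: numeral_2_eq_2)
  have 3: "((\<lambda>s::real. (max 0 s) ^ 3) has_real_derivative 3 * (max 0 s) ^ 2) (at s)" for s
    using has_real_derivative_max_power[of 0 1 s] by (simp add: numeral_2_eq_2 numeral_3_eq_3)
  have "Ck_on (Suc 0) (\<lambda>s::real. 3 * (max 0 s) ^ 2) UNIV"
    by (rule Ck_on_SucI_real[where g' = "\<lambda>s. 3 * (2 * max 0 s)"])
      (rule open_UNIV, rule DERIV_cmult[OF 2], auto intro!: continuous_intros)
  then show ?thesis by (rule Ck_on_SucI_real[OF open_UNIV 3])
qed

text \<open>At an interior point the constant -1 on the domain itself serves, as it contains no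
  boundary point. At a boundary point some directional derivative of the local function is nonzero,
  and by linearity one of two opposite directions is increasing.\<close>

lemma smooth_domain_chart:
  fixes \<Omega> :: "(real^'n) set"
  assumes dom: "bounded_smooth_domain \<Omega>" and x: "x \<in> closure \<Omega>"
  shows "\<exists>U \<sigma>. open U \<and> x \<in> U \<and> Ck_on (Suc (Suc 0)) \<sigma> U \<and> \<Omega> \<inter> U = {y\<in>U. \<sigma> y < (0::real)} \<and>
    (\<forall>y\<in>U \<inter> frontier \<Omega>. \<exists>v. frechet_derivative \<sigma> (at y) v > 0)"
proof (cases "x \<in> \<Omega>")
  case True
  have "open \<Omega>" using dom by (simp add: bounded_smooth_domain_def)
  then have "\<Omega> \<inter> frontier \<Omega> = {}" by (simp add: frontier_def interior_open)
  then show ?thesis using True \<open>open \<Omega>\<close>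
    by (intro exI[of _ \<Omega>] exI[of _ "\<lambda>_. -1"]) (auto simp del: Ck_on.simps)
next
  case False
  then have "x \<in> frontier \<Omega>"
    using x interior_subset[of \<Omega>] by (auto simp: frontier_def)
  then obtain U and \<sigma> :: "real^'n \<Rightarrow> real" where U: "open U" "x \<in> U" "smooth_on \<sigma> U"
      "\<And>y. y \<in> U \<Longrightarrow> frechet_derivative \<sigma> (at y) \<noteq> (\<lambda>v. 0)" "\<Omega> \<inter> U = {y\<in>U. \<sigma> y < 0}"
    using dom unfolding bounded_smooth_domain_def by blast
  obtain W h where h: "open W" "U \<subseteq> W" "\<forall>m. Ck_on m h W" "\<forall>y\<in>U. \<sigma> y = h y"
    using U(3) unfolding smooth_on_def by auto
  have C: "Ck_on (Suc (Suc 0)) \<sigma> U"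
    by (rule Ck_on_cong[OF Ck_on_subset[OF h(3)[rule_format] h(2)] U(1)]) (use h(4) in auto)
  have "\<exists>v. frechet_derivative \<sigma> (at y) v > 0" if y: "y \<in> U" for y
  proof -
    obtain v where v: "frechet_derivative \<sigma> (at y) v \<noteq> 0" using U(4)[OF y] by auto
    have "linear (frechet_derivative \<sigma> (at y))"
      using C y by (intro linear_frechet_derivative) auto
    then have "frechet_derivative \<sigma> (at y) (- v) = - frechet_derivative \<sigma> (at y) v" by (rule linear_neg)
    then show ?thesis using v by (metis linorder_neqE_linordered_idom neg_0_less_iff_less)
  qed
  then show ?thesis using U(1,2,5) C by blast
qed

text \<open>Finitely many local functions, multiplied by nonnegative bumps, are added. The bumps do
  not have to sum to 1, because every summand is nonpositive inside and nonnegative outside the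
  domain, so the sign of the sum is right.\<close>

lemma bounded_smooth_domain_imp_smooth_domain:
  fixes \<Omega> :: "(real^'n) set"
  assumes dom: "bounded_smooth_domain \<Omega>"
  shows "\<exists>\<rho>. smooth_domain \<Omega> \<rho>"
proof -
  have bd: "bounded \<Omega>" and op: "open \<Omega>" using dom by (auto simp: bounded_smooth_domain_def)
  obtain U and \<sigma> :: "real^'n \<Rightarrow> real^'n \<Rightarrow> real" where U: "\<And>x. x \<in> closure \<Omega> \<Longrightarrow> open (U x)"
      "\<And>x. x \<in> closure \<Omega> \<Longrightarrow> x \<in> U x" "\<And>x. x \<in> closure \<Omega> \<Longrightarrow> Ck_on (Suc (Suc 0)) (\<sigma> x) (U x)"
      "\<And>x. x \<in> closure \<Omega> \<Longrightarrow> \<Omega> \<inter> U x = {y\<in>U x. \<sigma> x y < 0}"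
      "\<And>x y. x \<in> closure \<Omega> \<Longrightarrow> y \<in> U x \<Longrightarrow> y \<in> frontier \<Omega> \<Longrightarrow> \<exists>v. frechet_derivative (\<sigma> x) (at y) v > 0"
  proof -
    define P where "P x U \<sigma> \<longleftrightarrow> open U \<and> x \<in> U \<and> Ck_on (Suc (Suc 0)) \<sigma> U \<and> \<Omega> \<inter> U = {y\<in>U. \<sigma> y < (0::real)} \<and>
      (\<forall>y\<in>U \<inter> frontier \<Omega>. \<exists>v. frechet_derivative \<sigma> (at y) v > 0)" for x U \<sigma>
    have "\<forall>x\<in>closure \<Omega>. \<exists>p. P x (fst p) (snd p)"
    proof
      fix x assume "x \<in> closure \<Omega>"
      from smooth_domain_chart[OF dom this] obtain U \<sigma> where "P x U \<sigma>" unfolding P_def by (elim exE)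
      then show "\<exists>p. P x (fst p) (snd p)" by (intro exI[of _ "(U, \<sigma>)"]) simp
    qed
    then obtain p where "\<forall>x\<in>closure \<Omega>. P x (fst (p x)) (snd (p x))" by (rule bchoice[THEN exE])
    then show ?thesis unfolding P_def by (intro that[of "\<lambda>x. fst (p x)" "\<lambda>x. snd (p x)"]) blast+
  qed
  have "\<exists>r>0. cball x r \<subseteq> U x" if "x \<in> closure \<Omega>" for x
    using U(1,2) that open_contains_cball by blast
  then obtain r where r: "\<And>x. x \<in> closure \<Omega> \<Longrightarrow> r x > 0" "\<And>x. x \<in> closure \<Omega> \<Longrightarrow> cball x (r x) \<subseteq> U x"
    by metis
  \<comment> \<open>A bump that is positive on the open ball and 0 outside the closed one. As
    \<open>cball x (r x)\<close> lies in \<open>U x\<close>, its product with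
    \<open>\<sigma> x\<close> extends by 0 to a \<open>C^2\<close> function.\<close>
  define \<eta> where "\<eta> x y = (max 0 ((r x)\<^sup>2 - (y - x) \<bullet> (y - x))) ^ 3" for x y :: "real^'n"
  define t where "t x y = (if y \<in> U x then \<eta> x y * \<sigma> x y else 0)" for x y
  have \<eta>C: "Ck_on (Suc (Suc 0)) (\<eta> x) UNIV" for x
    unfolding \<eta>_def[abs_def]
    by (rule Ck_on_compose_real[OF open_UNIV _ Ck_on_max_cube])
      (auto intro!: Ck_on_diff Ck_on_inner simp del: Ck_on.simps)
  have \<eta>0: "\<eta> x y \<ge> 0" for x y by (simp add: \<eta>_def)
  have \<eta>pos: "\<eta> x y > 0" if "y \<in> ball x (r x)" for x y
  proof -
    have "(norm (y - x))\<^sup>2 < (r x)\<^sup>2"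
      using that by (intro power_strict_mono) (auto simp: dist_norm norm_minus_commute)
    then show ?thesis by (simp add: \<eta>_def power2_norm_eq_inner)
  qed
  have \<eta>out: "\<eta> x y = 0" if "y \<notin> cball x (r x)" "x \<in> closure \<Omega>" for x y
  proof -
    have "(r x)\<^sup>2 \<le> (norm (y - x))\<^sup>2"
      using that r(1)[of x] by (intro power_mono) (auto simp: dist_norm norm_minus_commute)
    then show ?thesis by (simp add: \<eta>_def power2_norm_eq_inner)
  qed
  have tC: "Ck_on (Suc (Suc 0)) (t x) UNIV" if x: "x \<in> closure \<Omega>" for x
  proof -
    have "Ck_on (Suc (Suc 0)) (t x) (U x)"
      by (rule Ck_on_cong[OF Ck_on_mult[OF U(1) Ck_on_subset[OF \<eta>C] U(3)] U(1)]) (auto simp: t_def x)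
    moreover have "Ck_on (Suc (Suc 0)) (t x) (- cball x (r x))"
      by (rule Ck_on_cong[OF Ck_on_const[of _ 0]]) (auto simp: t_def \<eta>out x)
    ultimately have "Ck_on (Suc (Suc 0)) (t x) (U x \<union> - cball x (r x))" by (intro Ck_on_Un U(1) x) auto
    moreover have "U x \<union> - cball x (r x) = UNIV" using r(2)[OF x] by auto
    ultimately show ?thesis by simp
  qed
  have \<sigma>iff: "\<sigma> x y < 0 \<longleftrightarrow> y \<in> \<Omega>" if "x \<in> closure \<Omega>" "y \<in> U x" for x y
    using U(4)[OF that(1)] that(2) by blast
  have t_le: "t x y \<le> 0" if "x \<in> closure \<Omega>" "y \<in> \<Omega>" for x y
    using \<sigma>iff[OF that(1), of y] that(2) \<eta>0[of x y] by (auto simp: t_def intro!: mult_nonneg_nonpos)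
  have t_ge: "t x y \<ge> 0" if "x \<in> closure \<Omega>" "y \<notin> \<Omega>" for x y
    using \<sigma>iff[OF that(1), of y] that(2) \<eta>0[of x y] by (auto simp: t_def intro!: mult_nonneg_nonneg)
  have cpt: "compact (closure \<Omega>)" using bd by (simp add: compact_closure)
  have "closure \<Omega> \<subseteq> (\<Union>x\<in>closure \<Omega>. ball x (r x))" using r(1) by force
  then obtain I where I: "I \<subseteq> closure \<Omega>" "finite I" "closure \<Omega> \<subseteq> (\<Union>x\<in>I. ball x (r x))"
    using compactE_image[OF cpt, of "closure \<Omega>" "\<lambda>x. ball x (r x)"] by auto
  define \<rho> where "\<rho> y = (\<Sum>x\<in>I. t x y)" for y
  have \<rho>C: "Ck_on (Suc (Suc 0)) \<rho> UNIV"
    unfolding \<rho>_def[abs_def] using I(1) by (intro Ck_on_sum tC) auto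
  have neg: "\<rho> y < 0" if y: "y \<in> \<Omega>" for y
  proof -
    obtain x where x: "x \<in> I" "y \<in> ball x (r x)" using I(3) y closure_subset[of \<Omega>] by blast
    have yU: "y \<in> U x" using x I(1) r(2) ball_subset_cball by blast
    then have "\<sigma> x y < 0" using \<sigma>iff x(1) I(1) y by blast
    then have "t x y < 0" using yU \<eta>pos[OF x(2)] by (simp add: t_def mult_pos_neg)
    moreover have "(\<Sum>z\<in>I - {x}. t z y) \<le> 0" using t_le y I(1) by (intro sum_nonpos) auto
    ultimately show ?thesis unfolding \<rho>_def using x(1) I(2) by (simp add: sum.remove)
  qed
  have \<rho>t: "\<rho> y \<ge> t x y" if "x \<in> I" "y \<notin> \<Omega>" for x y
    unfolding \<rho>_def using that I t_ge by (intro member_le_sum) auto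
  have nonneg: "\<rho> y \<ge> 0" if "y \<notin> \<Omega>" for y
    unfolding \<rho>_def using that I(1) t_ge by (intro sum_nonneg) auto
  have eq: "\<Omega> = {x. \<rho> x < 0}" using neg nonneg by (auto simp: not_less[symmetric])
  \<comment> \<open>The gradients of overlapping charts are never compared. Along a direction
    \<open>v\<close> in which one local function increases, the points
    \<open>y + h *\<^sub>R v\<close> with small positive \<open>h\<close> lie outside the domain,
    where \<open>\<rho>\<close> is at least that single summand; the summand has slope
    \<open>D > 0\<close>, so \<open>\<rho>\<close> cannot have slope 0.\<close>
  have "grad \<rho> y \<noteq> 0" if y: "y \<in> frontier \<Omega>" for y
  proof
    assume g: "grad \<rho> y = 0"
    have y': "y \<in> closure \<Omega>" "y \<notin> \<Omega>" using y op by (auto simp: frontier_def interior_open)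
    obtain x where x: "x \<in> I" "y \<in> ball x (r x)" using I(3) y'(1) by blast
    have xc: "x \<in> closure \<Omega>" using x I by auto
    have yU: "y \<in> U x" using x xc r(2) ball_subset_cball by blast
    have \<sigma>c: "continuous_on (U x) (\<sigma> x)" using U(3)[OF xc] by (rule Ck_on_imp_continuous_on)
    have \<sigma>0: "\<sigma> x y = 0"
    proof (rule ccontr)
      assume "\<sigma> x y \<noteq> 0"
      then have pos: "\<sigma> x y > 0" using \<sigma>iff[OF xc yU] y'(2) by linarith
      have "open (U x \<inter> \<sigma> x -` {0<..})"
        using continuous_open_preimage[OF \<sigma>c U(1)[OF xc]] by auto
      moreover have "y \<in> U x \<inter> \<sigma> x -` {0<..}" using yU pos by auto
      ultimately have "(U x \<inter> \<sigma> x -` {0<..}) \<inter> \<Omega> \<noteq> {}"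
        using y'(1) open_Int_closure_eq_empty by blast
      then show False using \<sigma>iff[OF xc] by fastforce
    qed
    obtain v where v: "frechet_derivative (\<sigma> x) (at y) v > 0" using U(5)[OF xc yU y] by blast
    have \<sigma>d: "\<sigma> x differentiable (at y)" using U(3)[OF xc] yU by simp
    have \<eta>d: "\<eta> x differentiable (at y)" using \<eta>C by simp
    have line: "((\<lambda>s. f (y + s *\<^sub>R v)) has_real_derivative frechet_derivative f (at y) v) (at 0)"
      if "f differentiable (at y)" for f :: "real^'n \<Rightarrow> real"
      using has_derivative_line_real[of f _ y 0 v] has_frechet_derivative[OF that] by simp
    have op_line: "open {s. y + s *\<^sub>R v \<in> U x}"
      using open_vimage[OF U(1)[OF xc], of "\<lambda>s. y + s *\<^sub>R v"]
      by (simp add: vimage_def continuous_intros)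
    then have ev: "\<forall>\<^sub>F s in nhds 0. y + s *\<^sub>R v \<in> U x"
      using eventually_nhds_in_open[OF op_line, of 0] yU by simp
    obtain d1 where d1: "d1 > 0" "\<And>h. 0 < h \<Longrightarrow> h < d1 \<Longrightarrow> \<sigma> x (y + h *\<^sub>R v) > 0"
      using DERIV_pos_inc_right[OF line[OF \<sigma>d] v] \<sigma>0 by auto
    define D where "D = \<eta> x y * frechet_derivative (\<sigma> x) (at y) v"
    have D: "D > 0" using v \<eta>pos[OF x(2)] by (simp add: D_def)
    have "((\<lambda>s. \<eta> x (y + s *\<^sub>R v) * \<sigma> x (y + s *\<^sub>R v)) has_real_derivative D) (at 0)"
      using DERIV_mult[OF line[OF \<eta>d] line[OF \<sigma>d]] by (simp add: \<sigma>0 D_def mult.commute)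
    moreover have "((\<lambda>s. \<rho> (y + s *\<^sub>R v)) has_real_derivative 0) (at 0)"
    proof -
      have "\<rho> differentiable (at y)" using \<rho>C by simp
      then show ?thesis using line frechet_derivative_eq_grad[of \<rho> y v] g by fastforce
    qed
    ultimately have "((\<lambda>s. \<eta> x (y + s *\<^sub>R v) * \<sigma> x (y + s *\<^sub>R v) - \<rho> (y + s *\<^sub>R v)) has_real_derivative D - 0) (at 0)"
      by (rule DERIV_diff)
    moreover have "\<rho> y = 0"
    proof -
      have "y \<in> closure {x. \<rho> x \<le> 0}" using y'(1) closure_mono[of \<Omega> "{x. \<rho> x \<le> 0}"] neg by (auto intro: less_imp_le)
      moreover have "closed {x. \<rho> x \<le> 0}"
        by (intro closed_Collect_le Ck_on_imp_continuous_on[OF \<rho>C] continuous_intros)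
      ultimately show ?thesis using nonneg[OF y'(2)] by (simp add: closure_closed)
    qed
    ultimately obtain d2 where d2: "d2 > 0" "\<And>h. 0 < h \<Longrightarrow> h < d2 \<Longrightarrow>
        \<eta> x (y + h *\<^sub>R v) * \<sigma> x (y + h *\<^sub>R v) - \<rho> (y + h *\<^sub>R v) > 0"
      using DERIV_pos_inc_right[of "\<lambda>s. \<eta> x (y + s *\<^sub>R v) * \<sigma> x (y + s *\<^sub>R v) - \<rho> (y + s *\<^sub>R v)" D 0] D \<sigma>0
      by auto
    obtain d3 where d3: "d3 > 0" "\<And>h. \<bar>h\<bar> < d3 \<Longrightarrow> y + h *\<^sub>R v \<in> U x"
      using ev by (auto simp: eventually_nhds_metric)
    define h where "h = min d1 (min d2 d3) / 2"
    have h: "0 < h" "h < d1" "h < d2" "\<bar>h\<bar> < d3" using d1(1) d2(1) d3(1) by (auto simp: h_def min_def)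
    have "y + h *\<^sub>R v \<notin> \<Omega>" using \<sigma>iff[OF xc d3(2)[OF h(4)]] d1(2)[OF h(1,2)] by linarith
    then have "\<rho> (y + h *\<^sub>R v) \<ge> \<eta> x (y + h *\<^sub>R v) * \<sigma> x (y + h *\<^sub>R v)"
      using \<rho>t[OF x(1)] d3(2)[OF h(4)] by (fastforce simp: t_def)
    then show False using d2(2)[OF h(1,3)] by simp
  qed
  then have "smooth_domain \<Omega> \<rho>" using bd \<rho>C eq by (intro smooth_domain.intro) auto
  then show ?thesis by blast
qed


section \<open>Weighted Hessian estimates\<close>

lemma young: "2 * a * b \<le> c * a\<^sup>2 + b\<^sup>2 / c" if "c > 0" for a b c :: real
proof -
  have "0 \<le> (c * a - b)\<^sup>2 / c" using that by simp
  also have "\<dots> = c * a\<^sup>2 + b\<^sup>2 / c - 2 * a * b"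
    using that by (simp add: power2_eq_square field_simps)
  finally show ?thesis by simp
qed

lemma inner_ge_neg_norm: "- (norm x * norm y) \<le> x \<bullet> y"
  using Cauchy_Schwarz_ineq2[of x y] by linarith

context smooth_domain
begin

text \<open>For large \<open>B\<close> the normal derivative of this weight outweighs the curvature of the boundary, so that
  the boundary term of the Bernstein argument has a sign.\<close>

definition weight :: "real \<Rightarrow> real^'n \<Rightarrow> real" where
  "weight B x = exp (- B * \<rho> x)"

lemma Ck_weight: "Ck_on (Suc (Suc 0)) (weight B) S"
  unfolding weight_def[abs_def]
  by (rule Ck_on_subset[OF Ck_on_compose_real[OF open_UNIV Ck_on_mult[OF open_UNIV Ck_on_const Ck_rho] Ck_on_exp]])
    auto

lemma weight_pos: "weight B x > 0"
  by (simp add: weight_def)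

lemma grad_weight: "grad (weight B) x = (- B * weight B x) *\<^sub>R grad \<rho> x"
proof -
  have r: "\<rho> differentiable (at x)" using Ck_rho by simp
  have "grad (\<lambda>y. - B * \<rho> y) x = (- B) *\<^sub>R grad \<rho> x"
    using r by (subst grad_mult) (auto simp: grad_const)
  moreover have "(\<lambda>y. - B * \<rho> y) differentiable (at x)" using r by (intro differentiable_mult) auto
  ultimately show ?thesis
    unfolding weight_def[abs_def] using DERIV_exp
    by (subst grad_compose[where d = "exp (- B * \<rho> x)"]) (auto simp: mult_ac)
qed

text \<open>After \<open>boundary_hessian\<close> the flux of the Bernstein field through the
  boundary is a nonnegative multiple of the left side minus the right side.\<close>

definition boundary_bound :: "real \<Rightarrow> bool" where
  "boundary_bound B \<longleftrightarrow> (\<forall>x\<in>frontier \<Omega>. 2 * (grad \<rho> x \<bullet> (vgrad (grad \<rho>) x *v grad \<rho> x)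
      - laplacian \<rho> x * (norm (grad \<rho> x))\<^sup>2) \<le> B * ((norm (grad \<rho> x))\<^sup>2)\<^sup>2)"

text \<open>Division by the fourth power of \<open>norm (grad \<rho> x)\<close>, which is nonzero
  there, leaves a continuous function on the compact boundary.\<close>

lemma boundary_bound_exists: "\<exists>B. boundary_bound B"
proof -
  let ?n = "\<lambda>x. (norm (grad \<rho> x))\<^sup>2"
  let ?b = "\<lambda>x. (grad \<rho> x \<bullet> (vgrad (grad \<rho>) x *v grad \<rho> x) - laplacian \<rho> x * ?n x) / (?n x)\<^sup>2"
  have q: "Ck_on (Suc 0) (grad \<rho>) UNIV" by (rule Ck_on_grad[OF open_UNIV Ck_rho])
  have cq: "continuous_on S (grad \<rho>)" for S
    using Ck_on_imp_continuous_on[OF q] continuous_on_subset by blast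
  have ch: "continuous_on S (\<lambda>x. vgrad (grad \<rho>) x $ i $ j)" for S i j
    using Ck_on_imp_continuous_on[OF Ck_on_vgrad_nth[OF open_UNIV q]] continuous_on_subset by blast
  have cl: "continuous_on S (laplacian \<rho>)" for S
    using Ck_on_imp_continuous_on[OF Ck_on_laplacian[OF open_UNIV Ck_rho]] continuous_on_subset by blast
  have "continuous_on (frontier \<Omega>) ?b"
    using grad_rho_nonzero unfolding matrix_vector_mult_def
    by (intro continuous_intros cq ch cl) auto
  moreover have "compact (frontier \<Omega>)" using bounded_Omega by (rule compact_frontier_bounded)
  ultimately have "bounded (?b ` frontier \<Omega>)"
    by (intro compact_imp_bounded compact_continuous_image)
  then obtain B where B: "\<And>x. x \<in> frontier \<Omega> \<Longrightarrow> \<bar>?b x\<bar> \<le> B" by (auto simp: bounded_iff)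
  have "boundary_bound (2 * B)"
    unfolding boundary_bound_def
  proof
    fix x assume x: "x \<in> frontier \<Omega>"
    have "(?n x)\<^sup>2 > 0" using grad_rho_nonzero[OF x] by simp
    moreover have "?b x \<le> B" using B[OF x] by linarith
    ultimately show "2 * (grad \<rho> x \<bullet> (vgrad (grad \<rho>) x *v grad \<rho> x) - laplacian \<rho> x * ?n x) \<le> 2 * B * (?n x)\<^sup>2"
      by (simp add: pos_divide_le_eq)
  qed
  then show ?thesis by blast
qed

end

section \<open>The Bernstein field and its divergence\<close>

text \<open>One computation with two instances: \<open>f = 0\<close> with \<open>T = 1\<close> gives
  the global Hessian bound, a general \<open>f\<close> with a cutoff as \<open>T\<close> gives the
  truncated one. The condition \<open>s * T' s \<le> 2\<close> makes the derivative of the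
  truncation cost no more than a multiple of \<open>(m x)\<^sup>2\<close>.\<close>

locale hessian_estimate = smooth_domain \<Omega> \<rho> for \<Omega> :: "(real^'n) set" and \<rho> +
  fixes B A :: real and W :: "(real^'n) set" and w :: "real^'n \<Rightarrow> real" and f f' T T' :: "real \<Rightarrow> real"
  assumes B: "boundary_bound B"
    and W: "open W" "closure \<Omega> \<subseteq> W"
    and w: "Ck_on (Suc (Suc (Suc 0))) w W"
    and w0: "\<And>x. x \<in> frontier \<Omega> \<Longrightarrow> w x = 0"
    and f: "Ck_on (Suc 0) f UNIV" "\<And>s. (f has_real_derivative f' s) (at s)" "f 0 = 0"
    and T: "Ck_on (Suc 0) T UNIV" "\<And>s. (T has_real_derivative T' s) (at s)"
      "\<And>s. 0 \<le> T s" "\<And>s. T s \<le> 1" "\<And>s. 0 \<le> T' s" "\<And>s. s * T' s \<le> 2"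
    and A: "A \<ge> 0"
begin

abbreviation "hess \<equiv> vgrad (grad w)"
abbreviation "E \<equiv> weight B"

definition "m x = laplacian w x - f (w x)"
definition "P x = E x * (norm (grad w x))\<^sup>2 + A * (w x)\<^sup>2"
text \<open>Half the gradient of \<open>P\<close>, as \<open>grad_P\<close> confirms.\<close>

definition "N x = E x *\<^sub>R (hess x *v grad w x) + ((norm (grad w x))\<^sup>2 / 2) *\<^sub>R grad E x + (A * w x) *\<^sub>R grad w x"
text \<open>Subtracting \<open>(E x * m x) *\<^sub>R grad w x\<close> removes the gradient of the
  Laplacian from the divergence, so no third derivative of \<open>w\<close> is left. It also shapes
  the flux: on the boundary \<open>f (w x)\<close> is 0, and the combination of second derivatives
  treated in \<open>boundary_hessian\<close> appears.\<close>

definition "Z x = T (P x) *\<^sub>R (N x - (E x * m x) *\<^sub>R grad w x)"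

lemma Ck2_w: "Ck_on (Suc (Suc 0)) w W" and Ck1_w: "Ck_on (Suc 0) w W"
  using w by (auto dest!: Ck_on_SucD simp del: Ck_on.simps)

lemma Ck2_grad_w: "Ck_on (Suc (Suc 0)) (grad w) W"
  by (rule Ck_on_grad[OF W(1) w])

lemma Ck1_grad_w: "Ck_on (Suc 0) (grad w) W"
  by (rule Ck_on_SucD[OF Ck2_grad_w])

lemma Ck1_E: "Ck_on (Suc 0) E W" and Ck1_grad_E: "Ck_on (Suc 0) (grad E) W"
  by (rule Ck_on_SucD[OF Ck_weight]) (rule Ck_on_grad[OF W(1) Ck_weight])

lemma Ck1_norm_grad_sq: "Ck_on (Suc 0) (\<lambda>x. (norm (grad w x))\<^sup>2) W"
  unfolding power2_norm_eq_inner by (intro Ck_on_inner W Ck1_grad_w)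

lemma Ck1_hess_grad: "Ck_on (Suc 0) (\<lambda>x. hess x *v grad w x) W"
proof (rule Ck_on_vec[OF W(1)])
  fix i
  have "Ck_on (Suc 0) (\<lambda>x. \<Sum>j\<in>UNIV. hess x $ i $ j * grad w x $ j) W"
    by (intro Ck_on_sum Ck_on_mult W Ck_on_vgrad_nth[OF W(1) Ck2_grad_w] Ck_on_nth[OF W(1) Ck1_grad_w])
  then show "Ck_on (Suc 0) (\<lambda>x. (hess x *v grad w x) $ i) W"
    by (simp add: matrix_vector_mult_def del: Ck_on.simps)
qed

lemma Ck1_laplacian: "Ck_on (Suc 0) (laplacian w) W"
  by (rule Ck_on_laplacian[OF W(1) w])

lemma Ck1_m: "Ck_on (Suc 0) m W"
  unfolding m_def[abs_def]
  by (intro Ck_on_diff W Ck1_laplacian Ck_on_compose_real[OF W(1) Ck1_w f(1)]) auto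

lemma Ck1_P: "Ck_on (Suc 0) P W"
  unfolding P_def[abs_def] by (intro Ck_on_add Ck_on_mult Ck_on_power W Ck1_E Ck1_norm_grad_sq Ck1_w Ck_on_const)

lemma Ck1_T_P: "Ck_on (Suc 0) (\<lambda>x. T (P x)) W"
  by (rule Ck_on_compose_real[OF W(1) Ck1_P T(1)]) auto

lemma N_parts:
  "Ck_on (Suc 0) (\<lambda>x. E x *\<^sub>R (hess x *v grad w x)) W"
  "Ck_on (Suc 0) (\<lambda>x. (norm (grad w x))\<^sup>2 / 2) W"
  "Ck_on (Suc 0) (\<lambda>x. ((norm (grad w x))\<^sup>2 / 2) *\<^sub>R grad E x) W"
  "Ck_on (Suc 0) (\<lambda>x. A * w x) W"
  "Ck_on (Suc 0) (\<lambda>x. (A * w x) *\<^sub>R grad w x) W"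
  "Ck_on (Suc 0) (\<lambda>x. E x * m x) W"
  "Ck_on (Suc 0) (\<lambda>x. (E x * m x) *\<^sub>R grad w x) W"
  unfolding divide_inverse
  by (intro Ck_on_scaleR Ck_on_mult W Ck1_E Ck1_hess_grad Ck1_grad_E Ck1_norm_grad_sq Ck1_w Ck1_grad_w Ck1_m Ck_on_const)+

lemma Ck1_N: "Ck_on (Suc 0) N W"
  unfolding N_def[abs_def] by (intro Ck_on_add W N_parts)

lemma Ck1_N_diff: "Ck_on (Suc 0) (\<lambda>x. N x - (E x * m x) *\<^sub>R grad w x) W"
  by (intro Ck_on_diff W Ck1_N N_parts)

lemma Ck1_Z: "Ck_on (Suc 0) Z W"
  unfolding Z_def[abs_def] by (intro Ck_on_scaleR W Ck1_T_P Ck1_N_diff)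

lemma grad_P: "x \<in> W \<Longrightarrow> grad P x = 2 *\<^sub>R N x"
proof -
  assume x: "x \<in> W"
  note d = Ck_on_differentiable[OF _ x]
  have "grad (\<lambda>y. A * (w y)\<^sup>2) x = (2 * A * w x) *\<^sub>R grad w x"
    unfolding power2_eq_square using d[OF Ck1_w]
    by (simp add: grad_mult differentiable_mult grad_const scaleR_add_left[symmetric] algebra_simps)
  moreover have "grad (\<lambda>y. E y * (norm (grad w y))\<^sup>2) x =
      E x *\<^sub>R (2 *\<^sub>R (hess x *v grad w x)) + (norm (grad w x))\<^sup>2 *\<^sub>R grad E x"
    by (simp add: grad_mult[OF d[OF Ck1_E] d[OF Ck1_norm_grad_sq]] grad_norm_grad_sq[OF W(1) Ck2_w x])
  ultimately have "grad P x = E x *\<^sub>R (2 *\<^sub>R (hess x *v grad w x)) + (norm (grad w x))\<^sup>2 *\<^sub>R grad E x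
      + (2 * A * w x) *\<^sub>R grad w x"
    unfolding P_def[abs_def]
    by (subst grad_add[OF d[OF Ck_on_mult[OF W(1) Ck1_E Ck1_norm_grad_sq]]
          d[OF Ck_on_mult[OF W(1) Ck_on_const Ck_on_power[OF W(1) Ck1_w]]]]) simp
  then show ?thesis by (simp add: N_def algebra_simps)
qed

lemma divergence_N:
  assumes x: "x \<in> W"
  shows "divergence N x = E x * ((norm (hess x))\<^sup>2 + grad w x \<bullet> grad (laplacian w) x)
    + 2 * (grad E x \<bullet> (hess x *v grad w x)) + (norm (grad w x))\<^sup>2 / 2 * laplacian E x
    + A * w x * laplacian w x + A * (norm (grad w x))\<^sup>2"
proof -
  note d = Ck_on_differentiable[OF _ x]
  have gh: "grad (\<lambda>y. (norm (grad w y))\<^sup>2 / 2) x = hess x *v grad w x"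
    unfolding divide_inverse using grad_mult[OF d[OF Ck1_norm_grad_sq], of "\<lambda>_. inverse 2"]
    by (simp add: grad_const grad_norm_grad_sq[OF W(1) Ck2_w x])
  have gA: "grad (\<lambda>y. A * w y) x = A *\<^sub>R grad w x"
    using grad_mult[OF _ d[OF Ck1_w], of "\<lambda>_. A"] by (simp add: grad_const)
  show ?thesis
    unfolding N_def[abs_def]
    by (subst divergence_add[OF d[OF Ck_on_add[OF W(1) N_parts(1,3)]] d[OF N_parts(5)]],
        subst divergence_add[OF d[OF N_parts(1)] d[OF N_parts(3)]],
        subst divergence_scaleR[OF d[OF Ck1_E] d[OF Ck1_hess_grad]],
        subst divergence_scaleR[OF d[OF N_parts(2)] d[OF Ck1_grad_E]],
        subst divergence_scaleR[OF d[OF N_parts(4)] d[OF Ck1_grad_w]],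
        subst divergence_hessian_grad[OF W(1) x w])
      (simp add: gh gA laplacian_eq_divergence dot_square_norm inner_commute algebra_simps)
qed

text \<open>The third-order term of \<open>divergence_N\<close> meets
  \<open>E x * (grad m x \<bullet> grad w x)\<close>. Since \<open>m\<close> is the Laplacian minus
  \<open>f (w x)\<close>, only the term with \<open>f' (w x)\<close> remains of the two.\<close>

lemma divergence_Z:
  assumes x: "x \<in> W"
  shows "divergence Z x = T (P x) * (E x * (norm (hess x))\<^sup>2 + 2 * (grad E x \<bullet> (hess x *v grad w x))
      + (norm (grad w x))\<^sup>2 / 2 * laplacian E x + A * w x * laplacian w x + A * (norm (grad w x))\<^sup>2
      - E x * (m x * laplacian w x) - m x * (grad E x \<bullet> grad w x) + E x * f' (w x) * (norm (grad w x))\<^sup>2)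
    + T' (P x) * (2 * (N x \<bullet> (N x - (E x * m x) *\<^sub>R grad w x)))"
proof -
  note d = Ck_on_differentiable[OF _ x]
  have gm: "grad m x = grad (laplacian w) x - f' (w x) *\<^sub>R grad w x"
    unfolding m_def[abs_def]
    by (subst grad_diff[OF d[OF Ck1_laplacian] d[OF Ck_on_compose_real[OF W(1) Ck1_w f(1)]]])
      (auto simp: grad_compose[OF d[OF Ck1_w] f(2)])
  have gT: "grad (\<lambda>y. T (P y)) x = T' (P x) *\<^sub>R (2 *\<^sub>R N x)"
    by (simp add: grad_compose[OF d[OF Ck1_P] T(2)] grad_P[OF x])
  have "divergence (\<lambda>y. (E y * m y) *\<^sub>R grad w y) x = E x * m x * laplacian w x +
      (E x *\<^sub>R grad m x + m x *\<^sub>R grad E x) \<bullet> grad w x"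
    by (simp add: divergence_scaleR[OF d[OF N_parts(6)] d[OF Ck1_grad_w]] grad_mult[OF d[OF Ck1_E] d[OF Ck1_m]]
        laplacian_eq_divergence)
  then have dd: "divergence (\<lambda>y. N y - (E y * m y) *\<^sub>R grad w y) x = divergence N x - (E x * m x * laplacian w x +
      E x * (grad (laplacian w) x \<bullet> grad w x) - E x * f' (w x) * (norm (grad w x))\<^sup>2 + m x * (grad E x \<bullet> grad w x))"
    by (subst divergence_diff[OF d[OF Ck1_N] d[OF N_parts(7)]])
      (simp add: gm inner_add_left inner_diff_left power2_norm_eq_inner algebra_simps)
  have ip: "(T' (P x) *\<^sub>R (2 *\<^sub>R N x)) \<bullet> y = T' (P x) * (2 * (N x \<bullet> y))" for y by simp
  have "divergence Z x = T (P x) * divergence (\<lambda>y. N y - (E y * m y) *\<^sub>R grad w y) x +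
      T' (P x) * (2 * (N x \<bullet> (N x - (E x * m x) *\<^sub>R grad w x)))"
    unfolding Z_def[abs_def] by (simp only: divergence_scaleR[OF d[OF Ck1_T_P] d[OF Ck1_N_diff]] gT ip)
  also have "divergence (\<lambda>y. N y - (E y * m y) *\<^sub>R grad w y) x =
      E x * (norm (hess x))\<^sup>2 + 2 * (grad E x \<bullet> (hess x *v grad w x))
      + (norm (grad w x))\<^sup>2 / 2 * laplacian E x + A * w x * laplacian w x + A * (norm (grad w x))\<^sup>2
      - E x * (m x * laplacian w x) - m x * (grad E x \<bullet> grad w x) + E x * f' (w x) * (norm (grad w x))\<^sup>2"
    unfolding dd divergence_N[OF x] by (simp add: inner_commute[of "grad (laplacian w) x"] algebra_simps)
  finally show ?thesis .
qed

text \<open>With \<open>grad w x = s *\<^sub>R grad \<rho> x\<close> the flux is quadratic in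
  \<open>s\<close>: \<open>boundary_hessian\<close> trades the second derivatives of
  \<open>w\<close> for those of \<open>\<rho>\<close>, and \<open>grad_weight\<close> contributes
  the term with \<open>B\<close> that dominates them.\<close>

lemma Z_boundary:
  assumes x: "x \<in> frontier \<Omega>"
  shows "grad \<rho> x \<bullet> Z x \<le> 0"
proof -
  let ?q = "grad \<rho> x"
  have xW: "x \<in> W" using x W(2) by (auto simp: frontier_iff)
  note d = Ck_on_differentiable[OF _ xW]
  obtain s where s: "grad w x = s *\<^sub>R ?q" using grad_parallel[OF x d[OF Ck1_w] w0] by auto
  have n: "?q \<bullet> ?q = (norm ?q)\<^sup>2" by (simp add: power2_norm_eq_inner)
  have ng: "(norm (grad w x))\<^sup>2 = s\<^sup>2 * (norm ?q)\<^sup>2" by (simp add: s power_mult_distrib)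
  define a b where "a = ?q \<bullet> (hess x *v ?q) - laplacian w x * (norm ?q)\<^sup>2"
    and "b = ?q \<bullet> (vgrad (grad \<rho>) x *v ?q) - laplacian \<rho> x * (norm ?q)\<^sup>2"
  have ab: "a = s * b"
    unfolding a_def b_def by (rule boundary_hessian[OF W Ck2_w w0 x s])
  have "?q \<bullet> (N x - (E x * m x) *\<^sub>R grad w x) =
      E x * s * (?q \<bullet> (hess x *v ?q)) - s\<^sup>2 * (norm ?q)\<^sup>2 / 2 * (B * E x * (norm ?q)\<^sup>2) - E x * laplacian w x * (s * (norm ?q)\<^sup>2)"
    unfolding N_def ng
    by (simp add: inner_diff_right inner_add_right w0[OF x] m_def f(3) grad_weight s n matrix_vector_mult_scaleR)
  also have "\<dots> = E x * (s * a - s\<^sup>2 * (B * ((norm ?q)\<^sup>2)\<^sup>2) / 2)"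
    by (simp add: a_def algebra_simps power2_eq_square)
  also have "\<dots> = E x * s\<^sup>2 * ((2 * b - B * ((norm ?q)\<^sup>2)\<^sup>2) / 2)"
    by (simp add: ab power2_eq_square algebra_simps)
  also have "\<dots> \<le> 0"
    using B x weight_pos[of B x] unfolding boundary_bound_def b_def by (intro mult_nonneg_nonpos) auto
  finally show ?thesis using T(3) by (simp add: Z_def mult_nonneg_nonpos)
qed

text \<open>Each indefinite term takes a share of the squared Hessian: a quarter of
  \<open>E x\<close> goes to \<open>m x * laplacian w x\<close> and \<open>c0 / 4\<close> to the
  gradient of the weight, which leaves at least \<open>c0 / 2\<close>. The remainders are multiples
  of the squared gradient, charged to \<open>A\<close>, and of \<open>(m x)\<^sup>2\<close>;
  \<open>C\<close> majorizes both coefficients.\<close>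

lemma divergence_Z_ge:
  assumes x: "x \<in> W" and c: "0 < c0" "c0 \<le> E x" "E x \<le> c1" and G: "norm (grad E x) \<le> G" "\<bar>laplacian E x\<bar> \<le> G"
    and L: "0 \<le> L" "- L \<le> f' (w x)"
    and C: "4 * G\<^sup>2 / c0 + 2 * G + c1 * CARD('n) + c1 \<le> C"
  shows "T (P x) * (c0 / 2 * (norm (hess x))\<^sup>2 + (A - C - c1 * L) * (norm (grad w x))\<^sup>2 + A * w x * laplacian w x)
    - C * (m x)\<^sup>2 \<le> divergence Z x"
proof -
  define H h M where "H = norm (hess x)" and "h = norm (grad w x)" and "M = m x"
  have G0: "G \<ge> 0" using G(2) by linarith
  have c1: "c1 > 0" using c by linarith
  have t1: "E x * (M * laplacian w x) \<le> E x * (H\<^sup>2 / 4) + c1 * CARD('n) * M\<^sup>2"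
  proof -
    have n: "real CARD('n) > 0" by simp
    have "2 * (laplacian w x / 2) * M \<le> (1 / CARD('n)) * (laplacian w x / 2)\<^sup>2 + M\<^sup>2 / (1 / CARD('n))"
      using n by (intro young) auto
    also have "(1 / CARD('n)) * (laplacian w x / 2)\<^sup>2 \<le> H\<^sup>2 / 4"
      using laplacian_sq_le[of w x] n by (simp add: H_def power_divide field_simps)
    finally have "M * laplacian w x \<le> H\<^sup>2 / 4 + CARD('n) * M\<^sup>2" by (simp add: mult_ac)
    then have "E x * (M * laplacian w x) \<le> E x * (H\<^sup>2 / 4 + CARD('n) * M\<^sup>2)"
      using c by (intro mult_left_mono) auto
    also have "\<dots> \<le> E x * (H\<^sup>2 / 4) + c1 * (CARD('n) * M\<^sup>2)"
      unfolding distrib_left using c by (intro add_left_mono mult_right_mono) auto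
    finally show ?thesis by simp
  qed
  have t2: "- (c0 / 4 * H\<^sup>2 + 4 * G\<^sup>2 / c0 * h\<^sup>2) \<le> 2 * (grad E x \<bullet> (hess x *v grad w x))"
  proof -
    have "norm (grad E x) * norm (hess x *v grad w x) \<le> G * (H * h)"
      unfolding H_def h_def by (intro mult_mono G norm_matrix_vector_mult_le G0) auto
    moreover have "2 * H * (G * h) \<le> c0 / 4 * H\<^sup>2 + (G * h)\<^sup>2 / (c0 / 4)"
      using c by (intro young) auto
    ultimately show ?thesis
      using inner_ge_neg_norm[of "grad E x" "hess x *v grad w x"] by (simp add: power_mult_distrib algebra_simps)
  qed
  have t3: "- (G * h\<^sup>2) \<le> h\<^sup>2 / 2 * laplacian E x"
  proof -
    have "h\<^sup>2 / 2 * (- G) \<le> h\<^sup>2 / 2 * laplacian E x" using G(2) by (intro mult_left_mono) auto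
    moreover have "h\<^sup>2 * G \<ge> 0" using G0 by simp
    ultimately show ?thesis by (simp add: algebra_simps)
  qed
  have t4: "M * (grad E x \<bullet> grad w x) \<le> G * M\<^sup>2 + G * h\<^sup>2"
  proof -
    have "\<bar>M * (grad E x \<bullet> grad w x)\<bar> \<le> \<bar>M\<bar> * (G * h)"
      unfolding abs_mult h_def
      by (intro mult_left_mono order_trans[OF Cauchy_Schwarz_ineq2] mult_right_mono G) auto
    also have "\<dots> \<le> G * ((M\<^sup>2 + h\<^sup>2) / 2)"
      using mult_left_mono[OF sum_squares_bound[of "\<bar>M\<bar>" h] G0] by (simp add: algebra_simps)
    also have "\<dots> \<le> G * (M\<^sup>2 + h\<^sup>2)" using G0 by (intro mult_left_mono) auto
    finally show ?thesis by (simp add: algebra_simps)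
  qed
  have t5: "- (c1 * L * h\<^sup>2) \<le> E x * f' (w x) * h\<^sup>2"
  proof -
    have "E x * (- f' (w x)) \<le> E x * L" using L c by (intro mult_left_mono) auto
    also have "\<dots> \<le> c1 * L" using L c by (intro mult_right_mono)
    finally have "- (c1 * L) \<le> E x * f' (w x)" by simp
    from mult_right_mono[OF this, of "h\<^sup>2"] show ?thesis by simp
  qed
  \<comment> \<open>Completing the square, \<open>2 * (N x \<bullet> (N x - y))\<close> is at least
    minus half of \<open>(norm y)\<^sup>2\<close>. With \<open>y\<close> as below this square is
    \<open>(E x * M)\<^sup>2 * h\<^sup>2\<close>, and \<open>T' (P x) * (E x * h\<^sup>2)\<close> is
    at most \<open>T' (P x) * P x\<close>, hence at most 2.\<close>
  have t6: "- (c1 * M\<^sup>2) \<le> T' (P x) * (2 * (N x \<bullet> (N x - (E x * M) *\<^sub>R grad w x)))"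
  proof -
    let ?y = "(E x * M) *\<^sub>R grad w x"
    have "0 \<le> (2 *\<^sub>R N x - ?y) \<bullet> (2 *\<^sub>R N x - ?y)" by (rule inner_ge_zero)
    then have "- ((norm ?y)\<^sup>2 / 2) \<le> 2 * (N x \<bullet> (N x - ?y))"
      unfolding power2_norm_eq_inner by (simp add: inner_diff_left inner_diff_right inner_commute algebra_simps)
    from mult_left_mono[OF this T(5)[of "P x"]]
    have "- (T' (P x) * (norm ?y)\<^sup>2 / 2) \<le> T' (P x) * (2 * (N x \<bullet> (N x - ?y)))" by simp
    moreover have "T' (P x) * (norm ?y)\<^sup>2 / 2 \<le> c1 * M\<^sup>2"
    proof -
      have "T' (P x) * (E x * h\<^sup>2) \<le> T' (P x) * P x"
        using T(5) A by (intro mult_left_mono) (auto simp: P_def h_def)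
      also have "\<dots> \<le> 2" using T(6)[of "P x"] by (simp add: mult.commute)
      finally have "T' (P x) * (E x * h\<^sup>2) * (E x * M\<^sup>2) \<le> 2 * (E x * M\<^sup>2)"
        using c by (intro mult_right_mono) auto
      also have "\<dots> \<le> 2 * (c1 * M\<^sup>2)" using c by (intro mult_left_mono mult_right_mono) auto
      finally show ?thesis by (simp add: power_mult_distrib h_def power2_eq_square algebra_simps)
    qed
    ultimately show ?thesis by linarith
  qed
  let ?l = "c0 / 2 * H\<^sup>2 + (A - C - c1 * L) * h\<^sup>2 + A * w x * laplacian w x - (c1 * CARD('n) + G) * M\<^sup>2"
  let ?r = "E x * H\<^sup>2 + 2 * (grad E x \<bullet> (hess x *v grad w x))
      + h\<^sup>2 / 2 * laplacian E x + A * w x * laplacian w x + A * h\<^sup>2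
      - E x * (M * laplacian w x) - M * (grad E x \<bullet> grad w x) + E x * f' (w x) * h\<^sup>2"
  have EH: "c0 * H\<^sup>2 \<le> E x * H\<^sup>2" using c by (intro mult_right_mono) auto
  have Ch: "(4 * G\<^sup>2 / c0 + 2 * G) * h\<^sup>2 \<le> C * h\<^sup>2"
  proof (intro mult_right_mono)
    have "0 \<le> c1 * CARD('n) + c1" using c1 by simp
    then show "4 * G\<^sup>2 / c0 + 2 * G \<le> C" using C by linarith
  qed simp
  have e1: "(c1 * CARD('n) + G) * M\<^sup>2 = c1 * CARD('n) * M\<^sup>2 + G * M\<^sup>2"
    and e2: "(A - C - c1 * L) * h\<^sup>2 = A * h\<^sup>2 - C * h\<^sup>2 - c1 * L * h\<^sup>2"
    and e3: "(4 * G\<^sup>2 / c0 + 2 * G) * h\<^sup>2 = 4 * G\<^sup>2 / c0 * h\<^sup>2 + 2 * (G * h\<^sup>2)"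
    by (simp_all add: algebra_simps)
  have "?l \<le> ?r"
    unfolding e1 e2 using t1 t2 t3 t4 t5 EH Ch[unfolded e3] by linarith
  then have "T (P x) * ?l \<le> T (P x) * ?r" using T(3) by (rule mult_left_mono)
  moreover have "T (P x) * ((c1 * CARD('n) + G) * M\<^sup>2) \<le> (c1 * CARD('n) + G) * M\<^sup>2"
    using T(3,4) c1 G0 by (intro mult_left_le_one_le) auto
  moreover have "(c1 * CARD('n) + G) * M\<^sup>2 + c1 * M\<^sup>2 \<le> C * M\<^sup>2"
  proof -
    have "0 \<le> 4 * G\<^sup>2 / c0" using c by simp
    then have "(c1 * CARD('n) + G) + c1 \<le> C" using C G0 by linarith
    from mult_right_mono[OF this, of "M\<^sup>2"] show ?thesis by (simp add: algebra_simps)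
  qed
  moreover have "T (P x) * ?l = T (P x) * (c0 / 2 * H\<^sup>2 + (A - C - c1 * L) * h\<^sup>2 + A * w x * laplacian w x)
      - T (P x) * ((c1 * CARD('n) + G) * M\<^sup>2)" by (simp add: algebra_simps)
  ultimately show ?thesis
    using t6 unfolding divergence_Z[OF x] H_def h_def M_def by linarith
qed

end

section \<open>Integral inequalities for functions vanishing on the boundary\<close>

context smooth_domain
begin

lemma Ck_continuous: "Ck_on k f W \<Longrightarrow> closure \<Omega> \<subseteq> W \<Longrightarrow> continuous_on (closure \<Omega>) f"
  using Ck_on_imp_continuous_on continuous_on_subset by blast

lemma in_W: "closure \<Omega> \<subseteq> W \<Longrightarrow> x \<in> \<Omega> \<Longrightarrow> x \<in> W"
  using closure_subset by blast

text \<open>In the typical use \<open>d\<close> is a divergence whose integral is 0 or nonpositive,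
  so a pointwise inequality modulo a divergence becomes an inequality of integrals.\<close>

lemma integral_le_combination:
  fixes d f g g' :: "real^'n \<Rightarrow> real"
  assumes "continuous_on (closure \<Omega>) f" "continuous_on (closure \<Omega>) d"
    "continuous_on (closure \<Omega>) g" "continuous_on (closure \<Omega>) g'"
    "\<And>x. x \<in> \<Omega> \<Longrightarrow> f x \<le> d x + (a * g x + b * g' x)"
  shows "(LINT x:\<Omega>|lborel. f x) \<le> (LINT x:\<Omega>|lborel. d x) + (a * (LINT x:\<Omega>|lborel. g x) + b * (LINT x:\<Omega>|lborel. g' x))"
proof -
  have "(LINT x:\<Omega>|lborel. f x) \<le> (LINT x:\<Omega>|lborel. 1 * d x + 1 * (a * g x + b * g' x))"
    using assms by (intro integral_mono_closure continuous_intros) auto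
  also have "\<dots> = 1 * (LINT x:\<Omega>|lborel. d x) + 1 * (LINT x:\<Omega>|lborel. a * g x + b * g' x)"
    using assms by (intro integral_linear continuous_intros)
  finally show ?thesis by (simp only: integral_linear[OF assms(3,4)] mult_1)
qed

lemma integral_nonneg: "(\<And>x. x \<in> \<Omega> \<Longrightarrow> 0 \<le> f x) \<Longrightarrow> 0 \<le> (LINT x:\<Omega>|lborel. f x :: real)"
  unfolding set_lebesgue_integral_def
  by (rule Bochner_Integration.integral_nonneg) (auto simp: indicator_def)

lemma continuous_on_hess_norm:
  fixes w :: "real^'n \<Rightarrow> real"
  assumes "open W" "closure \<Omega> \<subseteq> W" "Ck_on (Suc (Suc 0)) w W"
  shows "continuous_on (closure \<Omega>) (\<lambda>x. (norm (vgrad (grad w) x))\<^sup>2)"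
  unfolding norm_matrix_sq
  by (intro continuous_intros Ck_continuous[OF Ck_on_vgrad_nth[OF assms(1) Ck_on_grad[OF assms(1,3)]] assms(2)])

lemma weight_bounds:
  "\<exists>c0 c1 G. 0 < c0 \<and> (\<forall>x\<in>closure \<Omega>. c0 \<le> weight B x \<and> weight B x \<le> c1 \<and>
     norm (grad (weight B) x) \<le> G \<and> \<bar>laplacian (weight B) x\<bar> \<le> G)"
proof -
  have bd: "\<exists>C. \<forall>x\<in>closure \<Omega>. norm (f x) \<le> C" if "continuous_on (closure \<Omega>) f"
    for f :: "real^'n \<Rightarrow> 'b::real_normed_vector"
    using compact_imp_bounded[OF compact_continuous_image[OF that compact_closure]] by (auto simp: bounded_iff)
  have cr: "continuous_on (closure \<Omega>) \<rho>" by (rule continuous_rho)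
  obtain R where R: "\<forall>x\<in>closure \<Omega>. norm (\<rho> x) \<le> R" using bd[OF cr] by blast
  have cg: "continuous_on (closure \<Omega>) (grad (weight B))"
    by (rule Ck_continuous[OF Ck_on_grad[OF open_UNIV Ck_weight]]) simp
  have cl: "continuous_on (closure \<Omega>) (laplacian (weight B))"
    by (rule Ck_continuous[OF Ck_on_laplacian[OF open_UNIV Ck_weight]]) simp
  obtain G1 G2 where G: "\<forall>x\<in>closure \<Omega>. norm (grad (weight B) x) \<le> G1" "\<forall>x\<in>closure \<Omega>. norm (laplacian (weight B) x) \<le> G2"
    using bd[OF cg] bd[OF cl] by blast
  have "exp (- (\<bar>B\<bar> * R)) \<le> weight B x \<and> weight B x \<le> exp (\<bar>B\<bar> * R)" if "x \<in> closure \<Omega>" for x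
  proof -
    have "\<bar>B * \<rho> x\<bar> \<le> \<bar>B\<bar> * R" unfolding abs_mult using R that by (intro mult_left_mono) auto
    then have "B * \<rho> x \<le> \<bar>B\<bar> * R" "- (B * \<rho> x) \<le> \<bar>B\<bar> * R" by linarith+
    then show ?thesis by (simp add: weight_def)
  qed
  then show ?thesis
    using G by (intro exI[of _ "exp (- (\<bar>B\<bar> * R))"] exI[of _ "exp (\<bar>B\<bar> * R)"] exI[of _ "max G1 G2"]) auto
qed

text \<open>The divergence of \<open>x $ i * (w x)\<^sup>2\<close> times a unit vector is
  \<open>(w x)\<^sup>2\<close> plus a term with the factor \<open>x $ i\<close>, which is bounded by
  \<open>R\<close> on the domain. Young's inequality absorbs half of the square, whence the constant
  \<open>4 * R\<^sup>2\<close>.\<close>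

lemma poincare:
  "\<exists>C>0. \<forall>W w. open W \<and> closure \<Omega> \<subseteq> W \<and> Ck_on (Suc 0) w W \<and> (\<forall>x\<in>frontier \<Omega>. w x = 0) \<longrightarrow>
    (LINT x:\<Omega>|lborel. (w x)\<^sup>2) \<le> C * (LINT x:\<Omega>|lborel. (norm (grad w x))\<^sup>2)"
proof -
  obtain R where R: "R > 0" "\<And>x. x \<in> \<Omega> \<Longrightarrow> norm x \<le> R" using bounded_Omega by (auto simp: bounded_pos)
  have "(LINT x:\<Omega>|lborel. (w x)\<^sup>2) \<le> 4 * R\<^sup>2 * (LINT x:\<Omega>|lborel. (norm (grad w x))\<^sup>2)"
    if W: "open W" "closure \<Omega> \<subseteq> W" and w: "Ck_on (Suc 0) w W" and w0: "\<forall>x\<in>frontier \<Omega>. w x = 0" for W w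
  proof -
    obtain i :: 'n where True by blast
    define Y where "Y x = (x $ i * (w x)\<^sup>2) *\<^sub>R axis i (1::real)" for x :: "real^'n"
    have p1: "Ck_on (Suc 0) (\<lambda>x. x $ i) W" by (rule Ck_on_nth[OF W(1) Ck_on_ident])
    have p2: "Ck_on (Suc 0) (\<lambda>x. (w x)\<^sup>2) W" by (rule Ck_on_power[OF W(1) w])
    have p3: "Ck_on (Suc 0) (\<lambda>x. x $ i * (w x)\<^sup>2) W" by (rule Ck_on_mult[OF W(1) p1 p2])
    have Y1: "Ck_on (Suc 0) Y W"
      unfolding Y_def[abs_def] by (rule Ck_on_scaleR[OF W(1) p3 Ck_on_const])
    have div: "divergence Y x = (w x)\<^sup>2 + 2 * (x $ i) * w x * grad w x $ i" if x: "x \<in> W" for x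
    proof -
      note d = Ck_on_differentiable[OF _ x]
      have "divergence (\<lambda>_. axis i (1::real)) x = 0"
        by (simp add: divergence_def partial_eq_grad grad_const)
      moreover have g2: "grad (\<lambda>x. (w x)\<^sup>2) x = (2 * w x) *\<^sub>R grad w x"
        unfolding power2_eq_square by (simp add: grad_mult[OF d[OF w] d[OF w]] flip: scaleR_add_left)
      ultimately show ?thesis
        unfolding Y_def[abs_def]
        by (subst divergence_scaleR[OF d[OF p3]])
          (simp_all add: grad_mult[OF d[OF p1] d[OF p2]] g2 grad_nth_coord inner_axis)
    qed
    have cw: "continuous_on (closure \<Omega>) w" and cg: "continuous_on (closure \<Omega>) (grad w)"
      by (rule Ck_continuous[OF w W(2)]) (rule Ck_continuous[OF Ck_on_grad[OF W(1) w] W(2)])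
    have cY: "continuous_on (closure \<Omega>) (divergence Y)"
      by (rule Ck_continuous[OF Ck_on_divergence[OF W(1) Y1] W(2)])
    have "(LINT x:\<Omega>|lborel. (w x)\<^sup>2) \<le> (LINT x:\<Omega>|lborel. divergence Y x) +
        (1 / 2 * (LINT x:\<Omega>|lborel. (w x)\<^sup>2) + 2 * R\<^sup>2 * (LINT x:\<Omega>|lborel. (norm (grad w x))\<^sup>2))"
    proof (rule integral_le_combination)
      fix x assume x: "x \<in> \<Omega>"
      have "\<bar>x $ i * grad w x $ i\<bar> \<le> R * norm (grad w x)"
        unfolding abs_mult using R(1) order_trans[OF component_le_norm_cart R(2)[OF x]]
        by (intro mult_mono component_le_norm_cart) auto
      then have "(x $ i * grad w x $ i)\<^sup>2 \<le> (R * norm (grad w x))\<^sup>2"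
        using abs_le_square_iff[of "x $ i * grad w x $ i" "R * norm (grad w x)"] R(1) by (simp add: abs_mult)
      moreover have "2 * w x * (- (x $ i * grad w x $ i)) \<le> 1 / 2 * (w x)\<^sup>2 + (- (x $ i * grad w x $ i))\<^sup>2 / (1 / 2)"
        by (rule young) simp
      ultimately show "(w x)\<^sup>2 \<le> divergence Y x + (1 / 2 * (w x)\<^sup>2 + 2 * R\<^sup>2 * (norm (grad w x))\<^sup>2)"
        by (simp add: div[OF in_W[OF W(2) x]] power_mult_distrib algebra_simps)
    qed (intro continuous_intros cw cg cY)+
    moreover have "(LINT x:\<Omega>|lborel. divergence Y x) = 0"
      by (rule integral_divergence_eq_0[OF W Y1]) (simp add: Y_def w0)
    ultimately show ?thesis by simp
  qed
  moreover have "4 * R\<^sup>2 > 0" using R(1) by simp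
  ultimately show ?thesis by blast
qed

text \<open>The choice of \<open>g\<close> selects the test field: the identity produces the fourth
  power of the gradient norm, \<open>cutoff K s * s\<close> its truncation. All other terms carry
  the undifferentiated \<open>w\<close>, which is where a sup bound on \<open>w\<close>
  enters.\<close>

lemma
  assumes W: "open W" and w: "Ck_on (Suc (Suc 0)) w W"
    and g: "Ck_on (Suc 0) g UNIV" "\<And>s. (g has_real_derivative g' s) (at s)"
  defines "Y \<equiv> \<lambda>y. (g ((norm (grad w y))\<^sup>2) * w y) *\<^sub>R grad w y"
  shows Ck_quartic: "Ck_on (Suc 0) Y W"
    and divergence_quartic: "x \<in> W \<Longrightarrow> divergence Y x = g ((norm (grad w x))\<^sup>2) * (norm (grad w x))\<^sup>2
      + g ((norm (grad w x))\<^sup>2) * w x * laplacian w x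
      + 2 * w x * g' ((norm (grad w x))\<^sup>2) * ((vgrad (grad w) x *v grad w x) \<bullet> grad w x)"
proof -
  have w1: "Ck_on (Suc 0) w W" and g1: "Ck_on (Suc 0) (grad w) W"
    using w by (rule Ck_on_SucD) (rule Ck_on_grad[OF W w])
  have h1: "Ck_on (Suc 0) (\<lambda>x. (norm (grad w x))\<^sup>2) W"
    unfolding power2_norm_eq_inner by (intro Ck_on_inner W g1)
  have gh: "Ck_on (Suc 0) (\<lambda>x. g ((norm (grad w x))\<^sup>2)) W"
    by (rule Ck_on_compose_real[OF W h1 g(1)]) simp
  have ghw: "Ck_on (Suc 0) (\<lambda>x. g ((norm (grad w x))\<^sup>2) * w x) W"
    by (rule Ck_on_mult[OF W gh w1])
  show "Ck_on (Suc 0) Y W" unfolding Y_def by (rule Ck_on_scaleR[OF W ghw g1])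
  assume x: "x \<in> W"
  note d = Ck_on_differentiable[OF _ x]
  show "divergence Y x = g ((norm (grad w x))\<^sup>2) * (norm (grad w x))\<^sup>2 + g ((norm (grad w x))\<^sup>2) * w x * laplacian w x
      + 2 * w x * g' ((norm (grad w x))\<^sup>2) * ((vgrad (grad w) x *v grad w x) \<bullet> grad w x)"
    unfolding Y_def
    by (subst divergence_scaleR[OF d[OF ghw] d[OF g1]], subst grad_mult[OF d[OF gh] d[OF w1]])
      (simp add: grad_compose[OF d[OF h1] g(2)] grad_norm_grad_sq[OF W w x] laplacian_eq_divergence
        inner_add_left dot_square_norm algebra_simps)
qed

lemma quadratic_form_le: "\<bar>((A :: real^'n^'n) *v v) \<bullet> v\<bar> \<le> norm A * (norm v)\<^sup>2"
proof -
  have "\<bar>(A *v v) \<bullet> v\<bar> \<le> norm (A *v v) * norm v" by (rule Cauchy_Schwarz_ineq2)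
  also have "\<dots> \<le> norm A * norm v * norm v" by (intro mult_right_mono norm_matrix_vector_mult_le) simp
  finally show ?thesis by (simp add: power2_eq_square mult.assoc)
qed

end

context hessian_estimate
begin

lemma integral_estimate:
  assumes "0 < c0" "\<And>x. x \<in> \<Omega> \<Longrightarrow> c0 \<le> E x" "\<And>x. x \<in> \<Omega> \<Longrightarrow> E x \<le> c1"
    "\<And>x. x \<in> \<Omega> \<Longrightarrow> norm (grad E x) \<le> G" "\<And>x. x \<in> \<Omega> \<Longrightarrow> \<bar>laplacian E x\<bar> \<le> G"
    "0 \<le> L" "\<And>x. x \<in> \<Omega> \<Longrightarrow> - L \<le> f' (w x)"
    "4 * G\<^sup>2 / c0 + 2 * G + c1 * CARD('n) + c1 \<le> C"
  shows "(LINT x:\<Omega>|lborel. T (P x) * (c0 / 2 * (norm (hess x))\<^sup>2 + (A - C - c1 * L) * (norm (grad w x))\<^sup>2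
      + A * w x * laplacian w x)) \<le> C * (LINT x:\<Omega>|lborel. (m x)\<^sup>2)" (is "?I \<le> _")
proof -
  have "?I \<le> (LINT x:\<Omega>|lborel. divergence Z x) + (C * (LINT x:\<Omega>|lborel. (m x)\<^sup>2) + 0 * (LINT x:\<Omega>|lborel. (m x)\<^sup>2))"
  proof (rule integral_le_combination)
    show "T (P x) * (c0 / 2 * (norm (hess x))\<^sup>2 + (A - C - c1 * L) * (norm (grad w x))\<^sup>2
      + A * w x * laplacian w x) \<le> divergence Z x + (C * (m x)\<^sup>2 + 0 * (m x)\<^sup>2)" if x: "x \<in> \<Omega>" for x
      using divergence_Z_ge[OF in_W[OF W(2) x] assms(1) assms(2,3,4,5)[OF x] assms(6) assms(7)[OF x] assms(8)]
      by simp
    show "continuous_on (closure \<Omega>) (divergence Z)"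
      by (rule Ck_continuous[OF Ck_on_divergence[OF W(1) Ck1_Z] W(2)])
    show "continuous_on (closure \<Omega>) (\<lambda>x. T (P x) * (c0 / 2 * (norm (hess x))\<^sup>2 + (A - C - c1 * L) * (norm (grad w x))\<^sup>2
      + A * w x * laplacian w x))"
      by (intro continuous_intros continuous_on_hess_norm[OF W Ck2_w] Ck_continuous[OF Ck1_T_P W(2)] Ck_continuous[OF Ck1_grad_w W(2)]
          Ck_continuous[OF Ck1_w W(2)] Ck_continuous[OF Ck1_laplacian W(2)])
  qed (intro continuous_intros Ck_continuous[OF Ck1_m W(2)])+
  moreover have "(LINT x:\<Omega>|lborel. divergence Z x) \<le> 0"
    by (rule integral_divergence_nonpos[OF W Ck1_Z Z_boundary])
  ultimately show ?thesis by simp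
qed

end

context smooth_domain
begin

text \<open>With \<open>f = 0\<close> and \<open>T = 1\<close> the lower-order terms reduce to
  \<open>w x * laplacian w x\<close>, which the Poincare inequality and Green's identity bound by
  the squared Laplacian.\<close>

lemma hessian_L2_bound:
  "\<exists>C>0. \<forall>W w. open W \<and> closure \<Omega> \<subseteq> W \<and> Ck_on (Suc (Suc (Suc 0))) w W \<and> (\<forall>x\<in>frontier \<Omega>. w x = 0) \<longrightarrow>
    (LINT x:\<Omega>|lborel. (norm (vgrad (grad w) x))\<^sup>2) \<le> C * (LINT x:\<Omega>|lborel. (laplacian w x)\<^sup>2)"
proof -
  obtain B where B: "boundary_bound B" using boundary_bound_exists by blast
  obtain c0 c1 G where c: "0 < c0" "\<forall>x\<in>closure \<Omega>. c0 \<le> weight B x \<and> weight B x \<le> c1 \<and>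
     norm (grad (weight B) x) \<le> G \<and> \<bar>laplacian (weight B) x\<bar> \<le> G"
    using weight_bounds by blast
  obtain Cp where Cp: "Cp > 0" "\<And>W w. open W \<Longrightarrow> closure \<Omega> \<subseteq> W \<Longrightarrow> Ck_on (Suc 0) w W \<Longrightarrow> (\<forall>x\<in>frontier \<Omega>. w x = 0) \<Longrightarrow>
    (LINT x:\<Omega>|lborel. (w x)\<^sup>2) \<le> Cp * (LINT x:\<Omega>|lborel. (norm (grad w x))\<^sup>2)" using poincare by blast
  define C where "C = max 1 (4 * G\<^sup>2 / c0 + 2 * G + c1 * CARD('n) + c1)"
  have C: "C \<ge> 1" "4 * G\<^sup>2 / c0 + 2 * G + c1 * CARD('n) + c1 \<le> C" by (auto simp: C_def)
  have c': "c0 \<le> weight B x" "weight B x \<le> c1" "norm (grad (weight B) x) \<le> G" "\<bar>laplacian (weight B) x\<bar> \<le> G"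
    if "x \<in> \<Omega>" for x using c(2) that closure_subset by blast+
  have "(LINT x:\<Omega>|lborel. (norm (vgrad (grad w) x))\<^sup>2) \<le> 2 / c0 * (2 * C + C * Cp\<^sup>2) * (LINT x:\<Omega>|lborel. (laplacian w x)\<^sup>2)"
    if W: "open W" "closure \<Omega> \<subseteq> W" and w: "Ck_on (Suc (Suc (Suc 0))) w W" and w0: "\<forall>x\<in>frontier \<Omega>. w x = 0" for W w
  proof -
    \<comment> \<open>Taking \<open>A = C\<close>, and \<open>L = 0\<close> when the estimate is
      applied, annihilates the coefficient of the squared gradient.\<close>
    interpret he: hessian_estimate \<Omega> \<rho> B C W w "\<lambda>_. 0" "\<lambda>_. 0" "\<lambda>_. 1" "\<lambda>_. 0"
      using B W w w0 C by unfold_locales auto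
    note cw = Ck_continuous[OF he.Ck1_w W(2)] and cg = Ck_continuous[OF he.Ck1_grad_w W(2)] and cl = Ck_continuous[OF he.Ck1_laplacian W(2)]
      and ch = continuous_on_hess_norm[OF W he.Ck2_w]
    define I1 I2 I3 I4 where "I1 = (LINT x:\<Omega>|lborel. (w x)\<^sup>2)" and "I2 = (LINT x:\<Omega>|lborel. (norm (grad w x))\<^sup>2)"
      and "I3 = (LINT x:\<Omega>|lborel. (laplacian w x)\<^sup>2)" and "I4 = (LINT x:\<Omega>|lborel. (norm (vgrad (grad w) x))\<^sup>2)"
    have P: "I1 \<le> Cp * I2" unfolding I1_def I2_def by (rule Cp(2)[OF W he.Ck1_w w0])
    \<comment> \<open>Green's identity and Young with weight \<open>1 / Cp\<close>: by Poincare the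
      term with \<open>I1\<close> is at most half of \<open>I2\<close>, so that
      \<open>I2 \<le> Cp * I3\<close>.\<close>
    have "I2 \<le> (LINT x:\<Omega>|lborel. divergence (\<lambda>y. w y *\<^sub>R grad w y) x) + (1 / (2 * Cp) * I1 + Cp / 2 * I3)"
      unfolding I1_def I2_def I3_def
    proof (rule integral_le_combination)
      fix x assume x: "x \<in> \<Omega>"
      note d = Ck_on_differentiable[OF _ in_W[OF W(2) x]]
      have "2 * w x * (- laplacian w x) \<le> 1 / Cp * (w x)\<^sup>2 + (- laplacian w x)\<^sup>2 / (1 / Cp)"
        by (rule young) (use Cp in simp)
      then show "(norm (grad w x))\<^sup>2 \<le> divergence (\<lambda>y. w y *\<^sub>R grad w y) x + (1 / (2 * Cp) * (w x)\<^sup>2 + Cp / 2 * (laplacian w x)\<^sup>2)"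
        by (simp add: divergence_scaleR[OF d[OF he.Ck1_w] d[OF he.Ck1_grad_w]] laplacian_eq_divergence dot_square_norm field_simps)
    next
      show "continuous_on (closure \<Omega>) (divergence (\<lambda>y. w y *\<^sub>R grad w y))"
        by (rule Ck_continuous[OF Ck_on_divergence[OF W(1) Ck_on_scaleR[OF W(1) he.Ck1_w he.Ck1_grad_w]] W(2)])
    qed (intro continuous_intros cw cg cl)+
    moreover have "(LINT x:\<Omega>|lborel. divergence (\<lambda>y. w y *\<^sub>R grad w y) x) = 0"
      by (rule integral_divergence_eq_0[OF W Ck_on_scaleR[OF W(1) he.Ck1_w he.Ck1_grad_w]]) (simp add: w0)
    moreover have "1 / (2 * Cp) * I1 \<le> 1 / (2 * Cp) * (Cp * I2)" using P Cp(1) by (intro mult_left_mono) auto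
    ultimately have I2: "I2 \<le> Cp * I3" using Cp(1) by simp
    then have "Cp * I2 \<le> Cp * (Cp * I3)" using Cp(1) by (intro mult_left_mono) auto
    then have I1: "I1 \<le> Cp\<^sup>2 * I3" using P by (simp add: power2_eq_square)
    have H: "(LINT x:\<Omega>|lborel. c0 / 2 * (norm (vgrad (grad w) x))\<^sup>2) \<le> (LINT x:\<Omega>|lborel. c0 / 2 * (norm (vgrad (grad w) x))\<^sup>2 + C * w x * laplacian w x)
        + (C * I1 + C * I3)"
      unfolding I1_def I3_def
    proof (rule integral_le_combination)
      fix x
      have "- (w x * laplacian w x) \<le> (w x)\<^sup>2 + (laplacian w x)\<^sup>2"
        using sum_squares_bound[of "w x" "- laplacian w x"] zero_le_power2[of "w x"] zero_le_power2[of "laplacian w x"]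
        unfolding power2_minus by linarith
      then have "C * - (w x * laplacian w x) \<le> C * ((w x)\<^sup>2 + (laplacian w x)\<^sup>2)" using C(1) by (intro mult_left_mono) auto
      then show "c0 / 2 * (norm (vgrad (grad w) x))\<^sup>2 \<le> c0 / 2 * (norm (vgrad (grad w) x))\<^sup>2 + C * w x * laplacian w x
        + (C * (w x)\<^sup>2 + C * (laplacian w x)\<^sup>2)" by (simp add: algebra_simps)
    qed (intro continuous_intros cw cg cl ch)+
    have H2: "(LINT x:\<Omega>|lborel. c0 / 2 * (norm (vgrad (grad w) x))\<^sup>2 + C * w x * laplacian w x) \<le> C * I3"
      using he.integral_estimate[OF c(1) c' _ _ C(2), of 0] by (simp add: he.m_def I3_def)
    have H3: "(LINT x:\<Omega>|lborel. c0 / 2 * (norm (vgrad (grad w) x))\<^sup>2) = c0 / 2 * I4"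
      by (simp add: I4_def)
    have H4: "C * I1 \<le> C * (Cp\<^sup>2 * I3)" using I1 C(1) by (intro mult_left_mono) auto
    have "(2 * C + C * Cp\<^sup>2) * I3 = C * I3 + C * I3 + C * (Cp\<^sup>2 * I3)" by (simp add: algebra_simps)
    then have "c0 / 2 * I4 \<le> (2 * C + C * Cp\<^sup>2) * I3" using H H2 H4 unfolding H3 by linarith
    then show ?thesis unfolding I3_def[symmetric] I4_def[symmetric] using c(1) by (simp add: field_simps)
  qed
  moreover have "2 / c0 * (2 * C + C * Cp\<^sup>2) > 0" using c(1) C(1) by (simp add: add_pos_nonneg)
  ultimately show ?thesis by blast
qed

text \<open>An interpolation inequality of Gagliardo-Nirenberg type. Each of the two error terms in
  the divergence of the quartic field uses a quarter of the fourth power in Young's inequality, and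
  \<open>hessian_L2_bound\<close> disposes of the second derivatives.\<close>

lemma grad_L4_bound:
  "\<exists>C>0. \<forall>W w M. open W \<and> closure \<Omega> \<subseteq> W \<and> Ck_on (Suc (Suc (Suc 0))) w W \<and> (\<forall>x\<in>frontier \<Omega>. w x = 0) \<and>
      (\<forall>x\<in>\<Omega>. \<bar>w x\<bar> \<le> M) \<longrightarrow>
    (LINT x:\<Omega>|lborel. ((norm (grad w x))\<^sup>2)\<^sup>2) \<le> C * M\<^sup>2 * (LINT x:\<Omega>|lborel. (laplacian w x)\<^sup>2)"
proof -
  obtain C where C: "C > 0" "\<And>W w. open W \<Longrightarrow> closure \<Omega> \<subseteq> W \<Longrightarrow> Ck_on (Suc (Suc (Suc 0))) w W \<Longrightarrow> (\<forall>x\<in>frontier \<Omega>. w x = 0) \<Longrightarrow>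
    (LINT x:\<Omega>|lborel. (norm (vgrad (grad w) x))\<^sup>2) \<le> C * (LINT x:\<Omega>|lborel. (laplacian w x)\<^sup>2)"
    using hessian_L2_bound by blast
  have "(LINT x:\<Omega>|lborel. ((norm (grad w x))\<^sup>2)\<^sup>2) \<le> (2 + 8 * C) * M\<^sup>2 * (LINT x:\<Omega>|lborel. (laplacian w x)\<^sup>2)"
    if W: "open W" "closure \<Omega> \<subseteq> W" and w: "Ck_on (Suc (Suc (Suc 0))) w W" and w0: "\<forall>x\<in>frontier \<Omega>. w x = 0"
      and M: "\<forall>x\<in>\<Omega>. \<bar>w x\<bar> \<le> M" for W w M
  proof -
    have w2: "Ck_on (Suc (Suc 0)) w W" by (rule Ck_on_SucD[OF w])
    define Y where "Y y = ((norm (grad w y))\<^sup>2 * w y) *\<^sub>R grad w y" for y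
    have Y1: "Ck_on (Suc 0) Y W"
      unfolding Y_def[abs_def] by (rule Ck_quartic[OF W(1) w2 Ck_on_ident DERIV_ident])
    have div: "divergence Y x = ((norm (grad w x))\<^sup>2)\<^sup>2
        + (norm (grad w x))\<^sup>2 * w x * laplacian w x + 2 * w x * ((vgrad (grad w) x *v grad w x) \<bullet> grad w x)"
      if "x \<in> W" for x
      unfolding Y_def[abs_def] divergence_quartic[OF W(1) w2 Ck_on_ident DERIV_ident that]
      by (simp add: power2_eq_square[of "(norm _)\<^sup>2"])
    have "(LINT x:\<Omega>|lborel. 1 / 2 * ((norm (grad w x))\<^sup>2)\<^sup>2) \<le> (LINT x:\<Omega>|lborel. divergence Y x) +
       (M\<^sup>2 * (LINT x:\<Omega>|lborel. (laplacian w x)\<^sup>2) + 4 * M\<^sup>2 * (LINT x:\<Omega>|lborel. (norm (vgrad (grad w) x))\<^sup>2))"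
    proof (rule integral_le_combination)
      fix x assume x: "x \<in> \<Omega>"
      define h H where "h = (norm (grad w x))\<^sup>2" and "H = norm (vgrad (grad w) x)"
      have h: "h \<ge> 0" "H \<ge> 0" by (auto simp: h_def H_def)
      have wM: "\<bar>w x\<bar> \<le> M" using M x by blast
      have "2 * h * (\<bar>w x\<bar> * \<bar>laplacian w x\<bar> / 2) \<le> 1 / 4 * h\<^sup>2 + (\<bar>w x\<bar> * \<bar>laplacian w x\<bar> / 2)\<^sup>2 / (1 / 4)"
        by (rule young) simp
      also have "(\<bar>w x\<bar> * \<bar>laplacian w x\<bar> / 2)\<^sup>2 / (1 / 4) = (w x)\<^sup>2 * (laplacian w x)\<^sup>2"
        by (simp add: power_divide power_mult_distrib)
      also have "\<dots> \<le> M\<^sup>2 * (laplacian w x)\<^sup>2"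
        using power_mono[OF wM, of 2] by (intro mult_right_mono) auto
      finally have 1: "h * (\<bar>w x\<bar> * \<bar>laplacian w x\<bar>) \<le> 1 / 4 * h\<^sup>2 + M\<^sup>2 * (laplacian w x)\<^sup>2" by simp
      have "2 * h * (\<bar>w x\<bar> * H) \<le> 1 / 4 * h\<^sup>2 + (\<bar>w x\<bar> * H)\<^sup>2 / (1 / 4)"
        by (rule young) simp
      also have "(\<bar>w x\<bar> * H)\<^sup>2 / (1 / 4) = 4 * ((w x)\<^sup>2 * H\<^sup>2)"
        by (simp add: power_mult_distrib)
      also have "\<dots> \<le> 4 * (M\<^sup>2 * H\<^sup>2)"
        using power_mono[OF wM, of 2] by (intro mult_left_mono mult_right_mono) auto
      finally have 2: "2 * (\<bar>w x\<bar> * (H * h)) \<le> 1 / 4 * h\<^sup>2 + 4 * M\<^sup>2 * H\<^sup>2" by (simp add: mult_ac)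
      have "\<bar>h * w x * laplacian w x\<bar> = h * (\<bar>w x\<bar> * \<bar>laplacian w x\<bar>)" using h by (simp add: abs_mult)
      moreover have "\<bar>2 * w x * ((vgrad (grad w) x *v grad w x) \<bullet> grad w x)\<bar> \<le> 2 * (\<bar>w x\<bar> * (H * h))"
        using mult_left_mono[OF quadratic_form_le[of "vgrad (grad w) x" "grad w x"], of "\<bar>w x\<bar>"]
        by (simp add: abs_mult h_def H_def)
      ultimately show "1 / 2 * ((norm (grad w x))\<^sup>2)\<^sup>2 \<le> divergence Y x + (M\<^sup>2 * (laplacian w x)\<^sup>2 + 4 * M\<^sup>2 * (norm (vgrad (grad w) x))\<^sup>2)"
        unfolding div[OF in_W[OF W(2) x]] h_def[symmetric] H_def[symmetric] using 1 2 by linarith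
    qed (intro continuous_intros continuous_on_hess_norm[OF W w2] Ck_continuous[OF Ck_on_divergence[OF W(1) Y1] W(2)]
      Ck_continuous[OF Ck_on_grad[OF W(1) w] W(2)] Ck_continuous[OF Ck_on_laplacian[OF W(1) w] W(2)])+
    moreover have "(LINT x:\<Omega>|lborel. divergence Y x) = 0"
      by (rule integral_divergence_eq_0[OF W Y1]) (simp add: Y_def w0)
    moreover have "4 * M\<^sup>2 * (LINT x:\<Omega>|lborel. (norm (vgrad (grad w) x))\<^sup>2) \<le> 4 * M\<^sup>2 * (C * (LINT x:\<Omega>|lborel. (laplacian w x)\<^sup>2))"
      by (intro mult_left_mono C(2)[OF W w w0]) auto
    ultimately show ?thesis by (simp add: algebra_simps)
  qed
  moreover have "2 + 8 * C > 0" using C(1) by simp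
  ultimately show ?thesis by blast
qed

end

section \<open>Gradient bounds with a constant uniform in the nonlinearity\<close>

context smooth_domain
begin

text \<open>The truncation level \<open>K1\<close> is chosen so high that on \<open>P > K1\<close> the good term \<open>\<bar>grad w\<bar>\<^sup>2\<close> absorbs
  everything produced by \<open>f\<close>; this makes the constant \<open>C\<close> independent of \<open>f\<close>.\<close>

lemma truncated_grad_L4_bound:
  "\<exists>C>0. \<forall>f f' L F. Ck_on (Suc 0) f UNIV \<and> (\<forall>s. (f has_real_derivative f' s) (at s)) \<and> f 0 = 0 \<and> 0 \<le> L \<and> 0 \<le> F \<and>
      (\<forall>s. 0 \<le> s \<longrightarrow> s \<le> 2 \<longrightarrow> - L \<le> f' s \<and> \<bar>f s\<bar> \<le> F) \<longrightarrow>
    (\<exists>K>0. \<forall>W w. open W \<and> closure \<Omega> \<subseteq> W \<and> Ck_on (Suc (Suc (Suc 0))) w W \<and> (\<forall>x\<in>frontier \<Omega>. w x = 0) \<and>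
        (\<forall>x\<in>\<Omega>. 0 \<le> w x \<and> w x \<le> 2) \<longrightarrow>
      (LINT x:\<Omega>|lborel. cutoff K ((norm (grad w x))\<^sup>2) * ((norm (grad w x))\<^sup>2)\<^sup>2)
        \<le> C * (LINT x:\<Omega>|lborel. (laplacian w x - f (w x))\<^sup>2))"
proof -
  obtain B where B: "boundary_bound B" using boundary_bound_exists by blast
  obtain c0 c1 G where c: "0 < c0" "\<forall>x\<in>closure \<Omega>. c0 \<le> weight B x \<and> weight B x \<le> c1 \<and>
     norm (grad (weight B) x) \<le> G \<and> \<bar>laplacian (weight B) x\<bar> \<le> G"
    using weight_bounds by blast
  define C where "C = max 1 (4 * G\<^sup>2 / c0 + 2 * G + c1 * CARD('n) + c1)"
  have C: "C \<ge> 1" "4 * G\<^sup>2 / c0 + 2 * G + c1 * CARD('n) + c1 \<le> C" by (auto simp: C_def)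
  have c': "c0 \<le> weight B x" "weight B x \<le> c1" "norm (grad (weight B) x) \<le> G" "\<bar>laplacian (weight B) x\<bar> \<le> G"
    if "x \<in> \<Omega>" for x using c(2) that closure_subset by blast+
  define N where "N = real CARD('n)"
  have N: "N > 0" by (simp add: N_def)
  \<comment> \<open>Collects the factors of the two steps below; neither \<open>L\<close> nor
    \<open>F\<close> enters.\<close>
  define D where "D = 2 * (8 * N + 576) * (2 / c0) * (C + 1)"
  have D: "D > 0" using c(1) C(1) N by (simp add: D_def)
  have "\<exists>K>0. \<forall>W w. open W \<and> closure \<Omega> \<subseteq> W \<and> Ck_on (Suc (Suc (Suc 0))) w W \<and> (\<forall>x\<in>frontier \<Omega>. w x = 0) \<and>
        (\<forall>x\<in>\<Omega>. 0 \<le> w x \<and> w x \<le> 2) \<longrightarrow>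
      (LINT x:\<Omega>|lborel. cutoff K ((norm (grad w x))\<^sup>2) * ((norm (grad w x))\<^sup>2)\<^sup>2)
        \<le> D * (LINT x:\<Omega>|lborel. (laplacian w x - f (w x))\<^sup>2)"
    if f: "Ck_on (Suc 0) f UNIV" "\<And>s. (f has_real_derivative f' s) (at s)" "f 0 = 0" and L: "0 \<le> L" and F: "0 \<le> F"
      and b: "\<And>s. 0 \<le> s \<Longrightarrow> s \<le> 2 \<Longrightarrow> - L \<le> f' s \<and> \<bar>f s\<bar> \<le> F" for f f' L F
  proof -
    define c1' where "c1' = max c0 c1"
    have c1': "c1' > 0" "c1 \<le> c1'" using c(1) by (auto simp: c1'_def)
    \<comment> \<open>Then \<open>A - C - c1 * L = 1 + \<bar>c1\<bar> * L\<close>, so the squared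
      gradient has a coefficient of at least 1. The summand with \<open>\<bar>c1\<bar>\<close> also
      secures \<open>A \<ge> 1\<close>.\<close>
    define A where "A = 1 + C + c1 * L + \<bar>c1\<bar> * L"
    have c1L: "0 \<le> c1 * L + \<bar>c1\<bar> * L" using mult_nonneg_nonneg[of "c1 + \<bar>c1\<bar>" L] L by (simp add: distrib_right)
    have A: "A \<ge> 1" using C(1) c1L by (simp add: A_def)
    \<comment> \<open>From \<open>0 \<le> w x \<le> 2\<close>, the bound \<open>F\<close> and
      Young's inequality, \<open>A * w x * laplacian w x\<close> is at least
      \<open>- K0 - (he.m x)\<^sup>2\<close>.\<close>
    define K0 where "K0 = A\<^sup>2 + 2 * A * F"
    \<comment> \<open>As \<open>P\<close> is at most \<open>c1'\<close> times the squared gradient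
      plus \<open>4 * A\<close>, a value above \<open>K1\<close> forces the squared gradient above
      \<open>K0\<close>. Conversely a squared gradient above the \<open>K\<close> defined next makes
      \<open>P\<close> at least \<open>2 * K1\<close>, where the truncation in \<open>P\<close> is
      at least 1/2.\<close>
    define K1 where "K1 = c1' * K0 + 4 * A"
    define K where "K = 2 * K1 / c0"
    have K0: "K0 \<ge> 0" using A F by (simp add: K0_def)
    have K1: "K1 > 0" using A K0 c1' by (simp add: K1_def add_nonneg_pos)
    have K: "K > 0" using K1 c(1) by (simp add: K_def)
    have "(LINT x:\<Omega>|lborel. cutoff K ((norm (grad w x))\<^sup>2) * ((norm (grad w x))\<^sup>2)\<^sup>2)
        \<le> D * (LINT x:\<Omega>|lborel. (laplacian w x - f (w x))\<^sup>2)"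
      if W: "open W" "closure \<Omega> \<subseteq> W" and w: "Ck_on (Suc (Suc (Suc 0))) w W" and w0: "\<forall>x\<in>frontier \<Omega>. w x = 0"
        and w2: "\<And>x. x \<in> \<Omega> \<Longrightarrow> 0 \<le> w x \<and> w x \<le> 2" for W w
    proof -
      interpret he: hessian_estimate \<Omega> \<rho> B A W w f f' "cutoff K1" "cutoff_deriv K1"
        using B W w w0 A f Ck_on_cutoff[OF K1] has_real_derivative_cutoff[OF K1] cutoff_bounds cutoff_deriv_nonneg
          cutoff_deriv_bounds(2)[OF K1]
        by unfold_locales (auto simp del: Ck_on.simps)
      let ?h = "\<lambda>x. (norm (grad w x))\<^sup>2" and ?H = "\<lambda>x. (norm (vgrad (grad w) x))\<^sup>2"
      let ?T = "\<lambda>x. cutoff K1 (he.P x)"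
      define J where "J = (LINT x:\<Omega>|lborel. (he.m x)\<^sup>2)"
      note cw = Ck_continuous[OF he.Ck1_w W(2)] and cg = Ck_continuous[OF he.Ck1_grad_w W(2)] and cl = Ck_continuous[OF he.Ck1_laplacian W(2)]
        and ch = continuous_on_hess_norm[OF W he.Ck2_w] and cT = Ck_continuous[OF he.Ck1_T_P W(2)] and cm = Ck_continuous[OF he.Ck1_m W(2)]
      have cE: "continuous_on (closure \<Omega>) (\<lambda>x. ?T x * (c0 / 2 * ?H x + (A - C - c1 * L) * ?h x + A * w x * laplacian w x))"
        by (intro continuous_intros cw cg cl ch cT)
      have est: "(LINT x:\<Omega>|lborel. ?T x * (c0 / 2 * ?H x + (A - C - c1 * L) * ?h x + A * w x * laplacian w x)) \<le> C * J"
        unfolding J_def using c(1) c' L C(2) b w2 by (intro he.integral_estimate) auto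
      have "(LINT x:\<Omega>|lborel. c0 / 2 * (?T x * ?H x)) \<le>
          (LINT x:\<Omega>|lborel. ?T x * (c0 / 2 * ?H x + (A - C - c1 * L) * ?h x + A * w x * laplacian w x)) + (1 * J + 0 * J)"
        unfolding J_def
      proof (rule integral_le_combination[OF _ cE])
        fix x assume x: "x \<in> \<Omega>"
        have wx: "0 \<le> w x" "w x \<le> 2" using w2[OF x] by auto
        have "?T x * (c0 / 2 * ?H x) - (he.m x)\<^sup>2 \<le> ?T x * (c0 / 2 * ?H x + (A - C - c1 * L) * ?h x + A * w x * laplacian w x)"
        proof (cases "he.P x \<le> K1")
          case False
          have "he.P x \<le> c1' * ?h x + A * 4"
          proof -
            have "weight B x * ?h x \<le> c1' * ?h x" using c'(2)[OF x] c1' by (intro mult_right_mono) auto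
            moreover have "A * (w x)\<^sup>2 \<le> A * 2\<^sup>2" using A wx by (intro mult_left_mono power_mono) auto
            ultimately show ?thesis by (simp add: he.P_def)
          qed
          then have "c1' * K0 < c1' * ?h x" using False by (simp add: K1_def)
          then have "K0 < ?h x" using c1' by simp
          moreover have "?h x \<le> (A - C - c1 * L) * ?h x"
            using mult_right_mono[of 1 "A - C - c1 * L" "?h x"] L by (simp add: A_def)
          moreover have "- (A\<^sup>2 + (he.m x)\<^sup>2 + 2 * A * F) \<le> A * w x * laplacian w x"
          proof -
            have "laplacian w x = he.m x + f (w x)" by (simp add: he.m_def)
            moreover have "\<bar>w x * he.m x\<bar> \<le> 2 * \<bar>he.m x\<bar>" unfolding abs_mult using wx by (intro mult_right_mono) auto
            moreover have "\<bar>w x * f (w x)\<bar> \<le> 2 * F" unfolding abs_mult using wx b[OF wx] F by (intro mult_mono) auto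
            ultimately have "- (2 * \<bar>he.m x\<bar> + 2 * F) \<le> w x * laplacian w x" by (simp add: distrib_left)
            then have "A * - (2 * \<bar>he.m x\<bar> + 2 * F) \<le> A * (w x * laplacian w x)" using A by (intro mult_left_mono) auto
            moreover have "2 * A * \<bar>he.m x\<bar> \<le> A\<^sup>2 + (he.m x)\<^sup>2" using sum_squares_bound[of A "\<bar>he.m x\<bar>"] by simp
            moreover have "A * - (2 * \<bar>he.m x\<bar> + 2 * F) = - (2 * A * \<bar>he.m x\<bar>) - 2 * A * F" by (simp add: algebra_simps)
            ultimately show ?thesis unfolding mult.assoc[of A "w x"] by linarith
          qed
          ultimately have "c0 / 2 * ?H x - (he.m x)\<^sup>2 \<le> c0 / 2 * ?H x + (A - C - c1 * L) * ?h x + A * w x * laplacian w x"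
            unfolding K0_def by linarith
          from mult_left_mono[OF this cutoff_bounds(1)[of K1 "he.P x"]]
          have "?T x * (c0 / 2 * ?H x) - ?T x * (he.m x)\<^sup>2 \<le> ?T x * (c0 / 2 * ?H x + (A - C - c1 * L) * ?h x + A * w x * laplacian w x)"
            by (simp only: right_diff_distrib)
          moreover have "?T x * (he.m x)\<^sup>2 \<le> (he.m x)\<^sup>2"
            using cutoff_bounds[of K1 "he.P x"] by (intro mult_left_le_one_le) auto
          ultimately show ?thesis by linarith
        qed (simp add: cutoff_eq_0)
        then show "c0 / 2 * (?T x * ?H x) \<le> ?T x * (c0 / 2 * ?H x + (A - C - c1 * L) * ?h x + A * w x * laplacian w x)
            + (1 * (he.m x)\<^sup>2 + 0 * (he.m x)\<^sup>2)"
          by (simp only: mult.left_commute[of "c0 / 2"])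
      qed (intro continuous_intros cm cT ch)+
      also have "(LINT x:\<Omega>|lborel. c0 / 2 * (?T x * ?H x)) = c0 / 2 * (LINT x:\<Omega>|lborel. ?T x * ?H x)"
        by simp
      finally have 1: "(LINT x:\<Omega>|lborel. ?T x * ?H x) \<le> 2 / c0 * ((C + 1) * J)"
        using est c(1) by (simp add: field_simps)
      \<comment> \<open>The quartic test field, now truncated in the squared gradient itself. On its
        support \<open>?T\<close> is at least 1/2, so its Hessian terms are controlled by the
        integral just bounded.\<close>
      define Y where "Y y = (cutoff K (?h y) * ?h y * w y) *\<^sub>R grad w y" for y
      have gC: "Ck_on (Suc 0) (\<lambda>s. cutoff K s * s) UNIV"
        by (intro Ck_on_mult open_UNIV Ck_on_cutoff[OF K] Ck_on_ident)
      have gd: "((\<lambda>s. cutoff K s * s) has_real_derivative s * cutoff_deriv K s + cutoff K s) (at s)" for s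
        using DERIV_mult[OF has_real_derivative_cutoff[OF K] DERIV_ident] by (simp add: mult.commute)
      have Y1: "Ck_on (Suc 0) Y W"
        unfolding Y_def[abs_def] by (rule Ck_quartic[OF W(1) he.Ck2_w gC gd])
      have div: "divergence Y x = cutoff K (?h x) * (?h x)\<^sup>2 + cutoff K (?h x) * ?h x * w x * laplacian w x
          + 2 * w x * (?h x * cutoff_deriv K (?h x) + cutoff K (?h x)) * ((vgrad (grad w) x *v grad w x) \<bullet> grad w x)"
        if "x \<in> W" for x
        unfolding Y_def[abs_def] divergence_quartic[OF W(1) he.Ck2_w gC gd that]
        by (simp add: power2_eq_square[of "(norm _)\<^sup>2"])
      have "(LINT x:\<Omega>|lborel. 1 / 2 * (cutoff K (?h x) * (?h x)\<^sup>2)) \<le> (LINT x:\<Omega>|lborel. divergence Y x) +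
          ((8 * N + 576) * (LINT x:\<Omega>|lborel. ?T x * ?H x) + 0 * J)"
        unfolding J_def
      proof (rule integral_le_combination)
        fix x assume x: "x \<in> \<Omega>"
        have wx: "0 \<le> w x" "w x \<le> 2" using w2[OF x] by auto
        define h g g' H where "h = ?h x" and "g = cutoff K (?h x)" and "g' = ?h x * cutoff_deriv K (?h x)" and "H = norm (vgrad (grad w) x)"
        let ?l = "laplacian w x" and ?q = "(vgrad (grad w) x *v grad w x) \<bullet> grad w x"
        have g: "0 \<le> g" "g \<le> 1" "0 \<le> g'" "g'\<^sup>2 \<le> 8 * g" and hH: "0 \<le> h" "0 \<le> H"
          using cutoff_bounds cutoff_deriv_bounds(3)[OF K] by (auto simp: g_def g'_def h_def H_def cutoff_deriv_nonneg)
        have T0: "0 \<le> ?T x" by (rule cutoff_bounds)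
        show "1 / 2 * (cutoff K (?h x) * (?h x)\<^sup>2) \<le> divergence Y x + ((8 * N + 576) * (?T x * ?H x) + 0 * (he.m x)\<^sup>2)"
        proof (cases "h \<le> K")
          case True
          then show ?thesis using T0 N
            by (simp add: div[OF in_W[OF W(2) x]] h_def cutoff_eq_0 cutoff_deriv_eq_0)
        next
          case False
          have "c0 * h \<le> weight B x * h" using c'(1)[OF x] hH by (intro mult_right_mono)
          also have "\<dots> \<le> he.P x" using A by (simp add: he.P_def h_def)
          finally have "2 * K1 \<le> he.P x" using False c(1) by (simp add: K_def field_simps)
          then have T: "1 / 2 \<le> ?T x" by (rule cutoff_ge_half[OF K1])
          have "2 * h * (2 * \<bar>?l\<bar>) \<le> 1 / 4 * h\<^sup>2 * 2 + (2 * \<bar>?l\<bar>)\<^sup>2 / (1 / 4 * 2)"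
            using young[of "1 / 2" h "2 * \<bar>?l\<bar>"] by simp
          then have "h * (2 * \<bar>?l\<bar>) \<le> 1 / 4 * h\<^sup>2 + 4 * ?l\<^sup>2" by (simp add: power_mult_distrib)
          moreover have "4 * ?l\<^sup>2 \<le> 4 * (N * H\<^sup>2)" using laplacian_sq_le[of w x] by (simp add: N_def H_def)
          ultimately have "h * (2 * \<bar>?l\<bar>) \<le> 1 / 4 * h\<^sup>2 + 4 * N * H\<^sup>2" by linarith
          then have "g * (h * (2 * \<bar>?l\<bar>)) \<le> g * (1 / 4 * h\<^sup>2 + 4 * N * H\<^sup>2)" using g by (intro mult_left_mono)
          also have "\<dots> = 1 / 4 * (g * h\<^sup>2) + g * (4 * N * H\<^sup>2)" by (simp add: algebra_simps)
          also have "g * (4 * N * H\<^sup>2) \<le> 4 * N * H\<^sup>2" using g N by (intro mult_left_le_one_le) auto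
          finally have i1: "g * (h * (2 * \<bar>?l\<bar>)) \<le> 1 / 4 * (g * h\<^sup>2) + 4 * N * H\<^sup>2" by simp
          \<comment> \<open>The part \<open>g'\<close> comes from differentiating the truncation.
            The bounds \<open>g'\<^sup>2 \<le> 8 * g\<close> and \<open>g\<^sup>2 \<le> g\<close>
            preserve a factor \<open>g\<close>, so the truncated fourth power can absorb the
            term.\<close>
          have "(g' + g)\<^sup>2 \<le> 2 * (g'\<^sup>2 + g\<^sup>2)" using sum_squares_bound[of g' g] by (simp add: power2_sum)
          also have "\<dots> \<le> 2 * (8 * g + g)"
            using g by (intro mult_left_mono add_mono) (auto simp: power2_eq_square mult_left_le_one_le)
          finally have gg: "(g' + g)\<^sup>2 \<le> 18 * g" by simp
          \<comment> \<open>The weight 1/72 turns \<open>18 * g\<close> into the quarter of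
            \<open>g * h\<^sup>2\<close> that is available, at the cost
            \<open>288 * H\<^sup>2\<close>. The doubled constants \<open>8 * N + 576\<close>
            compensate for \<open>?T x\<close> being only at least 1/2.\<close>
          have "2 * ((g' + g) * h) * (2 * H) \<le> 1 / 72 * ((g' + g) * h)\<^sup>2 + (2 * H)\<^sup>2 / (1 / 72)"
            by (rule young) simp
          also have "1 / 72 * ((g' + g) * h)\<^sup>2 \<le> 1 / 72 * (18 * g * h\<^sup>2)"
            unfolding power_mult_distrib using gg by (intro mult_left_mono mult_right_mono) auto
          finally have i2: "4 * ((g' + g) * (H * h)) \<le> 1 / 4 * (g * h\<^sup>2) + 288 * H\<^sup>2" by (simp add: power_mult_distrib mult_ac)
          have "\<bar>g * h * w x * ?l\<bar> \<le> g * (h * (2 * \<bar>?l\<bar>))"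
            using g hH wx by (simp add: abs_mult mult.assoc mult_left_mono mult_right_mono)
          moreover have "\<bar>2 * w x * (g' + g) * ?q\<bar> \<le> 4 * ((g' + g) * (H * h))"
          proof -
            have "\<bar>2 * w x * (g' + g) * ?q\<bar> = 2 * w x * ((g' + g) * \<bar>?q\<bar>)" using g wx by (simp add: abs_mult)
            also have "\<dots> \<le> 2 * 2 * ((g' + g) * (H * h))"
              using g wx quadratic_form_le[of "vgrad (grad w) x" "grad w x"] hH
              by (intro mult_mono mult_left_mono) (auto simp: H_def h_def)
            finally show ?thesis by simp
          qed
          moreover have "(4 * N + 288) * H\<^sup>2 \<le> (8 * N + 576) * (?T x * H\<^sup>2)"
          proof -
            have "(8 * N + 576) * (1 / 2 * H\<^sup>2) \<le> (8 * N + 576) * (?T x * H\<^sup>2)"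
              using T N by (intro mult_left_mono mult_right_mono) auto
            then show ?thesis by (simp add: algebra_simps)
          qed
          moreover have "(4 * N + 288) * H\<^sup>2 = 4 * N * H\<^sup>2 + 288 * H\<^sup>2" by (simp add: algebra_simps)
          ultimately show ?thesis
            unfolding div[OF in_W[OF W(2) x]] h_def[symmetric] g_def[symmetric, unfolded h_def[symmetric]]
              g'_def[symmetric, unfolded h_def[symmetric]] H_def[symmetric] using i1 i2 by linarith
        qed
      next
        show "continuous_on (closure \<Omega>) (\<lambda>x. 1 / 2 * (cutoff K (?h x) * (?h x)\<^sup>2))"
          by (intro continuous_intros cg continuous_on_compose2[OF continuous_on_cutoff[OF K, of UNIV]]) auto
      qed (intro continuous_intros cT ch cm Ck_continuous[OF Ck_on_divergence[OF W(1) Y1] W(2)])+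
      moreover have "(LINT x:\<Omega>|lborel. divergence Y x) = 0"
        by (rule integral_divergence_eq_0[OF W Y1]) (simp add: Y_def w0)
      moreover have "(LINT x:\<Omega>|lborel. 1 / 2 * (cutoff K (?h x) * (?h x)\<^sup>2)) = 1 / 2 * (LINT x:\<Omega>|lborel. cutoff K (?h x) * (?h x)\<^sup>2)"
        by simp
      moreover have "(8 * N + 576) * (LINT x:\<Omega>|lborel. ?T x * ?H x) \<le> (8 * N + 576) * (2 / c0 * ((C + 1) * J))"
        using 1 N by (intro mult_left_mono) auto
      ultimately have "(LINT x:\<Omega>|lborel. cutoff K (?h x) * (?h x)\<^sup>2) \<le> 2 * ((8 * N + 576) * (2 / c0 * ((C + 1) * J)))"
        by linarith
      also have "\<dots> = D * J" by (simp add: D_def)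
      finally show ?thesis by (simp add: J_def he.m_def)
    qed
    note bound = this
    show ?thesis
    proof (intro exI[of _ K] conjI allI impI K; elim conjE)
      fix W and w :: "real^'n \<Rightarrow> real"
      assume a: "open W" "closure \<Omega> \<subseteq> W" "Ck_on (Suc (Suc (Suc 0))) w W" "\<forall>x\<in>frontier \<Omega>. w x = 0"
        "\<forall>x\<in>\<Omega>. 0 \<le> w x \<and> w x \<le> 2"
      show "(LINT x:\<Omega>|lborel. cutoff K ((norm (grad w x))\<^sup>2) * ((norm (grad w x))\<^sup>2)\<^sup>2)
        \<le> D * (LINT x:\<Omega>|lborel. (laplacian w x - f (w x))\<^sup>2)" by (rule bound[OF a(1-4) a(5)[rule_format]])
    qed
  qed
  note ex = this
  show ?thesis
  proof (rule exI[of _ D], intro conjI allI impI D; elim conjE)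
    fix f f' L F
    assume a: "Ck_on (Suc 0) f UNIV" "\<forall>s. (f has_real_derivative f' s) (at s)" "f 0 = 0" "0 \<le> L" "0 \<le> F"
      "\<forall>s. 0 \<le> s \<longrightarrow> s \<le> 2 \<longrightarrow> - L \<le> f' s \<and> \<bar>f s\<bar> \<le> F"
    show "\<exists>K>0. \<forall>W w. open W \<and> closure \<Omega> \<subseteq> W \<and> Ck_on (Suc (Suc (Suc 0))) w W \<and> (\<forall>x\<in>frontier \<Omega>. w x = 0) \<and>
        (\<forall>x\<in>\<Omega>. 0 \<le> w x \<and> w x \<le> 2) \<longrightarrow>
      (LINT x:\<Omega>|lborel. cutoff K ((norm (grad w x))\<^sup>2) * ((norm (grad w x))\<^sup>2)\<^sup>2)
        \<le> D * (LINT x:\<Omega>|lborel. (laplacian w x - f (w x))\<^sup>2)"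
      by (rule ex[OF a(1) a(2)[rule_format] a(3-5) a(6)[rule_format]])
  qed
qed

text \<open>The factor \<open>(v x)\<^sup>2\<close> is replaced by \<open>M\<^sup>2\<close> only
  where the squared gradient exceeds twice the truncation level; below it the factor is kept, as its
  integral can be absorbed later. The quantifier order carries the point: \<open>C\<close> is fixed
  before \<open>f\<close>, while \<open>K\<close> may depend on \<open>f\<close>.\<close>

lemma weighted_grad_L4_bound:
  "\<exists>C>0. \<forall>f f' L F. Ck_on (Suc 0) f UNIV \<and> (\<forall>s. (f has_real_derivative f' s) (at s)) \<and> f 0 = 0 \<and> 0 \<le> L \<and> 0 \<le> F \<and>
      (\<forall>s. 0 \<le> s \<longrightarrow> s \<le> 2 \<longrightarrow> - L \<le> f' s \<and> \<bar>f s\<bar> \<le> F) \<longrightarrow>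
    (\<exists>K\<ge>0. \<forall>W w v M. open W \<and> closure \<Omega> \<subseteq> W \<and> Ck_on (Suc (Suc (Suc 0))) w W \<and> (\<forall>x\<in>frontier \<Omega>. w x = 0) \<and>
        (\<forall>x\<in>\<Omega>. 0 \<le> w x \<and> w x \<le> 2) \<and> continuous_on (closure \<Omega>) v \<and> (\<forall>x\<in>\<Omega>. \<bar>v x\<bar> \<le> M) \<longrightarrow>
      (LINT x:\<Omega>|lborel. (v x)\<^sup>2 * ((norm (grad w x))\<^sup>2)\<^sup>2)
        \<le> C * M\<^sup>2 * (LINT x:\<Omega>|lborel. (laplacian w x - f (w x))\<^sup>2) + K * (LINT x:\<Omega>|lborel. (v x)\<^sup>2))"
proof -
  from truncated_grad_L4_bound obtain C where C: "C > 0" "\<forall>f f' L F. Ck_on (Suc 0) f UNIV \<and>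
      (\<forall>s. (f has_real_derivative f' s) (at s)) \<and> f 0 = 0 \<and> 0 \<le> L \<and> 0 \<le> F \<and>
      (\<forall>s. 0 \<le> s \<longrightarrow> s \<le> 2 \<longrightarrow> - L \<le> f' s \<and> \<bar>f s\<bar> \<le> F) \<longrightarrow>
    (\<exists>K>0. \<forall>W w. open W \<and> closure \<Omega> \<subseteq> W \<and> Ck_on (Suc (Suc (Suc 0))) w W \<and> (\<forall>x\<in>frontier \<Omega>. w x = 0) \<and>
        (\<forall>x\<in>\<Omega>. 0 \<le> w x \<and> w x \<le> 2) \<longrightarrow>
      (LINT x:\<Omega>|lborel. cutoff K ((norm (grad w x))\<^sup>2) * ((norm (grad w x))\<^sup>2)\<^sup>2)
        \<le> C * (LINT x:\<Omega>|lborel. (laplacian w x - f (w x))\<^sup>2))"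
    by (elim exE conjE) (rule that)
  show ?thesis
  proof (rule exI[of _ "2 * C"], intro conjI allI impI; (elim conjE)?)
    show "2 * C > 0" using C(1) by simp
    fix f f' L F
    assume f: "Ck_on (Suc 0) f UNIV" "\<forall>s. (f has_real_derivative f' s) (at s)" "f 0 = 0" "0 \<le> L" "0 \<le> F"
      "\<forall>s. 0 \<le> s \<longrightarrow> s \<le> 2 \<longrightarrow> - L \<le> f' s \<and> \<bar>f s\<bar> \<le> F"
    have "\<exists>K>0. \<forall>W w. open W \<and> closure \<Omega> \<subseteq> W \<and> Ck_on (Suc (Suc (Suc 0))) w W \<and> (\<forall>x\<in>frontier \<Omega>. w x = 0) \<and>
        (\<forall>x\<in>\<Omega>. 0 \<le> w x \<and> w x \<le> 2) \<longrightarrow>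
      (LINT x:\<Omega>|lborel. cutoff K ((norm (grad w x))\<^sup>2) * ((norm (grad w x))\<^sup>2)\<^sup>2)
        \<le> C * (LINT x:\<Omega>|lborel. (laplacian w x - f (w x))\<^sup>2)"
      by (rule C(2)[rule_format, of f f' L F]) (intro conjI f)
    then obtain K where K: "K > 0" "\<forall>W w. open W \<and> closure \<Omega> \<subseteq> W \<and> Ck_on (Suc (Suc (Suc 0))) w W \<and>
        (\<forall>x\<in>frontier \<Omega>. w x = 0) \<and> (\<forall>x\<in>\<Omega>. 0 \<le> w x \<and> w x \<le> 2) \<longrightarrow>
      (LINT x:\<Omega>|lborel. cutoff K ((norm (grad w x))\<^sup>2) * ((norm (grad w x))\<^sup>2)\<^sup>2)
        \<le> C * (LINT x:\<Omega>|lborel. (laplacian w x - f (w x))\<^sup>2)"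
      by (elim exE conjE) (rule that)
    show "\<exists>K\<ge>0. \<forall>W w v M. open W \<and> closure \<Omega> \<subseteq> W \<and> Ck_on (Suc (Suc (Suc 0))) w W \<and> (\<forall>x\<in>frontier \<Omega>. w x = 0) \<and>
        (\<forall>x\<in>\<Omega>. 0 \<le> w x \<and> w x \<le> 2) \<and> continuous_on (closure \<Omega>) v \<and> (\<forall>x\<in>\<Omega>. \<bar>v x\<bar> \<le> M) \<longrightarrow>
      (LINT x:\<Omega>|lborel. (v x)\<^sup>2 * ((norm (grad w x))\<^sup>2)\<^sup>2)
        \<le> 2 * C * M\<^sup>2 * (LINT x:\<Omega>|lborel. (laplacian w x - f (w x))\<^sup>2) + K * (LINT x:\<Omega>|lborel. (v x)\<^sup>2)"
    proof (intro exI[of _ "(2 * K)\<^sup>2"] conjI allI impI; (elim conjE)?)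
      fix W and w v :: "real^'n \<Rightarrow> real" and M
      assume W: "open W" "closure \<Omega> \<subseteq> W" and w: "Ck_on (Suc (Suc (Suc 0))) w W" and w0: "\<forall>x\<in>frontier \<Omega>. w x = 0"
        "\<forall>x\<in>\<Omega>. 0 \<le> w x \<and> w x \<le> 2" and v: "continuous_on (closure \<Omega>) v" and M: "\<forall>x\<in>\<Omega>. \<bar>v x\<bar> \<le> M"
      let ?h = "\<lambda>x. (norm (grad w x))\<^sup>2"
      have cg: "continuous_on (closure \<Omega>) (grad w)" by (rule Ck_continuous[OF Ck_on_grad[OF W(1) w] W(2)])
      have cc: "continuous_on (closure \<Omega>) (\<lambda>x. cutoff K (?h x))"
        by (intro continuous_intros cg continuous_on_compose2[OF continuous_on_cutoff[OF K(1), of UNIV]]) auto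
      have "(LINT x:\<Omega>|lborel. (v x)\<^sup>2 * (?h x)\<^sup>2) \<le> (LINT x:\<Omega>|lborel. (0::real)) +
          (2 * M\<^sup>2 * (LINT x:\<Omega>|lborel. cutoff K (?h x) * (?h x)\<^sup>2) + (2 * K)\<^sup>2 * (LINT x:\<Omega>|lborel. (v x)\<^sup>2))"
      proof (rule integral_le_combination)
        fix x assume x: "x \<in> \<Omega>"
        have vM: "(v x)\<^sup>2 \<le> M\<^sup>2" using M x power_mono[of "\<bar>v x\<bar>" M 2] by simp
        show "(v x)\<^sup>2 * (?h x)\<^sup>2 \<le> 0 + (2 * M\<^sup>2 * (cutoff K (?h x) * (?h x)\<^sup>2) + (2 * K)\<^sup>2 * (v x)\<^sup>2)"
        proof (cases "?h x \<le> 2 * K")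
          case True
          then have "(?h x)\<^sup>2 \<le> (2 * K)\<^sup>2" by (intro power_mono) auto
          then have "(v x)\<^sup>2 * (?h x)\<^sup>2 \<le> (v x)\<^sup>2 * (2 * K)\<^sup>2" by (intro mult_left_mono) auto
          moreover have "0 \<le> 2 * M\<^sup>2 * (cutoff K (?h x) * (?h x)\<^sup>2)" by (simp add: cutoff_bounds)
          ultimately show ?thesis by (simp add: mult.commute)
        next
          case False
          then have "1 / 2 \<le> cutoff K (?h x)" by (intro cutoff_ge_half K) auto
          then have "M\<^sup>2 * (?h x)\<^sup>2 * (1 / 2) \<le> M\<^sup>2 * (?h x)\<^sup>2 * cutoff K (?h x)" by (intro mult_left_mono) auto
          moreover have "(v x)\<^sup>2 * (?h x)\<^sup>2 \<le> M\<^sup>2 * (?h x)\<^sup>2" using vM by (intro mult_right_mono) auto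
          moreover have "0 \<le> (2 * K)\<^sup>2 * (v x)\<^sup>2" by simp
          moreover have "2 * M\<^sup>2 * (cutoff K (?h x) * (?h x)\<^sup>2) = 2 * (M\<^sup>2 * (?h x)\<^sup>2 * cutoff K (?h x))" by simp
          ultimately show ?thesis by linarith
        qed
      qed (intro continuous_intros v cg cc)+
      moreover have "2 * M\<^sup>2 * (LINT x:\<Omega>|lborel. cutoff K (?h x) * (?h x)\<^sup>2) \<le>
          2 * M\<^sup>2 * (C * (LINT x:\<Omega>|lborel. (laplacian w x - f (w x))\<^sup>2))"
        by (intro mult_left_mono K(2)[rule_format, of W w] conjI W w w0) simp
      ultimately show "(LINT x:\<Omega>|lborel. (v x)\<^sup>2 * (?h x)\<^sup>2)
        \<le> 2 * C * M\<^sup>2 * (LINT x:\<Omega>|lborel. (laplacian w x - f (w x))\<^sup>2) + (2 * K)\<^sup>2 * (LINT x:\<Omega>|lborel. (v x)\<^sup>2)"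
        by (simp add: mult_ac)
    qed simp
  qed
qed

end


section \<open>Energy identities\<close>

context smooth_domain
begin

text \<open>Continuity on the closure carries integrability along with the value, so a long linear
  combination can be integrated by introduction rules that follow its syntax.\<close>

definition has_int :: "(real^'n \<Rightarrow> real) \<Rightarrow> real \<Rightarrow> bool" where
  "has_int f v \<longleftrightarrow> continuous_on (closure \<Omega>) f \<and> (LINT x:\<Omega>|lborel. f x) = v"

lemma has_intI: "continuous_on (closure \<Omega>) f \<Longrightarrow> has_int f (LINT x:\<Omega>|lborel. f x)"
  by (simp add: has_int_def)

lemma has_int_add: "has_int f v \<Longrightarrow> has_int g w \<Longrightarrow> has_int (\<lambda>x. f x + g x) (v + w)"
  using integral_linear[of f g 1 1] by (auto simp: has_int_def intro: continuous_on_add)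

lemma has_int_cmult: "has_int f v \<Longrightarrow> has_int (\<lambda>x. c * f x) (c * v)"
  by (auto simp: has_int_def intro: continuous_on_mult)

lemma has_int_sum: "(\<And>i. i \<in> I \<Longrightarrow> has_int (f i) (v i)) \<Longrightarrow> has_int (\<lambda>x. \<Sum>i\<in>I. f i x) (\<Sum>i\<in>I. v i)"
  by (auto simp: has_int_def set_lebesgue_integral_sum integrable_Omega intro: continuous_on_sum)

lemma has_int_cong:
  assumes "has_int f v" "continuous_on (closure \<Omega>) g" "\<And>x. x \<in> \<Omega> \<Longrightarrow> f x = g x"
  shows "has_int g v"
proof -
  have "(LINT x:\<Omega>|lborel. f x) = (LINT x:\<Omega>|lborel. g x)"
    using assms(3) by (intro set_lebesgue_integral_cong) auto
  then show ?thesis using assms by (simp add: has_int_def)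
qed

lemma has_int_cong_closure:
  assumes "has_int f v" "\<And>x. x \<in> closure \<Omega> \<Longrightarrow> f x = g x"
  shows "has_int g v"
proof (rule has_int_cong[OF assms(1)])
  show "continuous_on (closure \<Omega>) g"
    using assms continuous_on_cong[of "closure \<Omega>" "closure \<Omega>" f g] by (simp add: has_int_def)
qed (use assms(2) closure_subset in blast)

lemma has_int_mono: "has_int f v \<Longrightarrow> has_int g w \<Longrightarrow> (\<And>x. x \<in> \<Omega> \<Longrightarrow> f x \<le> g x) \<Longrightarrow> v \<le> w"
  unfolding has_int_def using integral_mono_closure[of f g] by auto

lemma has_int_divergence:
  assumes "open W" "closure \<Omega> \<subseteq> W" "Ck_on (Suc 0) Z W" "\<And>x. x \<in> frontier \<Omega> \<Longrightarrow> Z x = 0"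
  shows "has_int (divergence Z) 0"
  unfolding has_int_def
  using integral_divergence_eq_0[OF assms] Ck_continuous[OF Ck_on_divergence[OF assms(1,3)] assms(2)] by simp

lemma has_int_green:
  assumes W: "open W" "closure \<Omega> \<subseteq> W" and f: "Ck_on (Suc 0) f W" and g: "Ck_on (Suc (Suc 0)) g W"
    and f0: "\<And>x. x \<in> frontier \<Omega> \<Longrightarrow> f x = 0"
  shows "has_int (\<lambda>x. f x * laplacian g x + grad f x \<bullet> grad g x) 0"
proof (rule has_int_cong[OF has_int_divergence[OF W Ck_on_scaleR[OF W(1) f Ck_on_grad[OF W(1) g]]]])
  fix x assume x: "x \<in> \<Omega>"
  note d = Ck_on_differentiable[OF _ in_W[OF W(2) x]]
  show "divergence (\<lambda>x. f x *\<^sub>R grad g x) x = f x * laplacian g x + grad f x \<bullet> grad g x"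
    by (simp add: divergence_scaleR[OF d[OF f] d[OF Ck_on_grad[OF W(1) g]]] laplacian_eq_divergence)
next
  show "continuous_on (closure \<Omega>) (\<lambda>x. f x * laplacian g x + grad f x \<bullet> grad g x)"
    using W(1) by (intro continuous_intros Ck_continuous[OF f W(2)] Ck_continuous[OF Ck_on_grad[OF _ f] W(2)]
        Ck_continuous[OF Ck_on_grad[OF _ g] W(2)] Ck_continuous[OF Ck_on_laplacian[OF _ g] W(2)])
qed (simp add: f0)

end

lemma convect_scalar: "convect v f x = v x \<bullet> grad f x" for f :: "real^'n \<Rightarrow> real"
  by (simp add: convect_def grad_def inner_vec_def)

lemma vector_partial_nth:
  assumes "v differentiable (at x)"
  shows "partial i v x $ k = partial i (\<lambda>y. v y $ k) x"
proof -
  have "((\<lambda>y. v y $ k) has_derivative (\<lambda>h. frechet_derivative v (at x) h $ k)) (at x)"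
    by (rule bounded_linear.has_derivative[OF bounded_linear_vec_nth has_frechet_derivative[OF assms]])
  then show ?thesis by (simp add: partial_def frechet_derivative_eqI)
qed

lemma convect_vector:
  assumes "w differentiable (at x)"
  shows "convect v w x = vgrad w x *v v x"
  by (simp add: vec_eq_iff convect_def matrix_vector_mult_def vgrad_def vector_partial_nth[OF assms] mult.commute)

lemma vector_laplacian_nth:
  assumes S: "open S" "x \<in> S" and v: "Ck_on (Suc (Suc 0)) v S"
  shows "laplacian v x $ k = laplacian (\<lambda>y. v y $ k) x"
proof -
  have "partial i (partial i v) x $ k = partial i (partial i (\<lambda>y. v y $ k)) x" for i
  proof -
    have "partial i (partial i v) x $ k = partial i (\<lambda>y. partial i v y $ k) x"
      by (rule vector_partial_nth[OF Ck_on_differentiable[OF Ck_on_partial[OF v] S(2)]])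
    also have "\<dots> = partial i (partial i (\<lambda>y. v y $ k)) x"
      using Ck_on_differentiable[OF Ck_on_SucD[OF v]]
      by (intro partial_cong_open[OF S]) (simp add: vector_partial_nth)
    finally show ?thesis .
  qed
  then show ?thesis by (simp add: laplacian_def)
qed

lemma norm_vgrad_sq: "(norm (vgrad v x))\<^sup>2 = (\<Sum>i\<in>UNIV. (norm (grad (\<lambda>y. v y $ i) x))\<^sup>2)"
  by (simp add: norm_vec_def[of "vgrad v x"] L2_set_def sum_nonneg vgrad_nth)

section \<open>Integral identities for a divergence-free field\<close>

locale solenoidal = smooth_domain \<Omega> \<rho> for \<Omega> :: "(real^'n) set" and \<rho> +
  fixes W :: "(real^'n) set" and u :: "real^'n \<Rightarrow> real^'n"
  assumes W: "open W" "closure \<Omega> \<subseteq> W"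
    and u: "Ck_on (Suc (Suc 0)) u W"
    and u0: "\<And>x. x \<in> frontier \<Omega> \<Longrightarrow> u x = 0"
    and div_u: "\<And>x. x \<in> \<Omega> \<Longrightarrow> divergence u x = 0"
begin

lemma u1: "Ck_on (Suc 0) u W" by (rule Ck_on_SucD[OF u])

lemma continuous_u: "continuous_on (closure \<Omega>) u" by (rule Ck_continuous[OF u W(2)])

lemma continuous_vgrad_u: "continuous_on (closure \<Omega>) (\<lambda>x. vgrad u x $ i $ j)"
  by (rule Ck_continuous[OF Ck_on_vgrad_nth[OF W(1) u] W(2)])

text \<open>The field \<open>f x *\<^sub>R u x\<close> vanishes on the boundary, and
  \<open>div_u\<close> removes the other term of the product rule.\<close>

lemma has_int_transport:
  assumes f: "Ck_on (Suc 0) f W"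
  shows "has_int (\<lambda>x. u x \<bullet> grad f x) 0"
proof (rule has_int_cong[OF has_int_divergence[OF W Ck_on_scaleR[OF W(1) f u1]]])
  fix x assume x: "x \<in> \<Omega>"
  note d = Ck_on_differentiable[OF _ in_W[OF W(2) x]]
  show "divergence (\<lambda>x. f x *\<^sub>R u x) x = u x \<bullet> grad f x"
    by (simp add: divergence_scaleR[OF d[OF f] d[OF u1]] div_u[OF x] inner_commute)
qed (auto simp: u0 intro!: continuous_intros continuous_u Ck_continuous[OF Ck_on_grad[OF W(1) f] W(2)])

text \<open>The contraction of \<open>grad f\<close> tensor \<open>grad f\<close> with the velocity
  gradient. For the phase it is, up to the surface tension as a factor, all that the capillary
  stress contributes to the energy balance.\<close>

definition "stretch f x = grad f x \<bullet> (vgrad u x *v grad f x)"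

lemma stretch_le: "\<bar>stretch f x\<bar> \<le> norm (vgrad u x) * (norm (grad f x))\<^sup>2"
  using quadratic_form_le[of "vgrad u x" "grad f x"] by (simp add: stretch_def inner_commute)

lemma continuous_stretch:
  assumes "continuous_on (closure \<Omega>) (grad f)" shows "continuous_on (closure \<Omega>) (stretch f)"
  unfolding stretch_def[abs_def] matrix_vector_mult_def by (intro continuous_intros assms continuous_vgrad_u)

text \<open>The field \<open>(2 * (u x \<bullet> grad f x)) *\<^sub>R grad f x - (norm (grad f
  x))\<^sup>2 *\<^sub>R u x\<close> is chosen so that the terms with the Hessian of \<open>f\<close>
  cancel by its symmetry. The identity converts transport tested with the Laplacian into
  \<open>stretch\<close>, for the phase and for the temperature.\<close>

lemma has_int_laplacian_transport:
  assumes f: "Ck_on (Suc (Suc 0)) f W"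
  shows "has_int (\<lambda>x. laplacian f x * (u x \<bullet> grad f x) + stretch f x) 0"
proof -
  have g1: "Ck_on (Suc 0) (grad f) W" by (rule Ck_on_grad[OF W(1) f])
  have a1: "Ck_on (Suc 0) (\<lambda>x. u x \<bullet> grad f x) W" by (rule Ck_on_inner[OF W(1) u1 g1])
  have h1: "Ck_on (Suc 0) (\<lambda>x. (norm (grad f x))\<^sup>2) W"
    unfolding power2_norm_eq_inner by (rule Ck_on_inner[OF W(1) g1 g1])
  have "has_int (\<lambda>x. 2 * (laplacian f x * (u x \<bullet> grad f x) + stretch f x)) 0"
  proof (rule has_int_cong[OF has_int_divergence[OF W]])
    show "Ck_on (Suc 0) (\<lambda>x. (2 * (u x \<bullet> grad f x)) *\<^sub>R grad f x - (norm (grad f x))\<^sup>2 *\<^sub>R u x) W"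
      by (intro Ck_on_diff Ck_on_scaleR Ck_on_mult Ck_on_const W a1 g1 h1 u1)
    fix x assume x: "x \<in> \<Omega>"
    have xW: "x \<in> W" by (rule in_W[OF W(2) x])
    note d = Ck_on_differentiable[OF _ xW]
    have c1: "Ck_on (Suc 0) (\<lambda>x. 2 * (u x \<bullet> grad f x)) W" by (intro Ck_on_mult Ck_on_const W a1)
    have g2: "grad (\<lambda>x. 2 * (u x \<bullet> grad f x)) x = 2 *\<^sub>R (transpose (vgrad u x) *v grad f x + vgrad (grad f) x *v u x)"
      using grad_mult[OF _ d[OF a1], of "\<lambda>_. 2"]
      by (simp add: grad_const grad_inner[OF d[OF u1] d[OF g1]] hessian_symmetric[OF W(1) f xW])
    have t: "(grad f x v* vgrad u x) \<bullet> grad f x = stretch f x"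
      by (simp add: stretch_def dot_lmul_matrix)
    have "(vgrad (grad f) x *v u x) \<bullet> grad f x = (vgrad (grad f) x *v grad f x) \<bullet> u x"
      using dot_lmul_matrix[of "u x" "vgrad (grad f) x" "grad f x"]
      by (simp add: hessian_symmetric[OF W(1) f xW] inner_commute flip: transpose_matrix_vector)
    then show "divergence (\<lambda>x. (2 * (u x \<bullet> grad f x)) *\<^sub>R grad f x - (norm (grad f x))\<^sup>2 *\<^sub>R u x) x =
        2 * (laplacian f x * (u x \<bullet> grad f x) + stretch f x)"
      by (subst divergence_diff[OF d[OF Ck_on_scaleR[OF W(1) c1 g1]] d[OF Ck_on_scaleR[OF W(1) h1 u1]]],
          subst divergence_scaleR[OF d[OF c1] d[OF g1]], subst divergence_scaleR[OF d[OF h1] d[OF u1]],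
          subst grad_norm_grad_sq[OF W(1) f xW])
        (simp add: g2 t div_u[OF x] laplacian_eq_divergence inner_add_left algebra_simps)
  qed (auto simp: u0 intro!: continuous_intros continuous_u continuous_stretch Ck_continuous[OF g1 W(2)]
      Ck_continuous[OF Ck_on_laplacian[OF W(1) f] W(2)])
  from has_int_cmult[OF this, of "1 / 2"] show ?thesis by (simp add: add_divide_distrib)
qed

lemma has_int_dirichlet: "has_int (\<lambda>x. u x \<bullet> laplacian u x + (norm (vgrad u x))\<^sup>2) 0"
proof -
  have ui: "Ck_on (Suc (Suc 0)) (\<lambda>y. u y $ i) W" for i by (rule Ck_on_nth[OF W(1) u])
  have "has_int (\<lambda>x. \<Sum>i\<in>UNIV. u x $ i * laplacian (\<lambda>y. u y $ i) x + grad (\<lambda>y. u y $ i) x \<bullet> grad (\<lambda>y. u y $ i) x)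
      (\<Sum>i\<in>(UNIV :: 'n set). 0)"
    by (intro has_int_sum has_int_green[OF W Ck_on_SucD[OF ui] ui]) (simp add: u0)
  then show ?thesis
    unfolding sum.neutral_const
  proof (rule has_int_cong_closure)
    fix x assume "x \<in> closure \<Omega>"
    then have "x \<in> W" using W(2) by blast
    then show "(\<Sum>i\<in>UNIV. u x $ i * laplacian (\<lambda>y. u y $ i) x + grad (\<lambda>y. u y $ i) x \<bullet> grad (\<lambda>y. u y $ i) x) =
        u x \<bullet> laplacian u x + (norm (vgrad u x))\<^sup>2"
      by (simp add: inner_vec_def[of "u x"] vector_laplacian_nth[OF W(1) _ u] norm_vgrad_sq sum.distrib dot_square_norm)
  qed
qed

lemma has_int_tensor_divergence:
  assumes S: "\<And>i. Ck_on (Suc 0) (\<lambda>x. S x $ i) W"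
  shows "has_int (\<lambda>x. u x \<bullet> tensor_divergence S x + (\<Sum>i\<in>UNIV. vgrad u x $ i \<bullet> S x $ i)) 0"
proof -
  have td: "tensor_divergence S x $ i = divergence (\<lambda>y. S y $ i) x" for x i
    by (simp add: tensor_divergence_def divergence_def)
  have ui: "Ck_on (Suc 0) (\<lambda>y. u y $ i) W" for i by (rule Ck_on_nth[OF W(1) u1])
  have "has_int (\<lambda>x. \<Sum>i\<in>UNIV. u x $ i * divergence (\<lambda>y. S y $ i) x + vgrad u x $ i \<bullet> S x $ i) (\<Sum>i\<in>(UNIV :: 'n set). 0)"
  proof (rule has_int_sum)
    fix i
    show "has_int (\<lambda>x. u x $ i * divergence (\<lambda>y. S y $ i) x + vgrad u x $ i \<bullet> S x $ i) 0"
    proof (rule has_int_cong[OF has_int_divergence[OF W Ck_on_scaleR[OF W(1) ui[of i] S[of i]]]])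
      fix x assume x: "x \<in> \<Omega>"
      note d = Ck_on_differentiable[OF _ in_W[OF W(2) x]]
      show "divergence (\<lambda>x. u x $ i *\<^sub>R S x $ i) x = u x $ i * divergence (\<lambda>y. S y $ i) x + vgrad u x $ i \<bullet> S x $ i"
        by (simp add: divergence_scaleR[OF d[OF ui] d[OF S]] vgrad_nth)
    next
      show "continuous_on (closure \<Omega>) (\<lambda>x. u x $ i * divergence (\<lambda>y. S y $ i) x + vgrad u x $ i \<bullet> S x $ i)"
        unfolding vgrad_nth
        by (intro continuous_intros continuous_u Ck_continuous[OF Ck_on_divergence[OF W(1) S] W(2)]
            Ck_continuous[OF S W(2)] Ck_continuous[OF Ck_on_grad[OF W(1) ui] W(2)])
    qed (simp add: u0)
  qed
  then show ?thesis by (simp add: inner_vec_def[of "u _"] td sum.distrib)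
qed

end


lemma has_real_derivative_FF: "(FF \<epsilon> has_real_derivative (s ^ 3 - s) / \<epsilon>\<^sup>2) (at s)"
proof -
  have "((\<lambda>s. (s\<^sup>2 - 1)\<^sup>2) has_real_derivative 4 * (s ^ 3 - s)) (at s)"
    by (auto intro!: derivative_eq_intros simp: power2_eq_square power3_eq_cube algebra_simps)
  from DERIV_cmult[OF this, of "1 / (4 * \<epsilon>\<^sup>2)"] show ?thesis unfolding FF_def[abs_def]
    by (simp del: right_diff_distrib_numeral)
qed

lemma deriv_FF: "deriv (FF \<epsilon>) s = (s ^ 3 - s) / \<epsilon>\<^sup>2"
  by (rule DERIV_imp_deriv[OF has_real_derivative_FF])

lemma Ck_on_FF: "open S \<Longrightarrow> Ck_on m f S \<Longrightarrow> Ck_on m (\<lambda>x. FF \<epsilon> (f x)) S"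
  unfolding FF_def by (intro Ck_on_mult Ck_on_power Ck_on_diff Ck_on_const)

lemma stress_nth:
  "stress l0 a b \<epsilon> \<phi> \<theta> x $ i = (surface_tension l0 a b (\<theta> x) * grad \<phi> x $ i) *\<^sub>R grad \<phi> x
     - (surface_tension l0 a b (\<theta> x) * (1/2 * (norm (grad \<phi> x))\<^sup>2 + FF \<epsilon> (\<phi> x))) *\<^sub>R axis i 1"
  by (simp add: stress_def outer_def vec_eq_iff mat_def axis_def)

section \<open>The energy balance at a fixed time\<close>

text \<open>Time is frozen: \<open>ut\<close>, \<open>\<Phi>t\<close> and \<open>\<Theta>t\<close>
  are functions of space standing for the time derivatives. The last two vanish on the boundary
  because the boundary data are constant in time.\<close>

locale flow_slice = solenoidal \<Omega> \<rho> W u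
  for \<Omega> :: "(real^'n) set" and \<rho> W u +
  fixes p \<Phi> \<Theta> \<Phi>t \<Theta>t :: "real^'n \<Rightarrow> real" and ut :: "real^'n \<Rightarrow> real^'n"
    and \<nu> \<gamma> k l0 a b \<epsilon> \<alpha> g :: real and j :: "real^'n"
  assumes p: "Ck_on (Suc 0) p W"
    and \<Phi>: "Ck_on (Suc (Suc (Suc 0))) \<Phi> W" and \<Theta>: "Ck_on (Suc (Suc (Suc 0))) \<Theta> W"
    and \<Phi>t: "Ck_on (Suc 0) \<Phi>t W" and \<Theta>t: "Ck_on (Suc 0) \<Theta>t W"
    and ut: "continuous_on (closure \<Omega>) ut"
    and boundary: "\<And>x. x \<in> frontier \<Omega> \<Longrightarrow> \<Theta> x = 0 \<and> \<Phi>t x = 0 \<and> \<Theta>t x = 0"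
    and momentum: "\<And>x. x \<in> \<Omega> \<Longrightarrow> ut x + convect u u x + grad p x - \<nu> *\<^sub>R laplacian u x
        = - tensor_divergence (stress l0 a b \<epsilon> \<Phi> \<Theta>) x - ((1 - \<alpha> * \<Theta> x) * g) *\<^sub>R j"
    and phase: "\<And>x. x \<in> \<Omega> \<Longrightarrow> \<Phi>t x + convect u \<Phi> x = \<gamma> * (laplacian \<Phi> x - deriv (FF \<epsilon>) (\<Phi> x))"
    and heat: "\<And>x. x \<in> \<Omega> \<Longrightarrow> \<Theta>t x + convect u \<Theta> x = k * laplacian \<Theta> x"
begin

definition "\<mu> x = laplacian \<Phi> x - deriv (FF \<epsilon>) (\<Phi> x)"

text \<open>The integrand of the time derivative of \<open>energy\<close>, as
  \<open>slice_exists\<close> establishes.\<close>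

definition "rate \<zeta> \<omega> x = 2 * (u x \<bullet> ut x) + 2 * a * l0 * (grad \<Phi> x \<bullet> grad \<Phi>t x)
    + 2 * a * l0 * (deriv (FF \<epsilon>) (\<Phi> x) * \<Phi>t x) + 2 * \<zeta> * (grad \<Theta> x \<bullet> grad \<Theta>t x) + 2 * \<omega> * (\<Theta> x * \<Theta>t x)"

lemma \<Phi>2: "Ck_on (Suc (Suc 0)) \<Phi> W" and \<Theta>2: "Ck_on (Suc (Suc 0)) \<Theta> W"
  by (rule Ck_on_SucD[OF \<Phi>]) (rule Ck_on_SucD[OF \<Theta>])

lemma \<Phi>1: "Ck_on (Suc 0) \<Phi> W" and \<Theta>1: "Ck_on (Suc 0) \<Theta> W"
  by (rule Ck_on_SucD[OF \<Phi>2]) (rule Ck_on_SucD[OF \<Theta>2])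

lemma stress_row: "Ck_on (Suc 0) (\<lambda>x. stress l0 a b \<epsilon> \<Phi> \<Theta> x $ i) W"
  unfolding stress_nth surface_tension_def power2_norm_eq_inner
  by (intro Ck_on_diff Ck_on_scaleR Ck_on_mult Ck_on_add Ck_on_FF Ck_on_inner Ck_on_nth Ck_on_grad Ck_on_const W \<Phi>1 \<Theta>1 \<Phi>2)

text \<open>Twelve expressions, each of integral 0 by an integration by parts, weighted so that
  subtracting them from \<open>rate\<close> leaves the dissipation and three indefinite terms. In
  particular the constant part \<open>a * l0\<close> of the surface tension cancels between the
  momentum and the phase equation; only the part with \<open>b\<close> survives.\<close>

definition "exact_part \<zeta> \<omega> x =
    ((((- 1) * (u x \<bullet> grad (\<lambda>y. u y \<bullet> u y) x) + (- 2) * (u x \<bullet> grad p x))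
    + (2 * \<nu> * (u x \<bullet> laplacian u x + (norm (vgrad u x))\<^sup>2)
    + (- 2) * (u x \<bullet> tensor_divergence (stress l0 a b \<epsilon> \<Phi> \<Theta>) x + (\<Sum>i\<in>UNIV. vgrad u x $ i \<bullet> stress l0 a b \<epsilon> \<Phi> \<Theta> x $ i))))
    + ((- 2 * g) * (u x \<bullet> grad (\<lambda>y. j \<bullet> y) x)
    + 2 * a * l0 * (\<Phi>t x * laplacian \<Phi> x + grad \<Phi>t x \<bullet> grad \<Phi> x)))
    + ((2 * a * l0 * (laplacian \<Phi> x * (u x \<bullet> grad \<Phi> x) + stretch \<Phi> x)
    + (- 2 * a * l0) * (u x \<bullet> grad (\<lambda>y. FF \<epsilon> (\<Phi> y)) x))
    + ((2 * \<zeta> * (\<Theta>t x * laplacian \<Theta> x + grad \<Theta>t x \<bullet> grad \<Theta> x)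
    + 2 * \<zeta> * (laplacian \<Theta> x * (u x \<bullet> grad \<Theta> x) + stretch \<Theta> x))
    + (2 * \<omega> * k * (\<Theta> x * laplacian \<Theta> x + grad \<Theta> x \<bullet> grad \<Theta> x)
    + (- \<omega>) * (u x \<bullet> grad (\<lambda>y. \<Theta> y * \<Theta> y) x))))"

lemma has_int_exact_part: "has_int (exact_part \<zeta> \<omega>) 0"
proof -
  have l: "Ck_on (Suc 0) (\<lambda>y. j \<bullet> y) W" by (intro Ck_on_inner Ck_on_const Ck_on_ident W)
  have uu: "Ck_on (Suc 0) (\<lambda>y. u y \<bullet> u y) W" by (intro Ck_on_inner W u1)
  have tt: "Ck_on (Suc 0) (\<lambda>y. \<Theta> y * \<Theta> y) W" by (intro Ck_on_mult W \<Theta>1)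
  \<comment> \<open>The value 0 is written as the same linear combination of zeros, so that the
    rules for \<open>has_int\<close> unify.\<close>
  have z: "0 = (((((- 1) * 0 + (- 2) * 0) + (2 * \<nu> * 0 + (- 2) * 0)) + ((- 2 * g) * 0 + 2 * a * l0 * 0))
     + ((2 * a * l0 * 0 + (- 2 * a * l0) * 0) + ((2 * \<zeta> * 0 + 2 * \<zeta> * 0) + (2 * \<omega> * k * 0 + (- \<omega>) * (0::real)))))"
    by simp
  show ?thesis
    unfolding exact_part_def[abs_def]
    apply (subst z)
    apply (intro has_int_add has_int_cmult)
    apply (rule has_int_transport[OF uu] has_int_transport[OF p] has_int_dirichlet has_int_tensor_divergence[OF stress_row]
        has_int_transport[OF l] has_int_green[OF W \<Phi>t \<Phi>2] has_int_laplacian_transport[OF \<Phi>2]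
        has_int_transport[OF Ck_on_FF[OF W(1) \<Phi>1]] has_int_green[OF W \<Theta>t \<Theta>2] has_int_laplacian_transport[OF \<Theta>2]
        has_int_green[OF W \<Theta>1 \<Theta>2] has_int_transport[OF tt] | simp add: boundary)+
    done
qed

lemma rate_eq:
  assumes x: "x \<in> \<Omega>"
  shows "rate \<zeta> \<omega> x = exact_part \<zeta> \<omega> x - 2 * \<nu> * (norm (vgrad u x))\<^sup>2 - 2 * a * l0 * \<gamma> * (\<mu> x)\<^sup>2
    - 2 * l0 * b * \<Theta> x * stretch \<Phi> x + 2 * \<alpha> * g * \<Theta> x * (u x \<bullet> j) - 2 * k * \<zeta> * (laplacian \<Theta> x)\<^sup>2
    - 2 * \<zeta> * stretch \<Theta> x - 2 * k * \<omega> * (norm (grad \<Theta> x))\<^sup>2"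
proof -
  have xW: "x \<in> W" by (rule in_W[OF W(2) x])
  note d = Ck_on_differentiable[OF _ xW]
  let ?S = "stress l0 a b \<epsilon> \<Phi> \<Theta>" and ?f = "deriv (FF \<epsilon>) (\<Phi> x)"
  define A1 A2 A3 A4 A5 A6 A7 where "A1 = u x \<bullet> (vgrad u x *v u x)" and "A2 = u x \<bullet> grad p x"
    and "A3 = u x \<bullet> laplacian u x" and "A4 = u x \<bullet> tensor_divergence ?S x" and "A5 = u x \<bullet> j"
    and "A6 = u x \<bullet> grad \<Phi> x" and "A7 = u x \<bullet> grad \<Theta> x"
  have e1: "u x \<bullet> grad (\<lambda>y. u y \<bullet> u y) x = 2 * A1"
  proof -
    have "(u x v* vgrad u x) \<bullet> u x = A1" unfolding A1_def by (rule dot_lmul_matrix)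
    then show ?thesis
      by (simp add: grad_inner[OF d[OF u1] d[OF u1]] inner_add_right inner_commute[of "u x" "u x v* vgrad u x"]
          flip: scaleR_2)
  qed
  \<comment> \<open>The isotropic part of the stress is paired with the trace of the velocity
    gradient, which is 0.\<close>
  have e4: "(\<Sum>i\<in>UNIV. vgrad u x $ i \<bullet> ?S x $ i) = surface_tension l0 a b (\<Theta> x) * stretch \<Phi> x"
  proof -
    define c where "c = surface_tension l0 a b (\<Theta> x) * (1/2 * (norm (grad \<Phi> x))\<^sup>2 + FF \<epsilon> (\<Phi> x))"
    have "(\<Sum>i\<in>UNIV. vgrad u x $ i \<bullet> ?S x $ i) = (\<Sum>i\<in>UNIV. surface_tension l0 a b (\<Theta> x) *
        (grad \<Phi> x $ i * (vgrad u x $ i \<bullet> grad \<Phi> x)) - c * vgrad u x $ i $ i)"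
      by (simp add: stress_nth inner_diff_right inner_axis c_def mult.assoc)
    also have "\<dots> = surface_tension l0 a b (\<Theta> x) * (\<Sum>i\<in>UNIV. grad \<Phi> x $ i * (vgrad u x $ i \<bullet> grad \<Phi> x)) - c * divergence u x"
      by (simp add: sum_subtractf sum_distrib_left divergence_eq_vgrad)
    also have "(\<Sum>i\<in>UNIV. grad \<Phi> x $ i * (vgrad u x $ i \<bullet> grad \<Phi> x)) = stretch \<Phi> x"
      by (simp add: stretch_def inner_vec_def[of "grad \<Phi> x"] matrix_vector_mul_component)
    finally show ?thesis by (simp add: div_u[OF x])
  qed
  \<comment> \<open>Constant gravity is a gradient and does no work on a divergence-free field; only
    the part with \<alpha> remains.\<close>
  have e5: "grad (\<lambda>y. j \<bullet> y) x = j"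
    by (rule grad_eqI) (auto intro!: derivative_eq_intros)
  have e8: "u x \<bullet> grad (\<lambda>y. FF \<epsilon> (\<Phi> y)) x = ?f * A6"
    by (simp add: grad_compose[OF d[OF \<Phi>1] has_real_derivative_FF] deriv_FF A6_def)
  have e12: "u x \<bullet> grad (\<lambda>y. \<Theta> y * \<Theta> y) x = 2 * \<Theta> x * A7"
    unfolding grad_mult[OF d[OF \<Theta>1] d[OF \<Theta>1]] inner_add_right inner_scaleR_right A7_def by simp
  have "ut x = - tensor_divergence ?S x - ((1 - \<alpha> * \<Theta> x) * g) *\<^sub>R j - vgrad u x *v u x - grad p x + \<nu> *\<^sub>R laplacian u x"
    using momentum[OF x] unfolding convect_vector[OF d[OF u1]] by (simp add: algebra_simps)
  then have uut: "u x \<bullet> ut x = - A4 - (1 - \<alpha> * \<Theta> x) * g * A5 - A1 - A2 + \<nu> * A3"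
    by (simp add: inner_diff_right inner_add_right A1_def A2_def A3_def A4_def A5_def)
  have pt: "\<Phi>t x = \<gamma> * \<mu> x - A6" using phase[OF x] by (simp add: convect_scalar \<mu>_def A6_def)
  have tt: "\<Theta>t x = k * laplacian \<Theta> x - A7" using heat[OF x] by (simp add: convect_scalar A7_def)
  have lp: "laplacian \<Phi> x = \<mu> x + ?f" by (simp add: \<mu>_def)
  show ?thesis
    unfolding rate_def exact_part_def e1 e4 e5 e8 e12 uut lp surface_tension_def
    unfolding
      A2_def[symmetric] A3_def[symmetric] A4_def[symmetric] A5_def[symmetric] A6_def[symmetric] A7_def[symmetric]
      inner_commute[of "grad \<Phi>t x"] inner_commute[of "grad \<Theta>t x"] dot_square_norm pt tt
    by (simp add: algebra_simps power2_eq_square)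
qed

lemma continuous_slice:
  "continuous_on (closure \<Omega>) (grad \<Phi>)" "continuous_on (closure \<Omega>) (grad \<Theta>)" "continuous_on (closure \<Omega>) \<Theta>"
  "continuous_on (closure \<Omega>) \<Phi>" "continuous_on (closure \<Omega>) \<Phi>t" "continuous_on (closure \<Omega>) \<Theta>t"
  "continuous_on (closure \<Omega>) (grad \<Phi>t)" "continuous_on (closure \<Omega>) (grad \<Theta>t)"
  "continuous_on (closure \<Omega>) (laplacian \<Theta>)" "continuous_on (closure \<Omega>) \<mu>"
  "continuous_on (closure \<Omega>) (\<lambda>x. (norm (vgrad u x))\<^sup>2)"
  "continuous_on (closure \<Omega>) (rate \<zeta> \<omega>)"
proof -
  show 1: "continuous_on (closure \<Omega>) (grad \<Phi>)" "continuous_on (closure \<Omega>) (grad \<Theta>)" "continuous_on (closure \<Omega>) \<Theta>"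
    "continuous_on (closure \<Omega>) \<Phi>" "continuous_on (closure \<Omega>) \<Phi>t" "continuous_on (closure \<Omega>) \<Theta>t"
    "continuous_on (closure \<Omega>) (grad \<Phi>t)" "continuous_on (closure \<Omega>) (grad \<Theta>t)"
    "continuous_on (closure \<Omega>) (laplacian \<Theta>)"
    by (fact Ck_continuous[OF Ck_on_grad[OF W(1) \<Phi>2] W(2)] Ck_continuous[OF Ck_on_grad[OF W(1) \<Theta>2] W(2)]
        Ck_continuous[OF \<Theta>1 W(2)] Ck_continuous[OF \<Phi>1 W(2)] Ck_continuous[OF \<Phi>t W(2)] Ck_continuous[OF \<Theta>t W(2)]
        Ck_continuous[OF Ck_on_grad[OF W(1) \<Phi>t] W(2)] Ck_continuous[OF Ck_on_grad[OF W(1) \<Theta>t] W(2)]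
        Ck_continuous[OF Ck_on_laplacian[OF W(1) \<Theta>2] W(2)])+
  show "continuous_on (closure \<Omega>) \<mu>"
    unfolding \<mu>_def[abs_def] deriv_FF divide_inverse
    by (intro continuous_intros 1 Ck_continuous[OF Ck_on_laplacian[OF W(1) \<Phi>2] W(2)])
  show "continuous_on (closure \<Omega>) (\<lambda>x. (norm (vgrad u x))\<^sup>2)"
    unfolding norm_matrix_sq by (intro continuous_intros continuous_vgrad_u)
  show "continuous_on (closure \<Omega>) (rate \<zeta> \<omega>)"
    unfolding rate_def[abs_def] deriv_FF divide_inverse by (intro continuous_intros 1 ut continuous_u)
qed

text \<open>The budget: of the \<open>2 * \<nu>\<close> in front of the velocity gradient each of
  the three indefinite terms spends \<open>\<nu> / 2\<close>, the buoyancy through Poincare. Half of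
  the dissipation in \<open>\<mu>\<close> and half of that in the Laplacian of
  \<open>\<Theta>\<close> pay for the fourth-power terms under \<open>c2\<close> and
  \<open>c1\<close>; the remaining squares of \<open>\<Theta>\<close> are paid by
  \<open>\<omega>\<close> under \<open>c3\<close>.\<close>

lemma dissipation:
  assumes pos: "\<nu> > 0" "\<zeta> > 0" "Cp > 0" "0 \<le> K"
    and poincare_u: "(LINT x:\<Omega>|lborel. (norm (u x))\<^sup>2) \<le> Cp * (LINT x:\<Omega>|lborel. (norm (vgrad u x))\<^sup>2)"
    and poincare_\<Theta>: "(LINT x:\<Omega>|lborel. (\<Theta> x)\<^sup>2) \<le> Cp * (LINT x:\<Omega>|lborel. (norm (grad \<Theta> x))\<^sup>2)"
    and L4: "(LINT x:\<Omega>|lborel. ((norm (grad \<Theta> x))\<^sup>2)\<^sup>2) \<le> CL * (LINT x:\<Omega>|lborel. (laplacian \<Theta> x)\<^sup>2)"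
    and wL4: "(LINT x:\<Omega>|lborel. (\<Theta> x)\<^sup>2 * ((norm (grad \<Phi> x))\<^sup>2)\<^sup>2) \<le>
      CW * (LINT x:\<Omega>|lborel. (\<mu> x)\<^sup>2) + K * (LINT x:\<Omega>|lborel. (\<Theta> x)\<^sup>2)"
    and c1: "2 * \<zeta> * CL / \<nu> \<le> k" and c2: "2 * (l0 * b)\<^sup>2 / \<nu> * CW \<le> a * l0 * \<gamma>"
    and c3: "(2 * (l0 * b)\<^sup>2 / \<nu> * K + 2 * Cp / \<nu> * (\<alpha> * g)\<^sup>2) * Cp \<le> 2 * k * \<omega>" and j: "norm j = 1"
  shows "(LINT x:\<Omega>|lborel. rate \<zeta> \<omega> x) \<le> - (\<nu> / 2) * (LINT x:\<Omega>|lborel. (norm (vgrad u x))\<^sup>2)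
    - a * l0 * \<gamma> * (LINT x:\<Omega>|lborel. (\<mu> x)\<^sup>2) - k * \<zeta> * (LINT x:\<Omega>|lborel. (laplacian \<Theta> x)\<^sup>2)"
proof -
  define ID I\<mu> Iw Iu I\<Theta> I\<Delta> Ih Ig where "ID = (LINT x:\<Omega>|lborel. (norm (vgrad u x))\<^sup>2)"
    and "I\<mu> = (LINT x:\<Omega>|lborel. (\<mu> x)\<^sup>2)" and "Iw = (LINT x:\<Omega>|lborel. (\<Theta> x)\<^sup>2 * ((norm (grad \<Phi> x))\<^sup>2)\<^sup>2)"
    and "Iu = (LINT x:\<Omega>|lborel. (norm (u x))\<^sup>2)" and "I\<Theta> = (LINT x:\<Omega>|lborel. (\<Theta> x)\<^sup>2)"
    and "I\<Delta> = (LINT x:\<Omega>|lborel. (laplacian \<Theta> x)\<^sup>2)" and "Ih = (LINT x:\<Omega>|lborel. ((norm (grad \<Theta> x))\<^sup>2)\<^sup>2)"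
    and "Ig = (LINT x:\<Omega>|lborel. (norm (grad \<Theta> x))\<^sup>2)"
  define \<beta> where "\<beta> = 2 * (l0 * b)\<^sup>2 / \<nu>"
  define \<kappa> where "\<kappa> = 2 * Cp / \<nu> * (\<alpha> * g)\<^sup>2"
  define R where "R x = exact_part \<zeta> \<omega> x + ((((- \<nu>) * (norm (vgrad u x))\<^sup>2 + (- 2 * a * l0 * \<gamma>) * (\<mu> x)\<^sup>2)
      + (\<beta> * ((\<Theta> x)\<^sup>2 * ((norm (grad \<Phi> x))\<^sup>2)\<^sup>2) + \<nu> / (2 * Cp) * (norm (u x))\<^sup>2))
      + ((\<kappa> * (\<Theta> x)\<^sup>2 + (- 2 * k * \<zeta>) * (laplacian \<Theta> x)\<^sup>2)
      + (2 * \<zeta>\<^sup>2 / \<nu> * ((norm (grad \<Theta> x))\<^sup>2)\<^sup>2 + (- 2 * k * \<omega>) * (norm (grad \<Theta> x))\<^sup>2)))" for x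
  have hR: "has_int R (0 + ((((- \<nu>) * ID + (- 2 * a * l0 * \<gamma>) * I\<mu>) + (\<beta> * Iw + \<nu> / (2 * Cp) * Iu))
      + ((\<kappa> * I\<Theta> + (- 2 * k * \<zeta>) * I\<Delta>) + (2 * \<zeta>\<^sup>2 / \<nu> * Ih + (- 2 * k * \<omega>) * Ig))))"
    unfolding R_def[abs_def] ID_def I\<mu>_def Iw_def Iu_def I\<Theta>_def I\<Delta>_def Ih_def Ig_def
    by (intro has_int_add has_int_cmult has_int_exact_part has_intI continuous_slice)
      (intro continuous_intros continuous_slice continuous_u)+
  have hr: "has_int (rate \<zeta> \<omega>) (LINT x:\<Omega>|lborel. rate \<zeta> \<omega> x)"
    by (intro has_intI continuous_slice)
  have le: "rate \<zeta> \<omega> x \<le> R x" if x: "x \<in> \<Omega>" for x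
  proof -
    define H h h' where "H = norm (vgrad u x)" and "h = (norm (grad \<Phi> x))\<^sup>2" and "h' = (norm (grad \<Theta> x))\<^sup>2"
    have 1: "- (2 * l0 * b * \<Theta> x * stretch \<Phi> x) \<le> \<nu> / 2 * H\<^sup>2 + \<beta> * ((\<Theta> x)\<^sup>2 * h\<^sup>2)"
    proof -
      have "\<bar>2 * l0 * b * \<Theta> x * stretch \<Phi> x\<bar> \<le> \<bar>2 * l0 * b * \<Theta> x\<bar> * (H * h)"
        unfolding abs_mult[of _ "stretch \<Phi> x"] H_def h_def by (intro mult_left_mono stretch_le) simp
      also have "\<dots> = 2 * H * (\<bar>l0 * b * \<Theta> x\<bar> * h)" by (simp add: abs_mult)
      also have "\<dots> \<le> \<nu> / 2 * H\<^sup>2 + (\<bar>l0 * b * \<Theta> x\<bar> * h)\<^sup>2 / (\<nu> / 2)" using pos by (intro young) simp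
      also have "(\<bar>l0 * b * \<Theta> x\<bar> * h)\<^sup>2 / (\<nu> / 2) = \<beta> * ((\<Theta> x)\<^sup>2 * h\<^sup>2)"
        by (simp add: \<beta>_def power_mult_distrib)
      finally show ?thesis by linarith
    qed
    have 2: "2 * \<alpha> * g * \<Theta> x * (u x \<bullet> j) \<le> \<nu> / (2 * Cp) * (norm (u x))\<^sup>2 + \<kappa> * (\<Theta> x)\<^sup>2"
    proof -
      have "2 * \<alpha> * g * \<Theta> x * (u x \<bullet> j) \<le> \<bar>2 * \<alpha> * g * \<Theta> x\<bar> * \<bar>u x \<bullet> j\<bar>"
        unfolding abs_mult[symmetric] by (rule abs_ge_self)
      also have "\<dots> \<le> \<bar>2 * \<alpha> * g * \<Theta> x\<bar> * norm (u x)"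
        using Cauchy_Schwarz_ineq2[of "u x" j] j by (intro mult_left_mono) auto
      also have "\<dots> = 2 * norm (u x) * \<bar>\<alpha> * g * \<Theta> x\<bar>" by (simp add: abs_mult)
      also have "\<dots> \<le> \<nu> / (2 * Cp) * (norm (u x))\<^sup>2 + \<bar>\<alpha> * g * \<Theta> x\<bar>\<^sup>2 / (\<nu> / (2 * Cp))"
        using pos by (intro young) simp
      also have "\<bar>\<alpha> * g * \<Theta> x\<bar>\<^sup>2 / (\<nu> / (2 * Cp)) = \<kappa> * (\<Theta> x)\<^sup>2"
        by (simp add: \<kappa>_def power_mult_distrib)
      finally show ?thesis .
    qed
    have 3: "- (2 * \<zeta> * stretch \<Theta> x) \<le> \<nu> / 2 * H\<^sup>2 + 2 * \<zeta>\<^sup>2 / \<nu> * h'\<^sup>2"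
    proof -
      have "\<bar>2 * \<zeta> * stretch \<Theta> x\<bar> \<le> \<bar>2 * \<zeta>\<bar> * (H * h')"
        unfolding abs_mult[of _ "stretch \<Theta> x"] H_def h'_def by (intro mult_left_mono stretch_le) simp
      also have "\<dots> = 2 * H * (\<zeta> * h')" using pos by simp
      also have "\<dots> \<le> \<nu> / 2 * H\<^sup>2 + (\<zeta> * h')\<^sup>2 / (\<nu> / 2)" using pos by (intro young) simp
      finally show ?thesis by (simp add: power_mult_distrib)
    qed
    show ?thesis
      unfolding rate_eq[OF x] R_def H_def[symmetric] h_def[symmetric] h'_def[symmetric] using 1 2 3 by linarith
  qed
  have main: "(LINT x:\<Omega>|lborel. rate \<zeta> \<omega> x) \<le> 0 + ((((- \<nu>) * ID + (- 2 * a * l0 * \<gamma>) * I\<mu>) + (\<beta> * Iw + \<nu> / (2 * Cp) * Iu))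
      + ((\<kappa> * I\<Theta> + (- 2 * k * \<zeta>) * I\<Delta>) + (2 * \<zeta>\<^sup>2 / \<nu> * Ih + (- 2 * k * \<omega>) * Ig)))"
    by (rule has_int_mono[OF hr hR le])
  have nn: "0 \<le> I\<mu>" "0 \<le> I\<Theta>" "0 \<le> I\<Delta>" "0 \<le> Ig" "0 \<le> \<beta>" "0 \<le> \<kappa>"
    unfolding I\<mu>_def I\<Theta>_def I\<Delta>_def Ig_def \<beta>_def \<kappa>_def using pos by (auto intro!: integral_nonneg)
  have b1: "\<nu> / (2 * Cp) * Iu \<le> \<nu> / 2 * ID"
  proof -
    have "\<nu> / (2 * Cp) * Iu \<le> \<nu> / (2 * Cp) * (Cp * ID)"
      using poincare_u pos unfolding Iu_def ID_def by (intro mult_left_mono) auto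
    then show ?thesis using pos by simp
  qed
  have "\<beta> * Iw \<le> \<beta> * (CW * I\<mu> + K * I\<Theta>)"
    using wL4 nn unfolding Iw_def I\<mu>_def I\<Theta>_def by (intro mult_left_mono)
  also have "\<dots> = \<beta> * CW * I\<mu> + \<beta> * K * I\<Theta>" by (simp add: algebra_simps)
  finally have b2: "\<beta> * Iw \<le> a * l0 * \<gamma> * I\<mu> + \<beta> * K * I\<Theta>"
    using mult_right_mono[OF c2[folded \<beta>_def] nn(1)] by simp
  have b3: "2 * \<zeta>\<^sup>2 / \<nu> * Ih \<le> k * \<zeta> * I\<Delta>"
  proof -
    have "2 * \<zeta>\<^sup>2 / \<nu> * Ih \<le> 2 * \<zeta>\<^sup>2 / \<nu> * (CL * I\<Delta>)"
      using L4 pos unfolding Ih_def I\<Delta>_def by (intro mult_left_mono) auto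
    also have "\<dots> = (2 * \<zeta> * CL / \<nu>) * (\<zeta> * I\<Delta>)" by (simp add: power2_eq_square)
    also have "\<dots> \<le> k * (\<zeta> * I\<Delta>)" using c1 pos nn by (intro mult_right_mono) auto
    finally show ?thesis by simp
  qed
  have b4: "(\<beta> * K + \<kappa>) * I\<Theta> \<le> 2 * k * \<omega> * Ig"
  proof -
    have "(\<beta> * K + \<kappa>) * I\<Theta> \<le> (\<beta> * K + \<kappa>) * (Cp * Ig)"
      using poincare_\<Theta> nn pos unfolding I\<Theta>_def Ig_def by (intro mult_left_mono) auto
    also have "\<dots> = (\<beta> * K + \<kappa>) * Cp * Ig" by simp
    also have "\<dots> \<le> 2 * k * \<omega> * Ig" using c3 nn unfolding \<beta>_def \<kappa>_def by (intro mult_right_mono) auto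
    finally show ?thesis .
  qed
  have "(\<beta> * K + \<kappa>) * I\<Theta> = \<beta> * K * I\<Theta> + \<kappa> * I\<Theta>" by (simp add: algebra_simps)
  then show ?thesis
    unfolding ID_def[symmetric] I\<mu>_def[symmetric] I\<Delta>_def[symmetric] using main b1 b2 b3 b4 by linarith
qed

end

context solenoidal
begin

lemma vector_poincare:
  assumes "\<And>w. Ck_on (Suc 0) w W \<Longrightarrow> (\<forall>x\<in>frontier \<Omega>. w x = 0) \<Longrightarrow>
    (LINT x:\<Omega>|lborel. (w x)\<^sup>2) \<le> C * (LINT x:\<Omega>|lborel. (norm (grad w x))\<^sup>2)"
  shows "(LINT x:\<Omega>|lborel. (norm (u x))\<^sup>2) \<le> C * (LINT x:\<Omega>|lborel. (norm (vgrad u x))\<^sup>2)"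
proof -
  have ui: "Ck_on (Suc 0) (\<lambda>y. u y $ i) W" for i by (rule Ck_on_nth[OF W(1) u1])
  note c = continuous_on_subset[OF Ck_on_imp_continuous_on W(2)]
  have "(LINT x:\<Omega>|lborel. (norm (u x))\<^sup>2) = (\<Sum>i\<in>UNIV. LINT x:\<Omega>|lborel. (u x $ i)\<^sup>2)"
    unfolding norm_vec_def L2_set_def
    by (simp add: sum_nonneg) (intro set_lebesgue_integral_sum integrable_Omega continuous_intros c[OF u1])
  also have "\<dots> \<le> (\<Sum>i\<in>UNIV. C * (LINT x:\<Omega>|lborel. (norm (grad (\<lambda>y. u y $ i) x))\<^sup>2))"
    by (intro sum_mono assms ui) (simp add: u0)
  also have "\<dots> = C * (LINT x:\<Omega>|lborel. (norm (vgrad u x))\<^sup>2)"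
    unfolding norm_vgrad_sq sum_distrib_left[symmetric]
    by (subst set_lebesgue_integral_sum) (auto intro!: integrable_Omega continuous_intros c[OF Ck_on_grad[OF W(1) ui]])
  finally show ?thesis .
qed

end


section \<open>Differentiation under the integral and the maximum principle\<close>

lemma has_real_derivative_time_slice:
  fixes H :: "real \<times> 'a::real_normed_vector \<Rightarrow> real"
  assumes "H differentiable (at (t, x))"
  shows "((\<lambda>s. H (s, x)) has_real_derivative frechet_derivative H (at (t, x)) (1, 0)) (at t)"
  using has_derivative_line_real[of H _ "(0, x)" t "(1, 0)"] has_frechet_derivative[OF assms] by simp

text \<open>Dominated convergence for the difference quotients: for times between
  \<open>t / 2\<close> and \<open>2 * t\<close> the time derivative is bounded on a compact set, and
  the mean value inequality transfers the bound to the quotients.\<close>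

lemma (in smooth_domain) leibniz_integral:
  fixes H :: "real \<times> (real^'n) \<Rightarrow> real"
  assumes V: "open V" "{0<..} \<times> closure \<Omega> \<subseteq> V" and H: "Ck_on (Suc 0) H V" and t: "t > 0"
  shows "((\<lambda>s. LINT x:\<Omega>|lborel. H (s, x)) has_real_derivative
    (LINT x:\<Omega>|lborel. frechet_derivative H (at (t, x)) (1, 0))) (at t)"
proof -
  define D where "D z = frechet_derivative H (at z) (1, 0)" for z
  have cD: "continuous_on V D" unfolding D_def[abs_def] using H by simp
  have cH: "continuous_on V H" by (rule Ck_on_imp_continuous_on[OF H])
  have d: "((\<lambda>s. H (s, x)) has_real_derivative D (s, x)) (at s)" if "s > 0" "x \<in> closure \<Omega>" for s x
    unfolding D_def using that V(2) H by (intro has_real_derivative_time_slice) auto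
  have slice: "continuous_on (closure \<Omega>) (\<lambda>x. f (s, x))" if "s > 0" "continuous_on V f" for f :: "real \<times> (real^'n) \<Rightarrow> real" and s
    by (rule continuous_on_compose2[OF that(2)]) (use that(1) V(2) in \<open>auto intro!: continuous_intros\<close>)
  let ?K = "{t / 2..2 * t} \<times> closure \<Omega>"
  have "?K \<subseteq> V" using V(2) t by auto
  then have "bounded (D ` ?K)"
    by (intro compact_imp_bounded compact_continuous_image continuous_on_subset[OF cD] compact_Times compact_closure) auto
  then obtain B where B: "B > 0" "\<And>z. z \<in> ?K \<Longrightarrow> \<bar>D z\<bar> \<le> B" by (auto simp: bounded_pos)
  let ?F = "\<lambda>s. LINT x:\<Omega>|lborel. H (s, x)" and ?S = "{t / 2<..<2 * t}"
  have "((\<lambda>s. (?F s - ?F t) / (s - t)) \<longlongrightarrow> (LINT x:\<Omega>|lborel. D (t, x))) (at t within ?S)"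
    unfolding tendsto_at_iff_sequentially comp_def
  proof (intro allI impI)
    fix X assume X: "\<forall>i. X i \<in> ?S - {t}" "X \<longlonglongrightarrow> t"
    have pos: "X i > 0" "X i \<noteq> t" "t / 2 < X i" "X i < 2 * t" for i using X(1) t by (auto intro: less_trans[of 0 "t / 2"])
    have q: "(?F (X i) - ?F t) / (X i - t) = (LINT x:\<Omega>|lborel. (H (X i, x) - H (t, x)) / (X i - t))" for i
      by (simp add: set_integral_diff integrable_Omega slice[OF pos(1) cH] slice[OF t cH])
    have "(\<lambda>i. LINT x:\<Omega>|lborel. (H (X i, x) - H (t, x)) / (X i - t)) \<longlonglongrightarrow> (LINT x:\<Omega>|lborel. D (t, x))"
      unfolding set_lebesgue_integral_def
    proof (rule integral_dominated_convergence)
      show "integrable lborel (\<lambda>x. indicator \<Omega> x *\<^sub>R B)"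
        using set_integrable_1[of B] by (simp add: set_integrable_def)
      show "(\<lambda>x. indicator \<Omega> x *\<^sub>R D (t, x)) \<in> borel_measurable lborel"
        using integrable_Omega[OF slice[OF t cD]] unfolding set_integrable_def by (rule borel_measurable_integrable)
      have "continuous_on (closure \<Omega>) (\<lambda>x. (H (X i, x) - H (t, x)) / (X i - t))" for i
        using pos(2)[of i] by (intro continuous_intros slice cH pos(1) t) auto
      then show "(\<lambda>x. indicator \<Omega> x *\<^sub>R ((H (X i, x) - H (t, x)) / (X i - t))) \<in> borel_measurable lborel" for i
        using integrable_Omega unfolding set_integrable_def by (blast intro: borel_measurable_integrable)
      show "AE x in lborel. norm (indicator \<Omega> x *\<^sub>R ((H (X i, x) - H (t, x)) / (X i - t))) \<le> indicator \<Omega> x *\<^sub>R B" for i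
      proof (rule AE_I2)
        fix x
        have "\<bar>H (X i, x) - H (t, x)\<bar> \<le> B * \<bar>X i - t\<bar>" if x: "x \<in> \<Omega>"
        proof -
          have "norm (H (X i, x) - H (t, x)) \<le> B * norm (X i - t)"
          proof (rule field_differentiable_bound[of "{t / 2..2 * t}" "\<lambda>s. H (s, x)" "\<lambda>s. D (s, x)"])
            fix s assume s: "s \<in> {t / 2..2 * t}"
            show "((\<lambda>s. H (s, x)) has_field_derivative D (s, x)) (at s within {t / 2..2 * t})"
              using s t x closure_subset by (intro has_field_derivative_at_within[OF d]) auto
            show "norm (D (s, x)) \<le> B" using B(2)[of "(s, x)"] s x closure_subset by auto
          qed (use pos[of i] t in auto)
          then show ?thesis by simp
        qed
        then show "norm (indicator \<Omega> x *\<^sub>R ((H (X i, x) - H (t, x)) / (X i - t))) \<le> indicator \<Omega> x *\<^sub>R B"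
          using pos(2)[of i] by (auto simp: indicator_def field_simps)
      qed
      show "AE x in lborel. (\<lambda>i. indicator \<Omega> x *\<^sub>R ((H (X i, x) - H (t, x)) / (X i - t))) \<longlonglongrightarrow> indicator \<Omega> x *\<^sub>R D (t, x)"
      proof (rule AE_I2)
        fix x
        show "(\<lambda>i. indicator \<Omega> x *\<^sub>R ((H (X i, x) - H (t, x)) / (X i - t))) \<longlonglongrightarrow> indicator \<Omega> x *\<^sub>R D (t, x)"
        proof (cases "x \<in> \<Omega>")
          case True
          then have "((\<lambda>s. (H (s, x) - H (t, x)) / (s - t)) \<longlongrightarrow> D (t, x)) (at t)"
            using d[OF t] closure_subset by (auto simp: has_field_derivative_iff)
          moreover have "filterlim X (at t) sequentially"
            unfolding filterlim_at using X(2) pos by auto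
          ultimately have "(\<lambda>i. (H (X i, x) - H (t, x)) / (X i - t)) \<longlonglongrightarrow> D (t, x)" by (rule filterlim_compose)
          then show ?thesis using True by simp
        qed simp
      qed
    qed
    then show "(\<lambda>i. (?F (X i) - ?F t) / (X i - t)) \<longlonglongrightarrow> (LINT x:\<Omega>|lborel. D (t, x))" by (simp only: q)
  qed
  moreover have "at t within ?S = at t" using t by (intro at_within_open) auto
  ultimately show ?thesis by (simp add: has_field_derivative_iff D_def)
qed

section \<open>The maximum principle\<close>

text \<open>Axis by axis: a positive pure second derivative would make the first derivative positive
  just after \<open>x\<close>, so \<open>v\<close> would increase there.\<close>

lemma interior_maximum:
  fixes v :: "real^'n \<Rightarrow> real"
  assumes S: "open S" "x \<in> S" and v: "Ck_on (Suc (Suc 0)) v S" and max: "\<And>y. y \<in> S \<Longrightarrow> v y \<le> v x"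
  shows "grad v x = 0" "laplacian v x \<le> 0"
proof -
  obtain r where r: "r > 0" "ball x r \<subseteq> S" using S open_contains_ball by blast
  have inS: "x + s *\<^sub>R axis i 1 \<in> S" if "\<bar>s\<bar> < r" for s :: real and i
    using that r(2) by (auto simp: dist_norm intro!: subsetD[OF r(2)])
  have d: "((\<lambda>s. v (x + s *\<^sub>R axis i 1)) has_real_derivative partial i v (x + s *\<^sub>R axis i 1)) (at s)" if "\<bar>s\<bar> < r" for s i
    unfolding partial_def using inS[OF that] v by (intro has_derivative_line_real has_frechet_derivative) auto
  have d2: "((\<lambda>s. partial i v (x + s *\<^sub>R axis i 1)) has_real_derivative partial i (partial i v) x) (at 0)" for i
    using has_derivative_line_real[of "partial i v" _ x 0 "axis i 1"]
      has_frechet_derivative[OF Ck_on_differentiable[OF Ck_on_partial[OF v] S(2)]]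
    unfolding partial_def[of i "partial i v"] by simp
  have g: "partial i v x = 0" for i
    using DERIV_local_max[OF d[of 0 i] r(1)] inS max r(1) by simp
  then show "grad v x = 0" by (simp add: grad_def vec_eq_iff)
  have "partial i (partial i v) x \<le> 0" for i
  proof (rule ccontr)
    assume "\<not> partial i (partial i v) x \<le> 0"
    then obtain e where e: "e > 0" "\<And>h. 0 < h \<Longrightarrow> h < e \<Longrightarrow> 0 < partial i v (x + h *\<^sub>R axis i 1)"
      using DERIV_pos_inc_right[OF d2[of i]] by (auto simp: g)
    define h where "h = min e r / 2"
    have h: "0 < h" "h < e" "h < r" using e(1) r(1) by (auto simp: h_def min_def)
    have "((\<lambda>s. v (x + s *\<^sub>R axis i 1)) has_real_derivative partial i v (x + s *\<^sub>R axis i 1)) (at s)" if "0 \<le> s" "s \<le> h" for s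
      using that h by (intro d) auto
    from MVT2[OF h(1) this] obtain z where z: "0 < z" "z < h"
      "v (x + h *\<^sub>R axis i 1) - v (x + 0 *\<^sub>R axis i 1) = (h - 0) * partial i v (x + z *\<^sub>R axis i 1)" by blast
    have d0: "0 < partial i v (x + z *\<^sub>R axis i 1)" using e(2) z h by simp
    have "v x < v (x + h *\<^sub>R axis i 1)" using z(3) mult_pos_pos[OF h(1) d0] by simp
    moreover have "v (x + h *\<^sub>R axis i 1) \<le> v x" using h by (intro max inS) auto
    ultimately show False by simp
  qed
  then show "laplacian v x \<le> 0" by (simp add: laplacian_def sum_nonpos)
qed

text \<open>Subtracting \<open>e * s\<close> makes the comparison strict. If the bound failed, the
  maximum of \<open>v s y - e * s\<close> would be attained at positive time in the interior, where
  \<open>step\<close> gives a time slope of at most \<open>- e\<close>, and slightly earlier values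
  would be larger. Only earlier times are compared, so the final time needs no separate
  case.\<close>

lemma (in smooth_domain) maximum_principle:
  fixes v :: "real \<Rightarrow> real^'n \<Rightarrow> real"
  assumes cont: "continuous_on ({0..} \<times> closure \<Omega>) (\<lambda>(t, x). v t x)"
    and init: "\<And>x. x \<in> closure \<Omega> \<Longrightarrow> v 0 x \<le> m"
    and bdry: "\<And>t x. t > 0 \<Longrightarrow> x \<in> frontier \<Omega> \<Longrightarrow> v t x \<le> m"
    and C2: "\<And>t. t > 0 \<Longrightarrow> Ck_on (Suc (Suc 0)) (v t) \<Omega>"
    and step: "\<And>t x. t > 0 \<Longrightarrow> x \<in> \<Omega> \<Longrightarrow> v t x > m \<Longrightarrow> grad (v t) x = 0 \<Longrightarrow> laplacian (v t) x \<le> 0 \<Longrightarrow>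
      \<exists>d\<le>0. ((\<lambda>s. v s x) has_real_derivative d) (at t)"
    and t: "t \<ge> 0" and x: "x \<in> closure \<Omega>"
  shows "v t x \<le> m"
proof (rule ccontr)
  assume "\<not> v t x \<le> m"
  \<comment> \<open>At time \<open>t\<close> the correction gives away at most half of the excess
    over \<open>m\<close>.\<close>
  define e where "e = (v t x - m) / (2 * (t + 1))"
  have e: "e > 0" using \<open>\<not> v t x \<le> m\<close> t by (simp add: e_def)
  have et: "v t x - e * t > m"
  proof -
    have "e * (2 * (t + 1)) = v t x - m" using t by (simp add: e_def)
    moreover have "0 \<le> e * t" using e t by simp
    ultimately show ?thesis using e by (simp add: algebra_simps)
  qed
  have "continuous_on ({0..t} \<times> closure \<Omega>) (\<lambda>z. v (fst z) (snd z))"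
    using continuous_on_subset[OF cont, of "{0..t} \<times> closure \<Omega>"] by (force simp: case_prod_unfold)
  then have "continuous_on ({0..t} \<times> closure \<Omega>) (\<lambda>z. v (fst z) (snd z) - e * fst z)"
    by (intro continuous_intros)
  moreover have "compact ({0..t} \<times> closure \<Omega>)" by (intro compact_Times compact_closure) auto
  ultimately obtain z where z: "z \<in> {0..t} \<times> closure \<Omega>"
    "\<And>y. y \<in> {0..t} \<times> closure \<Omega> \<Longrightarrow> v (fst y) (snd y) - e * fst y \<le> v (fst z) (snd z) - e * fst z"
    using continuous_attains_sup[of "{0..t} \<times> closure \<Omega>" "\<lambda>z. v (fst z) (snd z) - e * fst z"] t x by fastforce
  obtain t1 x1 where z1: "z = (t1, x1)" by (cases z)
  have t1: "0 \<le> t1" "t1 \<le> t" "x1 \<in> closure \<Omega>" using z(1) z1 by auto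
  have max: "v s y - e * s \<le> v t1 x1 - e * t1" if "0 \<le> s" "s \<le> t" "y \<in> closure \<Omega>" for s y
    using z(2)[of "(s, y)"] that z1 by simp
  have gt: "v t1 x1 > m + e * t1" using max[OF t order_refl x] et by simp
  then have gtm: "v t1 x1 > m" using e t1 by (smt (verit) mult_nonneg_nonneg)
  have pos: "t1 > 0" using init[OF t1(3)] gtm t1(1) by (cases "t1 = 0") auto
  have x1: "x1 \<in> \<Omega>" using bdry[OF pos, of x1] gtm t1(3) closure_cases by force
  have sub: "y \<in> closure \<Omega>" if "y \<in> \<Omega>" for y using that closure_subset by blast
  have "v t1 y \<le> v t1 x1" if "y \<in> \<Omega>" for y using max[OF t1(1,2) sub[OF that]] by simp
  from interior_maximum[OF open_Omega x1 C2[OF pos] this] step[OF pos x1 gtm]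
  obtain d where d: "d \<le> 0" "((\<lambda>s. v s x1) has_real_derivative d) (at t1)" by blast
  have "((\<lambda>s. v s x1 - e * s) has_real_derivative d - e) (at t1)"
    using d(2) by (auto intro!: derivative_eq_intros)
  then obtain r where r: "r > 0" "\<And>h. 0 < h \<Longrightarrow> h < r \<Longrightarrow> v t1 x1 - e * t1 < v (t1 - h) x1 - e * (t1 - h)"
    using DERIV_neg_dec_left[of "\<lambda>s. v s x1 - e * s" "d - e" t1] d(1) e by auto
  define h where "h = min r t1 / 2"
  have h: "0 < h" "h < r" "h \<le> t1" using r(1) pos by (auto simp: h_def min_def)
  show False using r(2)[OF h(1,2)] max[of "t1 - h" x1] h t1 by simp
qed

text \<open>The set where a continuous function exceeds its essential bound is open and null, hence
  empty.\<close>

lemma Linf_norm_le_imp_bounded: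
  fixes f :: "real^'n \<Rightarrow> real"
  assumes \<Omega>: "open \<Omega>" and f: "continuous_on \<Omega> f" and le: "Linf_norm \<Omega> f \<le> ereal C" and x: "x \<in> \<Omega>"
  shows "\<bar>f x\<bar> \<le> C"
proof (rule ccontr)
  assume "\<not> \<bar>f x\<bar> \<le> C"
  define S where "S = \<Omega> \<inter> (\<lambda>y. \<bar>f y\<bar>) -` {C<..}"
  have "open S" unfolding S_def by (intro continuous_open_preimage continuous_intros f \<Omega>)
  have "AE y in restrict_space lborel \<Omega>. ereal \<bar>f y\<bar> \<le> Linf_norm \<Omega> f"
    unfolding Linf_norm_def by (rule esssup_AE)
  then have "AE y in restrict_space lborel \<Omega>. \<bar>f y\<bar> \<le> C"
    by (rule eventually_mono) (metis le order_trans ereal_less_eq(3))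
  then have "AE y in lborel. y \<in> \<Omega> \<longrightarrow> \<bar>f y\<bar> \<le> C" using \<Omega> by (subst (asm) AE_restrict_space_iff) auto
  then have "AE y in lborel. y \<notin> S" by (rule eventually_mono) (auto simp: S_def)
  then have "S \<in> null_sets lborel" using \<open>open S\<close> by (subst AE_iff_null_sets) auto
  then have "negligible S" using negligible_iff_null_sets null_sets_completionI by blast
  moreover have "S \<noteq> {}" using x \<open>\<not> \<bar>f x\<bar> \<le> C\<close> by (auto simp: S_def)
  ultimately show False using open_not_negligible \<open>open S\<close> by blast
qed


section \<open>Time slices of a smooth solution\<close>

text \<open>The solution agrees with its smooth extension only on the closure of the domain; this
  rule and its companions transfer the differential operators at interior points.\<close>

lemma convect_cong_open:
  "open S \<Longrightarrow> x \<in> S \<Longrightarrow> (\<And>y. y \<in> S \<Longrightarrow> v y = v' y) \<Longrightarrow> (\<And>y. y \<in> S \<Longrightarrow> f y = f' y) \<Longrightarrow> convect v f x = convect v' f' x"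
  unfolding convect_def by (intro sum.cong refl arg_cong2[where f = scaleR] partial_cong_open[of S x]) auto

lemma laplacian_cong_open:
  "open S \<Longrightarrow> x \<in> S \<Longrightarrow> (\<And>y. y \<in> S \<Longrightarrow> f y = g y) \<Longrightarrow> laplacian f x = laplacian g x"
  unfolding laplacian_def by (intro sum.cong refl partial_cong_open[of S x] partial_cong_open[of S]) auto

lemma vgrad_cong_open:
  "open S \<Longrightarrow> x \<in> S \<Longrightarrow> (\<And>y. y \<in> S \<Longrightarrow> f y = g y) \<Longrightarrow> vgrad f x = vgrad g x"
  by (simp add: vec_eq_iff vgrad_def partial_cong_open[of S x "\<lambda>y. f y $ _" "\<lambda>y. g y $ _"])

lemma tensor_divergence_cong_open:
  "open S \<Longrightarrow> x \<in> S \<Longrightarrow> (\<And>y. y \<in> S \<Longrightarrow> A y = B y) \<Longrightarrow> tensor_divergence A x = tensor_divergence B x"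
  by (simp add: vec_eq_iff tensor_divergence_def partial_cong_open[of S x "\<lambda>y. A y $ _ $ _" "\<lambda>y. B y $ _ $ _"])

lemma stress_cong_open:
  assumes "open S" "x \<in> S" "\<And>y. y \<in> S \<Longrightarrow> \<phi> y = \<phi>' y" "\<And>y. y \<in> S \<Longrightarrow> \<theta> y = \<theta>' y"
  shows "stress l0 a b \<epsilon> \<phi> \<theta> x = stress l0 a b \<epsilon> \<phi>' \<theta>' x"
  using assms by (simp add: stress_def grad_cong_open[of S x \<phi> \<phi>'])

lemma grad_add_const: "f differentiable (at x) \<Longrightarrow> grad (\<lambda>y. f y + c) x = grad f x"
  by (simp add: grad_add grad_const)

lemma smooth_on_extension:
  fixes v :: "real \<Rightarrow> 'a::real_normed_vector \<Rightarrow> 'b::real_normed_vector"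
  assumes "smooth_on (\<lambda>(t, x). v t x) ({0<..} \<times> S)"
  obtains V h where "open V" "{0<..} \<times> S \<subseteq> V" "\<And>m. Ck_on m h V" "\<And>t x. t > 0 \<Longrightarrow> x \<in> S \<Longrightarrow> v t x = h (t, x)"
  using assms unfolding smooth_on_def by force

lemma frechet_derivative_slice:
  fixes f :: "'a::real_normed_vector \<times> 'b::real_normed_vector \<Rightarrow> 'c::real_normed_vector"
  assumes "f differentiable (at (t, x))"
  shows "frechet_derivative (\<lambda>x. f (t, x)) (at x) v = frechet_derivative f (at (t, x)) (0, v)"
proof -
  have "((\<lambda>x. f (t, x)) has_derivative (\<lambda>v. frechet_derivative f (at (t, x)) (0, v))) (at x)"
    by (rule has_derivative_compose[of "\<lambda>x. (t, x)" "\<lambda>v. (0, v)" x UNIV f,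
          OF has_derivative_Pair[OF has_derivative_const has_derivative_ident] has_frechet_derivative[OF assms]])
  then show ?thesis by (simp add: frechet_derivative_eqI)
qed

lemma has_vector_derivative_time_slice:
  fixes H :: "real \<times> 'a::real_normed_vector \<Rightarrow> 'b::real_normed_vector"
  assumes H: "H differentiable (at (t, x))" and "t > 0" and eq: "\<And>s. s > 0 \<Longrightarrow> v s = H (s, x)"
  shows "(v has_vector_derivative frechet_derivative H (at (t, x)) (1, 0)) (at t)"
proof -
  have "((\<lambda>s. H (s, x)) has_vector_derivative frechet_derivative H (at (t, x)) (1, 0)) (at t)"
    using has_derivative_line[of H _ "(0, x)" t "(1, 0)"] has_frechet_derivative[OF H] by simp
  then show ?thesis
    by (rule has_vector_derivative_transform_within_open[of _ _ _ "{0<..}"]) (use assms in auto)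
qed

lemma has_real_derivative_time_slice':
  fixes H :: "real \<times> 'a::real_normed_vector \<Rightarrow> real"
  assumes "H differentiable (at (t, x))" "t > 0" "\<And>s. s > 0 \<Longrightarrow> v s = H (s, x)"
  shows "(v has_real_derivative frechet_derivative H (at (t, x)) (1, 0)) (at t)"
  using has_vector_derivative_time_slice[OF assms] by (simp add: has_real_derivative_iff_has_vector_derivative)

context smooth_domain
begin

lemma L2_norm_sq: "(L2_norm \<Omega> f)\<^sup>2 = (LINT x:\<Omega>|lborel. (norm (f x))\<^sup>2)"
  unfolding L2_norm_def by (intro real_sqrt_pow2 integral_nonneg) simp

text \<open>The maximum principle for \<open>v\<close> and for its negative. At a critical point
  transport drops out, and the sign of \<open>r\<close> drives the value back. The phase is the case
  \<open>r = deriv (FF \<epsilon>)\<close> with \<open>m = 1\<close>, the temperature the case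
  \<open>r = 0\<close>.\<close>

lemma scalar_bound:
  fixes v :: "real \<Rightarrow> real^'n \<Rightarrow> real"
  assumes sm: "smooth_on (\<lambda>(t, x). v t x) ({0<..} \<times> closure \<Omega>)"
    and cont: "continuous_on ({0..} \<times> closure \<Omega>) (\<lambda>(t, x). v t x)"
    and pde: "\<And>t x. t > 0 \<Longrightarrow> x \<in> \<Omega> \<Longrightarrow> deriv (\<lambda>s. v s x) t + convect (u t) (v t) x = \<kappa> * (laplacian (v t) x - r (v t x))"
    and \<kappa>: "\<kappa> > 0" and r: "\<And>s. s > m \<Longrightarrow> r s \<ge> 0" "\<And>s. s < - m \<Longrightarrow> r s \<le> 0"
    and bdry: "\<And>t x. t > 0 \<Longrightarrow> x \<in> frontier \<Omega> \<Longrightarrow> \<bar>v t x\<bar> \<le> m"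
    and init: "Linf_norm \<Omega> v0 \<le> ereal m" "\<And>x. x \<in> \<Omega> \<Longrightarrow> v 0 x = v0 x"
    and t: "t \<ge> 0" and x: "x \<in> closure \<Omega>"
  shows "\<bar>v t x\<bar> \<le> m"
proof -
  obtain V h where h: "open V" "{0<..} \<times> closure \<Omega> \<subseteq> V" "\<And>m. Ck_on m h V" "\<And>t x. t > 0 \<Longrightarrow> x \<in> closure \<Omega> \<Longrightarrow> v t x = h (t, x)"
    using smooth_on_extension[OF sm] by metis
  have cl: "y \<in> closure \<Omega>" if "y \<in> \<Omega>" for y using that closure_subset by blast
  have C2: "Ck_on (Suc (Suc 0)) (v t) \<Omega>" if t: "t > 0" for t
    by (rule Ck_on_cong[OF Ck_on_subset[OF Ck_on_slice[OF h(1) h(3)]] open_Omega]) (use h(2,4) t cl in auto)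
  have c0: "continuous_on (closure \<Omega>) (v 0)"
    using continuous_on_compose2[OF cont, of "closure \<Omega>" "\<lambda>x. (0, x)"] by (force intro!: continuous_intros)
  have v0: "\<bar>v0 y\<bar> \<le> m" if "y \<in> \<Omega>" for y
  proof (rule Linf_norm_le_imp_bounded[OF open_Omega _ init(1) that])
    have "continuous_on \<Omega> (v 0)" by (rule continuous_on_subset[OF c0 closure_subset])
    then show "continuous_on \<Omega> v0" using continuous_on_cong[of \<Omega> \<Omega> "v 0" v0] init(2) by simp
  qed
  \<comment> \<open>The pointwise bound on the open domain passes to the closure by continuity at
    time 0.\<close>
  have init': "\<bar>v 0 y\<bar> \<le> m" if "y \<in> closure \<Omega>" for y
    by (rule continuous_le_on_closure[OF continuous_on_rabs[OF c0] that]) (simp add: init(2) v0)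
  have "c * v t x \<le> m" if c: "c = 1 \<or> c = -1" for c
  proof (rule maximum_principle[where v = "\<lambda>t x. c * v t x", OF _ _ _ _ _ t x])
    show "continuous_on ({0..} \<times> closure \<Omega>) (\<lambda>(t, x). c * v t x)"
      using continuous_on_mult[OF continuous_on_const cont, of c] by (simp add: case_prod_unfold)
    show "c * v 0 y \<le> m" if "y \<in> closure \<Omega>" for y using init'[OF that] c by auto
    show "c * v t y \<le> m" if "t > 0" "y \<in> frontier \<Omega>" for t y using bdry[OF that] c by auto
    show "Ck_on (Suc (Suc 0)) (\<lambda>x. c * v t x) \<Omega>" if "t > 0" for t
      by (intro Ck_on_mult open_Omega Ck_on_const C2 that)
    fix t x assume t: "t > 0" and x: "x \<in> \<Omega>" and gt: "c * v t x > m" and g0: "grad (\<lambda>x. c * v t x) x = 0"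
      and l0: "laplacian (\<lambda>x. c * v t x) x \<le> 0"
    have gc: "grad (\<lambda>y. c * f y) y = c *\<^sub>R grad f y" if "f differentiable (at y)" for f :: "real^'n \<Rightarrow> real" and y
      using grad_mult[OF _ that, of "\<lambda>_. c"] by (simp add: grad_const)
    have d1: "v t differentiable (at y)" if "y \<in> \<Omega>" for y
      by (rule Ck_on_differentiable[OF C2[OF t] that])
    have "laplacian (\<lambda>y. c * v t y) x = divergence (\<lambda>y. c *\<^sub>R grad (v t) y) x"
      unfolding laplacian_eq_divergence by (rule divergence_cong_open[OF open_Omega x]) (rule gc[OF d1])
    also have "\<dots> = c * laplacian (v t) x"
      using divergence_scaleR[OF _ Ck_on_differentiable[OF Ck_on_grad[OF open_Omega C2[OF t]] x], of "\<lambda>_. c"]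
      by (simp add: laplacian_eq_divergence grad_const)
    finally have l: "c * laplacian (v t) x \<le> 0" using l0 by simp
    have g: "grad (v t) x = 0" using g0 gc[OF d1[OF x]] c by auto
    have "h differentiable (at (t, x))" using h(3)[of "Suc 0"] h(2) t cl[OF x] by auto
    from has_real_derivative_time_slice'[OF this t, of "\<lambda>s. v s x"] h(4) cl[OF x]
    have dv: "((\<lambda>s. v s x) has_real_derivative deriv (\<lambda>s. v s x) t) (at t)" by (metis DERIV_imp_deriv)
    have e: "deriv (\<lambda>s. v s x) t = \<kappa> * (laplacian (v t) x - r (v t x))"
      using pde[OF t x] g by (simp add: convect_scalar)
    have "c * deriv (\<lambda>s. v s x) t = \<kappa> * (c * laplacian (v t) x - c * r (v t x))"
      unfolding e by (simp add: algebra_simps)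
    moreover have "0 \<le> c * r (v t x)" using c gt r(1)[of "v t x"] r(2)[of "v t x"] by auto
    ultimately have "c * deriv (\<lambda>s. v s x) t \<le> 0" using l \<kappa> by (simp add: mult_nonneg_nonpos)
    then show "\<exists>d\<le>0. ((\<lambda>s. c * v s x) has_real_derivative d) (at t)" using DERIV_cmult[OF dv, of c] by blast
  qed
  from this[of 1] this[of "-1"] show ?thesis by simp
qed

end

section \<open>Reduction of a smooth solution to data at a fixed time\<close>

locale smooth_flow = smooth_domain \<Omega> \<rho> for \<Omega> :: "(real^'n) set" and \<rho> +
  fixes \<nu> \<gamma> k l0 a \<epsilon> b \<alpha> g :: real and j :: "real^'n" and u0 :: "real^'n \<Rightarrow> real^'n" and \<phi>0 \<theta>0 :: "real^'n \<Rightarrow> real"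
    and u :: "real \<Rightarrow> real^'n \<Rightarrow> real^'n" and \<phi> \<theta> :: "real \<Rightarrow> real^'n \<Rightarrow> real"
  assumes sol: "smooth_solution \<Omega> \<nu> \<gamma> k l0 a \<epsilon> b \<alpha> g j u0 \<phi>0 \<theta>0 u \<phi> \<theta>"
begin

text \<open>A solution merely coincides on the closure with functions smooth on a neighbourhood. At
  time \<open>t\<close> it is therefore replaced by slices of these extensions, which are smooth on
  an open \<open>W\<close>, and the energy is differentiated through an integrand \<open>H\<close>
  built from the extensions.\<close>

lemma slice_exists:
  assumes t: "t > 0"
  shows "\<exists>W U p \<Phi> \<Theta> \<Phi>t \<Theta>t ut. flow_slice \<Omega> \<rho> W U p \<Phi> \<Theta> \<Phi>t \<Theta>t ut \<nu> \<gamma> k l0 a b \<epsilon> \<alpha> g j \<and>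
    (\<forall>x\<in>closure \<Omega>. u t x = U x \<and> \<phi> t x = \<Phi> x \<and> \<theta> t x = \<Theta> x) \<and> (\<forall>x\<in>frontier \<Omega>. \<Phi> x = - 1) \<and>
    (\<forall>\<zeta> \<omega>. (energy \<Omega> l0 a \<epsilon> \<zeta> \<omega> u \<phi> \<theta> has_real_derivative
      (LINT x:\<Omega>|lborel. flow_slice.rate U \<Phi> \<Theta> \<Phi>t \<Theta>t ut l0 a \<epsilon> \<zeta> \<omega> x)) (at t))"
proof -
  obtain p where p: "smooth_on (\<lambda>(t, x). p t x) ({0<..} \<times> closure \<Omega>)"
    and smu: "smooth_on (\<lambda>(t, x). u t x) ({0<..} \<times> closure \<Omega>)"
    and sm\<phi>: "smooth_on (\<lambda>(t, x). \<phi> t x) ({0<..} \<times> closure \<Omega>)"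
    and sm\<theta>: "smooth_on (\<lambda>(t, x). \<theta> t x) ({0<..} \<times> closure \<Omega>)"
    and pde: "\<And>t x. t > 0 \<Longrightarrow> x \<in> \<Omega> \<Longrightarrow>
          vector_derivative (\<lambda>s. u s x) (at t) + convect (u t) (u t) x + grad (p t) x
              - \<nu> *\<^sub>R laplacian (u t) x
            = - tensor_divergence (stress l0 a b \<epsilon> (\<phi> t) (\<theta> t)) x
              - ((1 - \<alpha> * \<theta> t x) * g) *\<^sub>R j \<and>
          divergence (u t) x = 0 \<and>
          deriv (\<lambda>s. \<phi> s x) t + convect (u t) (\<phi> t) x
            = \<gamma> * (laplacian (\<phi> t) x - deriv (FF \<epsilon>) (\<phi> t x)) \<and>
          deriv (\<lambda>s. \<theta> s x) t + convect (u t) (\<theta> t) x = k * laplacian (\<theta> t) x"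
    and bc: "\<And>t x. t > 0 \<Longrightarrow> x \<in> frontier \<Omega> \<Longrightarrow> u t x = 0 \<and> \<phi> t x = -1 \<and> \<theta> t x = 0"
    using sol unfolding smooth_solution_def by blast
  obtain Vu hu where hu: "open Vu" "{0<..} \<times> closure \<Omega> \<subseteq> Vu" "\<And>m. Ck_on m hu Vu"
    "\<And>t x. t > 0 \<Longrightarrow> x \<in> closure \<Omega> \<Longrightarrow> u t x = hu (t, x)" by (rule smooth_on_extension[OF smu]) blast
  obtain Vf hf where hf: "open Vf" "{0<..} \<times> closure \<Omega> \<subseteq> Vf" "\<And>m. Ck_on m hf Vf"
    "\<And>t x. t > 0 \<Longrightarrow> x \<in> closure \<Omega> \<Longrightarrow> \<phi> t x = hf (t, x)" by (rule smooth_on_extension[OF sm\<phi>]) blast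
  obtain Vh hh where hh: "open Vh" "{0<..} \<times> closure \<Omega> \<subseteq> Vh" "\<And>m. Ck_on m hh Vh"
    "\<And>t x. t > 0 \<Longrightarrow> x \<in> closure \<Omega> \<Longrightarrow> \<theta> t x = hh (t, x)" by (rule smooth_on_extension[OF sm\<theta>]) blast
  obtain Vp hp where hp: "open Vp" "{0<..} \<times> closure \<Omega> \<subseteq> Vp" "\<And>m. Ck_on m hp Vp"
    "\<And>t x. t > 0 \<Longrightarrow> x \<in> closure \<Omega> \<Longrightarrow> p t x = hp (t, x)" by (rule smooth_on_extension[OF p]) blast
  define V where "V = Vu \<inter> Vf \<inter> Vh \<inter> Vp"
  have V: "open V" "{0<..} \<times> closure \<Omega> \<subseteq> V" using hu(1,2) hf(1,2) hh(1,2) hp(1,2) by (auto simp: V_def)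
  have Cu: "Ck_on m hu V" and Cf: "Ck_on m hf V" and Ch: "Ck_on m hh V" and Cp: "Ck_on m hp V" for m
    by (rule Ck_on_subset[OF hu(3)] Ck_on_subset[OF hf(3)] Ck_on_subset[OF hh(3)] Ck_on_subset[OF hp(3)]; auto simp: V_def)+
  have inV: "(s, x) \<in> V" if "s > 0" "x \<in> closure \<Omega>" for s x using V(2) that by auto
  have cl: "y \<in> closure \<Omega>" if "y \<in> \<Omega>" for y using that closure_subset by blast
  have fr: "y \<in> closure \<Omega>" if "y \<in> frontier \<Omega>" for y using that by (simp add: frontier_iff)
  have dm: "f differentiable (at (s, x))" if "\<And>m. Ck_on m f V" "s > 0" "x \<in> closure \<Omega>"
    for f :: "real \<times> (real^'n) \<Rightarrow> 'b::real_normed_vector" and s x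
    by (rule Ck_on_differentiable[OF that(1) inV[OF that(2,3)]])
  define W where "W = {x. (t, x) \<in> V}"
  have W: "open W" "closure \<Omega> \<subseteq> W"
    using open_vimage[OF V(1), of "\<lambda>x. (t, x)"] inV[OF t] by (auto simp: W_def vimage_def continuous_intros)
  define dt :: "(real \<times> (real^'n) \<Rightarrow> real) \<Rightarrow> real^'n \<Rightarrow> real" where "dt f x = frechet_derivative f (at (t, x)) (1, 0)" for f x
  define dx :: "(real \<times> (real^'n) \<Rightarrow> real) \<Rightarrow> 'n \<Rightarrow> real \<times> (real^'n) \<Rightarrow> real" where "dx f i z = frechet_derivative f (at z) (0, axis i 1)" for f i z
  define U p' \<Phi> \<Theta> where "U x = hu (t, x)" and "p' x = hp (t, x)" and "\<Phi> x = hf (t, x)" and "\<Theta> x = hh (t, x)" for x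
  define ut where "ut x = frechet_derivative hu (at (t, x)) (1, 0)" for x
  have slice: "Ck_on m (\<lambda>x. f (t, x)) W" if "Ck_on m f V" for m and f :: "real \<times> (real^'n) \<Rightarrow> 'b::real_normed_vector"
    unfolding W_def by (rule Ck_on_slice[OF V(1) that])
  have dt: "Ck_on m (dt f) W" if "Ck_on (Suc m) f V" for m f
    unfolding dt_def[abs_def] by (rule slice) (rule Ck_on_frechet_derivative[OF that])
  have dx: "Ck_on m (dx f i) V" if "Ck_on (Suc m) f V" for m f i
    unfolding dx_def[abs_def] by (rule Ck_on_frechet_derivative[OF that])
  have sl: "u t x = U x" "\<phi> t x = \<Phi> x" "\<theta> t x = \<Theta> x" "p t x = p' x" if "x \<in> closure \<Omega>" for x
    using hu(4) hf(4) hh(4) hp(4) t that by (auto simp: U_def \<Phi>_def \<Theta>_def p'_def)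
  have sl\<Omega>: "u t y = U y" "\<phi> t y = \<Phi> y" "\<theta> t y = \<Theta> y" "p t y = p' y" if "y \<in> \<Omega>" for y
    using sl[OF cl[OF that]] by auto
  have dtime: "((\<lambda>s. f (s, x)) has_real_derivative dt f x) (at t)" if "\<And>m. Ck_on m f V" "x \<in> closure \<Omega>" for f x
    unfolding dt_def by (rule has_real_derivative_time_slice[OF dm[OF that(1) t that(2)]])
  have dt\<phi>: "deriv (\<lambda>s. \<phi> s x) t = dt hf x" and dt\<theta>: "deriv (\<lambda>s. \<theta> s x) t = dt hh x" if "x \<in> closure \<Omega>" for x
    unfolding dt_def using hf(4) hh(4) that
    by (auto intro!: DERIV_imp_deriv has_real_derivative_time_slice' dm Cf Ch t)
  \<comment> \<open>At a boundary point the extensions of phase and temperature are constant in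
    time, as the data are, so their time derivatives vanish.\<close>
  have dt0: "dt f x = 0" if "\<And>m. Ck_on m f V" "x \<in> frontier \<Omega>" "\<And>s. s > 0 \<Longrightarrow> f (s, x) = c" for f x c
  proof -
    have "((\<lambda>s. c) has_real_derivative dt f x) (at t)"
      unfolding dt_def by (rule has_real_derivative_time_slice'[OF dm[OF that(1) t fr[OF that(2)]] t]) (simp add: that(3))
    then show ?thesis using DERIV_unique DERIV_const by blast
  qed
  have fs: "flow_slice \<Omega> \<rho> W U p' \<Phi> \<Theta> (dt hf) (dt hh) ut \<nu> \<gamma> k l0 a b \<epsilon> \<alpha> g j"
  proof unfold_locales
    show "Ck_on (Suc (Suc 0)) U W" "Ck_on (Suc 0) p' W" "Ck_on (Suc (Suc (Suc 0))) \<Phi> W" "Ck_on (Suc (Suc (Suc 0))) \<Theta> W"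
      unfolding U_def[abs_def] p'_def[abs_def] \<Phi>_def[abs_def] \<Theta>_def[abs_def] by (rule slice, rule Cu Cp Cf Ch)+
    show "Ck_on (Suc 0) (dt hf) W" "Ck_on (Suc 0) (dt hh) W" by (rule dt, rule Cf Ch)+
    have "Ck_on 0 ut W"
      unfolding ut_def[abs_def] by (rule slice) (rule Ck_on_frechet_derivative[OF Cu])
    then show "continuous_on (closure \<Omega>) ut" using W(2) by (rule Ck_continuous)
    show "U x = 0" if "x \<in> frontier \<Omega>" for x using bc[OF t that] sl[OF fr[OF that]] by simp
    show "\<Theta> x = 0 \<and> dt hf x = 0 \<and> dt hh x = 0" if x: "x \<in> frontier \<Omega>" for x
    proof -
      have "dt hf x = 0" by (rule dt0[OF Cf x, of "-1"]) (use bc[OF _ x] hf(4)[OF _ fr[OF x]] in simp)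
      moreover have "dt hh x = 0" by (rule dt0[OF Ch x, of 0]) (use bc[OF _ x] hh(4)[OF _ fr[OF x]] in simp)
      ultimately show ?thesis using bc[OF t x] sl[OF fr[OF x]] by simp
    qed
    fix x assume x: "x \<in> \<Omega>"
    note co = open_Omega x
    have "vector_derivative (\<lambda>s. u s x) (at t) = ut x"
      unfolding ut_def using hu(4) cl[OF x]
      by (intro vector_derivative_at has_vector_derivative_time_slice[OF dm[OF Cu t cl[OF x]] t]) auto
    moreover have "convect (u t) (u t) x = convect U U x" by (rule convect_cong_open[OF co]) (simp_all add: sl\<Omega>)
    moreover have "grad (p t) x = grad p' x" by (rule grad_cong_open[OF co]) (simp add: sl\<Omega>)
    moreover have "laplacian (u t) x = laplacian U x" by (rule laplacian_cong_open[OF co]) (simp add: sl\<Omega>)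
    moreover have "tensor_divergence (stress l0 a b \<epsilon> (\<phi> t) (\<theta> t)) x = tensor_divergence (stress l0 a b \<epsilon> \<Phi> \<Theta>) x"
      by (rule tensor_divergence_cong_open[OF co], rule stress_cong_open[OF open_Omega]) (simp_all add: sl\<Omega>)
    ultimately show "ut x + convect U U x + grad p' x - \<nu> *\<^sub>R laplacian U x =
        - tensor_divergence (stress l0 a b \<epsilon> \<Phi> \<Theta>) x - ((1 - \<alpha> * \<Theta> x) * g) *\<^sub>R j"
      using pde[OF t x] sl\<Omega>[OF x] by simp
    have "divergence (u t) x = divergence U x" by (rule divergence_cong_open[OF co]) (simp add: sl\<Omega>)
    then show "divergence U x = 0" using pde[OF t x] by simp
    have "convect (u t) (\<phi> t) x = convect U \<Phi> x" "laplacian (\<phi> t) x = laplacian \<Phi> x"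
      by (rule convect_cong_open[OF co] laplacian_cong_open[OF co]; simp add: sl\<Omega>)+
    then show "dt hf x + convect U \<Phi> x = \<gamma> * (laplacian \<Phi> x - deriv (FF \<epsilon>) (\<Phi> x))"
      using pde[OF t x] sl\<Omega>[OF x] dt\<phi>[OF cl[OF x]] by simp
    have "convect (u t) (\<theta> t) x = convect U \<Theta> x" "laplacian (\<theta> t) x = laplacian \<Theta> x"
      by (rule convect_cong_open[OF co] laplacian_cong_open[OF co]; simp add: sl\<Omega>)+
    then show "dt hh x + convect U \<Theta> x = k * laplacian \<Theta> x"
      using pde[OF t x] dt\<theta>[OF cl[OF x]] by simp
  qed (use W in auto)
  interpret fs: flow_slice \<Omega> \<rho> W U p' \<Phi> \<Theta> "dt hf" "dt hh" ut \<nu> \<gamma> k l0 a b \<epsilon> \<alpha> g j by (rule fs)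
  have "(energy \<Omega> l0 a \<epsilon> \<zeta> \<omega> u \<phi> \<theta> has_real_derivative (LINT x:\<Omega>|lborel. fs.rate \<zeta> \<omega> x)) (at t)" for \<zeta> \<omega>
  proof -
    \<comment> \<open>Gradients are written with the spatial derivatives \<open>dx\<close> of the
      space-time functions, so that \<open>H\<close> is smooth jointly in time and space and
      \<open>leibniz_integral\<close> applies.\<close>
    define H where "H z = (\<Sum>i\<in>UNIV. (hu z $ i)\<^sup>2) + a * l0 * (\<Sum>i\<in>UNIV. (dx hf i z)\<^sup>2) + 2 * a * l0 * FF \<epsilon> (hf z)
      + \<zeta> * (\<Sum>i\<in>UNIV. (dx hh i z)\<^sup>2) + \<omega> * (hh z)\<^sup>2" for z
    have CH: "Ck_on m H V" for m
      unfolding H_def[abs_def] by (intro Ck_on_add Ck_on_mult Ck_on_sum Ck_on_power Ck_on_const Ck_on_FF Ck_on_nth dx V Cu Cf Ch)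
    have gr: "grad (v s) x $ i = dx f i (s, x)" if "s > 0" "x \<in> \<Omega>" "\<And>m. Ck_on m f V" "\<And>y. y \<in> \<Omega> \<Longrightarrow> v s y = f (s, y)" for s x i v f
    proof -
      have "grad (v s) x = grad (\<lambda>y. f (s, y)) x" by (rule grad_cong_open[OF open_Omega that(2)]) (rule that(4))
      then show ?thesis by (simp add: grad_def partial_def dx_def frechet_derivative_slice[OF dm[OF that(3,1) cl[OF that(2)]]])
    qed
    have n2: "(norm y)\<^sup>2 = (\<Sum>i\<in>UNIV. (y $ i)\<^sup>2)" for y :: "real^'n" by (simp add: norm_vec_def L2_set_def sum_nonneg)
    have en: "energy \<Omega> l0 a \<epsilon> \<zeta> \<omega> u \<phi> \<theta> s = (LINT x:\<Omega>|lborel. H (s, x))" if s: "s > 0" for s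
    proof -
      have c: "continuous_on (closure \<Omega>) (\<lambda>x. f (s, x))" if "Ck_on m f V" for f :: "real \<times> (real^'n) \<Rightarrow> real" and m
        by (rule continuous_on_compose2[OF Ck_on_imp_continuous_on[OF that]]) (use inV[OF s] in \<open>auto intro!: continuous_intros\<close>)
      have "has_int (\<lambda>x. H (s, x)) ((LINT x:\<Omega>|lborel. \<Sum>i\<in>UNIV. (hu (s, x) $ i)\<^sup>2) + a * l0 * (LINT x:\<Omega>|lborel. \<Sum>i\<in>UNIV. (dx hf i (s, x))\<^sup>2)
        + 2 * a * l0 * (LINT x:\<Omega>|lborel. FF \<epsilon> (hf (s, x))) + \<zeta> * (LINT x:\<Omega>|lborel. \<Sum>i\<in>UNIV. (dx hh i (s, x))\<^sup>2)
        + \<omega> * (LINT x:\<Omega>|lborel. (hh (s, x))\<^sup>2))"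
        unfolding H_def
        by (intro has_int_add has_int_cmult has_intI c[of 0] Ck_on_sum Ck_on_power Ck_on_FF Ck_on_nth dx V Cu Cf Ch)
      moreover have "(LINT x:\<Omega>|lborel. (norm (u s x))\<^sup>2) = (LINT x:\<Omega>|lborel. \<Sum>i\<in>UNIV. (hu (s, x) $ i)\<^sup>2)"
        "(LINT x:\<Omega>|lborel. (norm (grad (\<phi> s) x))\<^sup>2) = (LINT x:\<Omega>|lborel. \<Sum>i\<in>UNIV. (dx hf i (s, x))\<^sup>2)"
        "(LINT x:\<Omega>|lborel. FF \<epsilon> (\<phi> s x)) = (LINT x:\<Omega>|lborel. FF \<epsilon> (hf (s, x)))"
        "(LINT x:\<Omega>|lborel. (norm (grad (\<theta> s) x))\<^sup>2) = (LINT x:\<Omega>|lborel. \<Sum>i\<in>UNIV. (dx hh i (s, x))\<^sup>2)"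
        "(LINT x:\<Omega>|lborel. (norm (\<theta> s x))\<^sup>2) = (LINT x:\<Omega>|lborel. (hh (s, x))\<^sup>2)"
        using hu(4)[OF s cl] hf(4)[OF s cl] hh(4)[OF s cl]
        by (auto intro!: set_lebesgue_integral_cong sum.cong simp: n2 gr[OF s _ Cf] gr[OF s _ Ch])
      ultimately show ?thesis unfolding energy_def L2_norm_sq by (simp add: has_int_def)
    qed
    have "((\<lambda>s. LINT x:\<Omega>|lborel. H (s, x)) has_real_derivative (LINT x:\<Omega>|lborel. dt H x)) (at t)"
      unfolding dt_def by (rule leibniz_integral[OF V CH t])
    then have "(energy \<Omega> l0 a \<epsilon> \<zeta> \<omega> u \<phi> \<theta> has_real_derivative (LINT x:\<Omega>|lborel. dt H x)) (at t)"
      by (rule has_field_derivative_transform_within_open[of _ _ _ "{0<..}"]) (use en t in auto)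
    moreover have "dt H x = fs.rate \<zeta> \<omega> x" if x: "x \<in> \<Omega>" for x
    proof -
      note xc = cl[OF x]
      have dtu: "((\<lambda>s. hu (s, x) $ i) has_real_derivative ut x $ i) (at t)" for i
      proof -
        have "((\<lambda>s. hu (s, x)) has_vector_derivative ut x) (at t)"
          unfolding ut_def by (rule has_vector_derivative_time_slice[OF dm[OF Cu t xc] t]) simp
        then have "((\<lambda>s. hu (s, x) $ i) has_vector_derivative ut x $ i) (at t)"
          unfolding has_vector_derivative_def
          by (rule bounded_linear.has_derivative[OF bounded_linear_vec_nth, THEN has_derivative_eq_rhs]) simp
        then show ?thesis by (simp add: has_real_derivative_iff_has_vector_derivative)
      qed
      \<comment> \<open>Time and space derivatives are interchanged by the symmetry of second
        derivatives in space-time.\<close>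
      have gt: "grad (dt f) x $ i = dt (dx f i) x" if f: "\<And>m. Ck_on m f V" for f i
      proof -
        have "grad (dt f) x $ i = frechet_derivative (\<lambda>z. frechet_derivative f (at z) (1, 0)) (at (t, x)) (0, axis i 1)"
          unfolding grad_def partial_def dt_def[abs_def]
          using frechet_derivative_slice[OF dm[of "\<lambda>z. frechet_derivative f (at z) (1, 0)", OF Ck_on_frechet_derivative[OF f] t xc]]
          by simp
        also have "\<dots> = dt (dx f i) x"
          unfolding dt_def dx_def[abs_def] by (rule frechet_derivative_commute[OF V(1) f inV[OF t xc]])
        finally show ?thesis .
      qed
      have g\<Phi>: "grad \<Phi> x $ i = dx hf i (t, x)" and g\<Theta>: "grad \<Theta> x $ i = dx hh i (t, x)" for i
        using gr[OF t x Cf, of "\<lambda>_. \<Phi>"] gr[OF t x Ch, of "\<lambda>_. \<Theta>"] by (simp_all add: \<Phi>_def \<Theta>_def)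
      have "((\<lambda>s. H (s, x)) has_real_derivative fs.rate \<zeta> \<omega> x) (at t)"
        unfolding H_def
      proof (rule DERIV_cong)
        show "((\<lambda>s. (\<Sum>i\<in>UNIV. (hu (s, x) $ i)\<^sup>2) + a * l0 * (\<Sum>i\<in>UNIV. (dx hf i (s, x))\<^sup>2) + 2 * a * l0 * FF \<epsilon> (hf (s, x))
            + \<zeta> * (\<Sum>i\<in>UNIV. (dx hh i (s, x))\<^sup>2) + \<omega> * (hh (s, x))\<^sup>2) has_real_derivative
          (\<Sum>i\<in>UNIV. 2 * (hu (t, x) $ i * ut x $ i)) + a * l0 * (\<Sum>i\<in>UNIV. 2 * (dx hf i (t, x) * dt (dx hf i) x))
          + 2 * a * l0 * (deriv (FF \<epsilon>) (\<Phi> x) * dt hf x) + \<zeta> * (\<Sum>i\<in>UNIV. 2 * (dx hh i (t, x) * dt (dx hh i) x))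
          + \<omega> * (2 * (\<Theta> x * dt hh x))) (at t)"
        proof (intro DERIV_add DERIV_cmult DERIV_sum)
          have sq: "((\<lambda>s. (f s)\<^sup>2) has_real_derivative 2 * (f t * d)) (at t)" if "(f has_real_derivative d) (at t)" for f d
            using DERIV_power[OF that, of 2] by (simp add: mult.commute)
          show "((\<lambda>s. (hu (s, x) $ i)\<^sup>2) has_real_derivative 2 * (hu (t, x) $ i * ut x $ i)) (at t)" for i
            by (rule sq[OF dtu])
          show "((\<lambda>s. (dx hf i (s, x))\<^sup>2) has_real_derivative 2 * (dx hf i (t, x) * dt (dx hf i) x)) (at t)"
            "((\<lambda>s. (dx hh i (s, x))\<^sup>2) has_real_derivative 2 * (dx hh i (t, x) * dt (dx hh i) x)) (at t)" for i
            by (rule sq, rule dtime[OF dx xc], rule Cf Ch)+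
          show "((\<lambda>s. FF \<epsilon> (hf (s, x))) has_real_derivative deriv (FF \<epsilon>) (\<Phi> x) * dt hf x) (at t)"
            unfolding deriv_FF \<Phi>_def by (rule DERIV_chain2[OF has_real_derivative_FF dtime[OF Cf xc]])
          show "((\<lambda>s. (hh (s, x))\<^sup>2) has_real_derivative 2 * (\<Theta> x * dt hh x)) (at t)"
            unfolding \<Theta>_def by (rule sq[OF dtime[OF Ch xc]])
        qed
        show "(\<Sum>i\<in>UNIV. 2 * (hu (t, x) $ i * ut x $ i)) + a * l0 * (\<Sum>i\<in>UNIV. 2 * (dx hf i (t, x) * dt (dx hf i) x))
          + 2 * a * l0 * (deriv (FF \<epsilon>) (\<Phi> x) * dt hf x) + \<zeta> * (\<Sum>i\<in>UNIV. 2 * (dx hh i (t, x) * dt (dx hh i) x))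
          + \<omega> * (2 * (\<Theta> x * dt hh x)) = fs.rate \<zeta> \<omega> x"
          unfolding fs.rate_def inner_vec_def g\<Phi> g\<Theta> gt[OF Cf] gt[OF Ch] U_def
          by (simp flip: sum_distrib_left)
      qed
      then show ?thesis using dtime[OF CH xc] DERIV_unique by blast
    qed
    then have "(LINT x:\<Omega>|lborel. dt H x) = (LINT x:\<Omega>|lborel. fs.rate \<zeta> \<omega> x)"
      by (intro set_lebesgue_integral_cong) auto
    ultimately show ?thesis by simp
  qed
  moreover have "\<forall>x\<in>closure \<Omega>. u t x = U x \<and> \<phi> t x = \<Phi> x \<and> \<theta> t x = \<Theta> x" using sl by blast
  moreover have "\<forall>x\<in>frontier \<Omega>. \<Phi> x = - 1" using bc[OF t] sl fr by metis
  ultimately show ?thesis using fs by blast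
qed

end


section \<open>The energy inequality\<close>

context smooth_flow
begin

text \<open>\<open>deriv (FF \<epsilon>) s\<close> is a nonnegative multiple of
  \<open>s * (s - 1) * (s + 1)\<close>, so beyond the two wells it never opposes the sign of
  \<open>s\<close>; these are the conditions of \<open>scalar_bound\<close> with
  \<open>m = 1\<close>.\<close>

lemma solution_bounds:
  assumes pos: "\<gamma> > 0" "k > 0"
    and init: "Linf_norm \<Omega> \<phi>0 \<le> 1" "Linf_norm \<Omega> \<theta>0 \<le> ereal M" and M: "M \<ge> 0"
    and t: "t \<ge> 0" and x: "x \<in> closure \<Omega>"
  shows "\<bar>\<phi> t x\<bar> \<le> 1" "\<bar>\<theta> t x\<bar> \<le> M"
proof -
  have sm: "smooth_on (\<lambda>(t, x). \<phi> t x) ({0<..} \<times> closure \<Omega>)" "smooth_on (\<lambda>(t, x). \<theta> t x) ({0<..} \<times> closure \<Omega>)"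
    "continuous_on ({0..} \<times> closure \<Omega>) (\<lambda>(t, x). \<phi> t x)" "continuous_on ({0..} \<times> closure \<Omega>) (\<lambda>(t, x). \<theta> t x)"
    and pde: "\<And>t x. t > 0 \<Longrightarrow> x \<in> \<Omega> \<Longrightarrow>
        deriv (\<lambda>s. \<phi> s x) t + convect (u t) (\<phi> t) x = \<gamma> * (laplacian (\<phi> t) x - deriv (FF \<epsilon>) (\<phi> t x))"
      "\<And>t x. t > 0 \<Longrightarrow> x \<in> \<Omega> \<Longrightarrow> deriv (\<lambda>s. \<theta> s x) t + convect (u t) (\<theta> t) x = k * (laplacian (\<theta> t) x - 0)"
    and bc: "\<And>t x. t > 0 \<Longrightarrow> x \<in> frontier \<Omega> \<Longrightarrow> \<bar>\<phi> t x\<bar> \<le> 1" "\<And>t x. t > 0 \<Longrightarrow> x \<in> frontier \<Omega> \<Longrightarrow> \<bar>\<theta> t x\<bar> \<le> M"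
    and ic: "\<And>x. x \<in> \<Omega> \<Longrightarrow> \<phi> 0 x = \<phi>0 x" "\<And>x. x \<in> \<Omega> \<Longrightarrow> \<theta> 0 x = \<theta>0 x"
    using sol M unfolding smooth_solution_def by auto
  have F1: "0 \<le> deriv (FF \<epsilon>) s" if "s > 1" for s
  proof -
    have "s ^ 3 - s = s * (s - 1) * (s + 1)" by (simp add: power3_eq_cube algebra_simps)
    then show ?thesis using that by (simp add: deriv_FF)
  qed
  have F2: "deriv (FF \<epsilon>) s \<le> 0" if "s < - 1" for s
    using F1[of "- s"] that by (auto simp: deriv_FF divide_le_0_iff zero_le_divide_iff)
  show "\<bar>\<phi> t x\<bar> \<le> 1"
    by (rule scalar_bound[OF sm(1,3) pde(1) pos(1) F1 F2 bc(1) _ ic(1) t x]) (use init(1) in \<open>auto simp: one_ereal_def\<close>)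
  show "\<bar>\<theta> t x\<bar> \<le> M"
    by (rule scalar_bound[OF sm(2,4) pde(2) pos(2) _ _ bc(2) init(2) ic(2) t x]) auto
qed

end

theorem proposition2p1:
  fixes \<Omega> :: "(real^'n) set"
  assumes "CARD('n) \<in> {2, 3}"
    and "bounded_smooth_domain \<Omega>"
  shows "\<exists>C1>0. \<forall>\<nu> \<gamma> k l0 a \<epsilon> b \<alpha> g :: real.
    \<nu> > 0 \<and> \<gamma> > 0 \<and> k > 0 \<and> l0 > 0 \<and> a > 0 \<and> \<epsilon> > 0 \<and> b \<noteq> 0 \<longrightarrow>
    (\<exists>\<zeta>>0. \<exists>\<omega>>0. \<forall>j u0 \<phi>0 \<theta>0 u \<phi> \<theta>.
       norm j = 1 \<and>
       Linf_norm \<Omega> \<phi>0 \<le> 1 \<and>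
       Linf_norm \<Omega> \<theta>0 \<le> ereal (1 / (4 * C1\<^sup>2 * \<bar>b\<bar>) * sqrt (a * \<gamma> * \<nu> / (2 * l0))) \<and>
       smooth_solution \<Omega> \<nu> \<gamma> k l0 a \<epsilon> b \<alpha> g j u0 \<phi>0 \<theta>0 u \<phi> \<theta> \<longrightarrow>
       (\<forall>t>0.
          energy \<Omega> l0 a \<epsilon> \<zeta> \<omega> u \<phi> \<theta> differentiable (at t) \<and>
          deriv (energy \<Omega> l0 a \<epsilon> \<zeta> \<omega> u \<phi> \<theta>) t
            \<le> - (\<nu> / 2) * (L2_norm \<Omega> (vgrad (u t)))\<^sup>2
              - a * l0 * \<gamma> * (L2_norm \<Omega> (\<lambda>x. laplacian (\<phi> t) x - deriv (FF \<epsilon>) (\<phi> t x)))\<^sup>2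
              - k * \<zeta> * (L2_norm \<Omega> (laplacian (\<theta> t)))\<^sup>2 \<and>
          - (\<nu> / 2) * (L2_norm \<Omega> (vgrad (u t)))\<^sup>2
              - a * l0 * \<gamma> * (L2_norm \<Omega> (\<lambda>x. laplacian (\<phi> t) x - deriv (FF \<epsilon>) (\<phi> t x)))\<^sup>2
              - k * \<zeta> * (L2_norm \<Omega> (laplacian (\<theta> t)))\<^sup>2 \<le> 0 \<and>
          0 \<le> energy \<Omega> l0 a \<epsilon> \<zeta> \<omega> u \<phi> \<theta> t))"
proof -
  obtain \<rho> where "smooth_domain \<Omega> \<rho>"
    using bounded_smooth_domain_imp_smooth_domain[OF assms(2)] by blast
  then interpret smooth_domain \<Omega> \<rho> .
  from poincare obtain Cp where Cp: "Cp > 0" "\<forall>W w. open W \<and> closure \<Omega> \<subseteq> W \<and> Ck_on (Suc 0) w W \<and> (\<forall>x\<in>frontier \<Omega>. w x = 0) \<longrightarrow>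
    (LINT x:\<Omega>|lborel. (w x)\<^sup>2) \<le> Cp * (LINT x:\<Omega>|lborel. (norm (grad w x))\<^sup>2)" by (elim exE conjE) (rule that)
  from grad_L4_bound obtain CL where CL: "CL > 0" "\<forall>W w M. open W \<and> closure \<Omega> \<subseteq> W \<and> Ck_on (Suc (Suc (Suc 0))) w W \<and>
      (\<forall>x\<in>frontier \<Omega>. w x = 0) \<and> (\<forall>x\<in>\<Omega>. \<bar>w x\<bar> \<le> M) \<longrightarrow>
    (LINT x:\<Omega>|lborel. ((norm (grad w x))\<^sup>2)\<^sup>2) \<le> CL * M\<^sup>2 * (LINT x:\<Omega>|lborel. (laplacian w x)\<^sup>2)" by (elim exE conjE) (rule that)
  from weighted_grad_L4_bound obtain CW where CW: "CW > 0" "\<forall>f f' L F. Ck_on (Suc 0) f UNIV \<and>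
      (\<forall>s. (f has_real_derivative f' s) (at s)) \<and> f 0 = 0 \<and> 0 \<le> L \<and> 0 \<le> F \<and>
      (\<forall>s. 0 \<le> s \<longrightarrow> s \<le> 2 \<longrightarrow> - L \<le> f' s \<and> \<bar>f s\<bar> \<le> F) \<longrightarrow>
    (\<exists>K\<ge>0. \<forall>W w v M. open W \<and> closure \<Omega> \<subseteq> W \<and> Ck_on (Suc (Suc (Suc 0))) w W \<and> (\<forall>x\<in>frontier \<Omega>. w x = 0) \<and>
        (\<forall>x\<in>\<Omega>. 0 \<le> w x \<and> w x \<le> 2) \<and> continuous_on (closure \<Omega>) v \<and> (\<forall>x\<in>\<Omega>. \<bar>v x\<bar> \<le> M) \<longrightarrow>
      (LINT x:\<Omega>|lborel. (v x)\<^sup>2 * ((norm (grad w x))\<^sup>2)\<^sup>2)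
        \<le> CW * M\<^sup>2 * (LINT x:\<Omega>|lborel. (laplacian w x - f (w x))\<^sup>2) + K * (LINT x:\<Omega>|lborel. (v x)\<^sup>2))"
    by (elim exE conjE) (rule that)
  \<comment> \<open>Depends on the domain alone, since \<open>CW\<close> is uniform in the
    nonlinearity. Being at least 1, it satisfies \<open>CW \<le> C1 ^ 4\<close>.\<close>
  define C1 where "C1 = max 1 CW"
  have C1: "C1 \<ge> 1" "CW \<le> C1" by (auto simp: C1_def)
  show ?thesis
  proof (rule exI[of _ C1], intro conjI allI impI; (elim conjE)?)
    show "C1 > 0" using C1 by simp
    fix \<nu> \<gamma> k l0 a \<epsilon> b \<alpha> g :: real
    assume pos: "\<nu> > 0" "\<gamma> > 0" "k > 0" "l0 > 0" "a > 0" "\<epsilon> > 0" "b \<noteq> 0"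
    \<comment> \<open>The admissible size of the initial temperature; by the maximum principle it
      bounds the temperature at all times.\<close>
    define M where "M = 1 / (4 * C1\<^sup>2 * \<bar>b\<bar>) * sqrt (a * \<gamma> * \<nu> / (2 * l0))"
    have M: "M > 0" using pos C1 by (simp add: M_def)
    have M2: "M\<^sup>2 = a * \<gamma> * \<nu> / (32 * C1 ^ 4 * b\<^sup>2 * l0)"
      using pos by (simp add: M_def power_mult_distrib power_divide real_sqrt_pow2)
    \<comment> \<open>\<open>F'\<close> with its argument shifted by 1: applied to
      \<open>w = \<phi> + 1\<close> it gives \<open>F'(\<phi>)\<close>, and it vanishes at 0. On
      [0, 2] its constants \<open>L\<close> and \<open>F\<close> are
      \<open>1 / \<epsilon>\<^sup>2\<close> and \<open>2 / \<epsilon>\<^sup>2\<close>; they affect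
      only \<open>K\<close>.\<close>
    define f where "f s = ((s - 1) ^ 3 - (s - 1)) / \<epsilon>\<^sup>2" for s
    define f' where "f' s = (3 * (s - 1)\<^sup>2 - 1) / \<epsilon>\<^sup>2" for s
    have f1: "Ck_on (Suc 0) f UNIV"
      unfolding f_def[abs_def] divide_inverse
      by (intro Ck_on_mult Ck_on_diff Ck_on_power Ck_on_const Ck_on_ident open_UNIV)
    have f2: "\<forall>s. (f has_real_derivative f' s) (at s)"
    proof
      fix s
      have "((\<lambda>s. (s - 1) ^ 3 - (s - 1)) has_real_derivative 3 * (s - 1)\<^sup>2 - 1) (at s)"
        by (rule derivative_eq_intros refl | simp)+
      then show "(f has_real_derivative f' s) (at s)" unfolding f_def[abs_def] f'_def by (rule DERIV_cdivide)
    qed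
    have f3: "\<forall>s. 0 \<le> s \<longrightarrow> s \<le> 2 \<longrightarrow> - (1 / \<epsilon>\<^sup>2) \<le> f' s \<and> \<bar>f s\<bar> \<le> 2 / \<epsilon>\<^sup>2"
    proof (intro allI impI conjI)
      fix s :: real assume s: "0 \<le> s" "s \<le> 2"
      have e: "\<epsilon>\<^sup>2 > 0" using pos by simp
      have "(- 1) / \<epsilon>\<^sup>2 \<le> f' s" unfolding f'_def using e by (intro divide_right_mono) auto
      then show "- (1 / \<epsilon>\<^sup>2) \<le> f' s" by simp
      have "\<bar>(s - 1) ^ 3 - (s - 1)\<bar> \<le> \<bar>s - 1\<bar> ^ 3 + \<bar>s - 1\<bar>" by (metis abs_triangle_ineq4 power_abs)
      also have "\<dots> \<le> 1 ^ 3 + 1" using s by (intro add_mono power_mono) auto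
      finally show "\<bar>f s\<bar> \<le> 2 / \<epsilon>\<^sup>2" unfolding f_def using e by (simp add: divide_right_mono)
    qed
    have "\<exists>K\<ge>0. \<forall>W w v M. open W \<and> closure \<Omega> \<subseteq> W \<and> Ck_on (Suc (Suc (Suc 0))) w W \<and> (\<forall>x\<in>frontier \<Omega>. w x = 0) \<and>
        (\<forall>x\<in>\<Omega>. 0 \<le> w x \<and> w x \<le> 2) \<and> continuous_on (closure \<Omega>) v \<and> (\<forall>x\<in>\<Omega>. \<bar>v x\<bar> \<le> M) \<longrightarrow>
      (LINT x:\<Omega>|lborel. (v x)\<^sup>2 * ((norm (grad w x))\<^sup>2)\<^sup>2)
        \<le> CW * M\<^sup>2 * (LINT x:\<Omega>|lborel. (laplacian w x - f (w x))\<^sup>2) + K * (LINT x:\<Omega>|lborel. (v x)\<^sup>2)"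
      by (rule CW(2)[rule_format, of f f' "1 / \<epsilon>\<^sup>2" "2 / \<epsilon>\<^sup>2"]) (use f1 f2 f3 in \<open>simp add: f_def del: Ck_on.simps\<close>)
    then obtain K where K: "K \<ge> 0" "\<forall>W w v M. open W \<and> closure \<Omega> \<subseteq> W \<and> Ck_on (Suc (Suc (Suc 0))) w W \<and> (\<forall>x\<in>frontier \<Omega>. w x = 0) \<and>
        (\<forall>x\<in>\<Omega>. 0 \<le> w x \<and> w x \<le> 2) \<and> continuous_on (closure \<Omega>) v \<and> (\<forall>x\<in>\<Omega>. \<bar>v x\<bar> \<le> M) \<longrightarrow>
      (LINT x:\<Omega>|lborel. (v x)\<^sup>2 * ((norm (grad w x))\<^sup>2)\<^sup>2)
        \<le> CW * M\<^sup>2 * (LINT x:\<Omega>|lborel. (laplacian w x - f (w x))\<^sup>2) + K * (LINT x:\<Omega>|lborel. (v x)\<^sup>2)"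
      by (elim exE conjE) (rule that)
    \<comment> \<open>Solves the condition \<open>c1\<close> of \<open>dissipation\<close> with
      equality.\<close>
    define \<zeta> where "\<zeta> = k * \<nu> / (2 * (CL * M\<^sup>2))"
    define D where "D = (2 * (l0 * b)\<^sup>2 / \<nu> * K + 2 * Cp / \<nu> * (\<alpha> * g)\<^sup>2) * Cp"
    \<comment> \<open>Exceeds what \<open>c3\<close> requires, with
      \<open>2 * k * \<omega> = D + 1\<close>, so that it is positive even for
      \<open>D = 0\<close>.\<close>
    define \<omega> where "\<omega> = (D + 1) / (2 * k)"
    have D: "D \<ge> 0" using pos K(1) Cp(1) by (simp add: D_def)
    have \<zeta>: "\<zeta> > 0" and \<omega>: "\<omega> > 0" using pos CL(1) M D by (simp_all add: \<zeta>_def \<omega>_def)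
    have c1: "2 * \<zeta> * (CL * M\<^sup>2) / \<nu> \<le> k" using pos CL(1) M by (simp add: \<zeta>_def)
    \<comment> \<open>Here the threshold on the initial temperature is used: inserting
      \<open>M\<^sup>2\<close> leaves \<open>a * l0 * \<gamma>\<close> times
      \<open>CW / (16 * C1 ^ 4)\<close>, free of all other coefficients.\<close>
    have c2: "2 * (l0 * b)\<^sup>2 / \<nu> * (CW * M\<^sup>2) \<le> a * l0 * \<gamma>"
    proof -
      have "2 * (l0 * b)\<^sup>2 / \<nu> * (CW * M\<^sup>2) = a * l0 * \<gamma> * (CW / (16 * C1 ^ 4))"
        unfolding M2 using pos C1 by (simp add: power2_eq_square divide_simps)
      also have "\<dots> \<le> a * l0 * \<gamma> * 1"
      proof (intro mult_left_mono)
        have "C1 ^ 1 \<le> C1 ^ 4" using C1(1) by (intro power_increasing) auto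
        then have "CW \<le> 16 * C1 ^ 4" using C1 by simp
        then show "CW / (16 * C1 ^ 4) \<le> 1" using C1 by simp
      qed (use pos in simp)
      finally show ?thesis by simp
    qed
    have c3: "(2 * (l0 * b)\<^sup>2 / \<nu> * K + 2 * Cp / \<nu> * (\<alpha> * g)\<^sup>2) * Cp \<le> 2 * k * \<omega>"
      using pos unfolding D_def[symmetric] by (simp add: \<omega>_def)
    show "\<exists>\<zeta>>0. \<exists>\<omega>>0. \<forall>j u0 \<phi>0 \<theta>0 u \<phi> \<theta>.
       norm j = 1 \<and>
       Linf_norm \<Omega> \<phi>0 \<le> 1 \<and>
       Linf_norm \<Omega> \<theta>0 \<le> ereal (1 / (4 * C1\<^sup>2 * \<bar>b\<bar>) * sqrt (a * \<gamma> * \<nu> / (2 * l0))) \<and>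
       smooth_solution \<Omega> \<nu> \<gamma> k l0 a \<epsilon> b \<alpha> g j u0 \<phi>0 \<theta>0 u \<phi> \<theta> \<longrightarrow>
       (\<forall>t>0.
          energy \<Omega> l0 a \<epsilon> \<zeta> \<omega> u \<phi> \<theta> differentiable (at t) \<and>
          deriv (energy \<Omega> l0 a \<epsilon> \<zeta> \<omega> u \<phi> \<theta>) t
            \<le> - (\<nu> / 2) * (L2_norm \<Omega> (vgrad (u t)))\<^sup>2
              - a * l0 * \<gamma> * (L2_norm \<Omega> (\<lambda>x. laplacian (\<phi> t) x - deriv (FF \<epsilon>) (\<phi> t x)))\<^sup>2
              - k * \<zeta> * (L2_norm \<Omega> (laplacian (\<theta> t)))\<^sup>2 \<and>
          - (\<nu> / 2) * (L2_norm \<Omega> (vgrad (u t)))\<^sup>2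
              - a * l0 * \<gamma> * (L2_norm \<Omega> (\<lambda>x. laplacian (\<phi> t) x - deriv (FF \<epsilon>) (\<phi> t x)))\<^sup>2
              - k * \<zeta> * (L2_norm \<Omega> (laplacian (\<theta> t)))\<^sup>2 \<le> 0 \<and>
          0 \<le> energy \<Omega> l0 a \<epsilon> \<zeta> \<omega> u \<phi> \<theta> t)"
      unfolding M_def[symmetric]
    proof (rule exI[of _ \<zeta>], rule conjI[OF \<zeta>], rule exI[of _ \<omega>], rule conjI[OF \<omega>], intro allI impI, elim conjE)
      fix j u0 \<phi>0 \<theta>0 u \<phi> \<theta> and t :: real
      assume j: "norm j = 1" and init: "Linf_norm \<Omega> \<phi>0 \<le> 1" "Linf_norm \<Omega> \<theta>0 \<le> ereal M"
        and sol: "smooth_solution \<Omega> \<nu> \<gamma> k l0 a \<epsilon> b \<alpha> g j u0 \<phi>0 \<theta>0 u \<phi> \<theta>" and t: "t > 0"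
      interpret sf: smooth_flow \<Omega> \<rho> \<nu> \<gamma> k l0 a \<epsilon> b \<alpha> g j u0 \<phi>0 \<theta>0 u \<phi> \<theta> by unfold_locales (rule sol)
      have bd: "\<bar>\<phi> t x\<bar> \<le> 1" "\<bar>\<theta> t x\<bar> \<le> M" if "x \<in> closure \<Omega>" for x
        using sf.solution_bounds[OF pos(2,3) init _ _ that] M t by auto
      from sf.slice_exists[OF t] obtain W U p \<Phi> \<Theta> \<Phi>t \<Theta>t ut where
        fs: "flow_slice \<Omega> \<rho> W U p \<Phi> \<Theta> \<Phi>t \<Theta>t ut \<nu> \<gamma> k l0 a b \<epsilon> \<alpha> g j"
        and sl: "\<forall>x\<in>closure \<Omega>. u t x = U x \<and> \<phi> t x = \<Phi> x \<and> \<theta> t x = \<Theta> x" and \<Phi>b: "\<forall>x\<in>frontier \<Omega>. \<Phi> x = - 1"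
        and der: "\<forall>\<zeta> \<omega>. (energy \<Omega> l0 a \<epsilon> \<zeta> \<omega> u \<phi> \<theta> has_real_derivative
          (LINT x:\<Omega>|lborel. flow_slice.rate U \<Phi> \<Theta> \<Phi>t \<Theta>t ut l0 a \<epsilon> \<zeta> \<omega> x)) (at t)" by (elim exE conjE) (rule that)
      interpret fs: flow_slice \<Omega> \<rho> W U p \<Phi> \<Theta> \<Phi>t \<Theta>t ut \<nu> \<gamma> k l0 a b \<epsilon> \<alpha> g j by (rule fs)
      note W = fs.W
      have cl: "x \<in> closure \<Omega>" if "x \<in> \<Omega>" for x using that closure_subset by blast
      have sl\<Omega>: "u t x = U x" "\<phi> t x = \<Phi> x" "\<theta> t x = \<Theta> x" if "x \<in> \<Omega>" for x using sl cl[OF that] by auto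
      have \<Theta>0: "\<forall>x\<in>frontier \<Omega>. \<Theta> x = 0" using fs.boundary by blast
      \<comment> \<open>Vanishes on the boundary, and the maximum principle puts it between 0 and 2,
        as the weighted estimate requires.\<close>
      define w where "w x = \<Phi> x + 1" for x
      have w3: "Ck_on (Suc (Suc (Suc 0))) w W"
        unfolding w_def[abs_def] by (intro Ck_on_add W fs.\<Phi> Ck_on_const)
      have gw: "grad w x = grad \<Phi> x" if "x \<in> W" for x
        unfolding w_def[abs_def] by (rule grad_add_const[OF Ck_on_differentiable[OF fs.\<Phi>1 that]])
      have lw: "laplacian w x = laplacian \<Phi> x" if "x \<in> W" for x
        unfolding laplacian_eq_divergence by (rule divergence_cong_open[OF W(1) that gw])
      have "(LINT x:\<Omega>|lborel. (\<Theta> x)\<^sup>2 * ((norm (grad w x))\<^sup>2)\<^sup>2) \<le>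
          CW * M\<^sup>2 * (LINT x:\<Omega>|lborel. (laplacian w x - f (w x))\<^sup>2) + K * (LINT x:\<Omega>|lborel. (\<Theta> x)\<^sup>2)"
      proof (rule K(2)[rule_format, of W], intro conjI)
        show "\<forall>x\<in>\<Omega>. 0 \<le> w x \<and> w x \<le> 2" using bd(1) cl sl\<Omega>(2) by (fastforce simp: w_def abs_le_iff)
        show "\<forall>x\<in>\<Omega>. \<bar>\<Theta> x\<bar> \<le> M" using bd(2) cl sl\<Omega>(3) by fastforce
        show "\<forall>x\<in>frontier \<Omega>. w x = 0" using \<Phi>b by (simp add: w_def)
      qed (rule W w3 fs.continuous_slice)+
      moreover have "(LINT x:\<Omega>|lborel. (\<Theta> x)\<^sup>2 * ((norm (grad w x))\<^sup>2)\<^sup>2) = (LINT x:\<Omega>|lborel. (\<Theta> x)\<^sup>2 * ((norm (grad \<Phi> x))\<^sup>2)\<^sup>2)"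
        "(LINT x:\<Omega>|lborel. (laplacian w x - f (w x))\<^sup>2) = (LINT x:\<Omega>|lborel. (fs.\<mu> x)\<^sup>2)"
        using in_W[OF W(2)] by (auto intro!: set_lebesgue_integral_cong simp: gw lw fs.\<mu>_def deriv_FF f_def w_def)
      ultimately have wL4: "(LINT x:\<Omega>|lborel. (\<Theta> x)\<^sup>2 * ((norm (grad \<Phi> x))\<^sup>2)\<^sup>2) \<le>
          CW * M\<^sup>2 * (LINT x:\<Omega>|lborel. (fs.\<mu> x)\<^sup>2) + K * (LINT x:\<Omega>|lborel. (\<Theta> x)\<^sup>2)" by simp
      have L4: "(LINT x:\<Omega>|lborel. ((norm (grad \<Theta> x))\<^sup>2)\<^sup>2) \<le> CL * M\<^sup>2 * (LINT x:\<Omega>|lborel. (laplacian \<Theta> x)\<^sup>2)"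
      proof (rule CL(2)[rule_format, of W], intro conjI)
        show "\<forall>x\<in>\<Omega>. \<bar>\<Theta> x\<bar> \<le> M" using bd(2) cl sl\<Omega>(3) by fastforce
      qed (rule W fs.\<Theta> \<Theta>0)+
      have p\<Theta>: "(LINT x:\<Omega>|lborel. (\<Theta> x)\<^sup>2) \<le> Cp * (LINT x:\<Omega>|lborel. (norm (grad \<Theta> x))\<^sup>2)"
        by (rule Cp(2)[rule_format, of W]) (intro conjI W fs.\<Theta>1 \<Theta>0)
      have pU: "(LINT x:\<Omega>|lborel. (norm (U x))\<^sup>2) \<le> Cp * (LINT x:\<Omega>|lborel. (norm (vgrad U x))\<^sup>2)"
        by (rule fs.vector_poincare, rule Cp(2)[rule_format, of W]) (intro conjI W)
      have diss: "(LINT x:\<Omega>|lborel. fs.rate \<zeta> \<omega> x) \<le> - (\<nu> / 2) * (LINT x:\<Omega>|lborel. (norm (vgrad U x))\<^sup>2)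
          - a * l0 * \<gamma> * (LINT x:\<Omega>|lborel. (fs.\<mu> x)\<^sup>2) - k * \<zeta> * (LINT x:\<Omega>|lborel. (laplacian \<Theta> x)\<^sup>2)"
        by (rule fs.dissipation[OF pos(1) \<zeta> Cp(1) K(1) pU p\<Theta> L4 wL4 c1 c2 c3 j])
      have eqs: "(L2_norm \<Omega> (vgrad (u t)))\<^sup>2 = (LINT x:\<Omega>|lborel. (norm (vgrad U x))\<^sup>2)"
        "(L2_norm \<Omega> (\<lambda>x. laplacian (\<phi> t) x - deriv (FF \<epsilon>) (\<phi> t x)))\<^sup>2 = (LINT x:\<Omega>|lborel. (fs.\<mu> x)\<^sup>2)"
        "(L2_norm \<Omega> (laplacian (\<theta> t)))\<^sup>2 = (LINT x:\<Omega>|lborel. (laplacian \<Theta> x)\<^sup>2)"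
        unfolding L2_norm_sq
        by (auto intro!: set_lebesgue_integral_cong simp: sl\<Omega> fs.\<mu>_def vgrad_cong_open[OF open_Omega _ sl\<Omega>(1)]
            laplacian_cong_open[OF open_Omega _ sl\<Omega>(2)] laplacian_cong_open[OF open_Omega _ sl\<Omega>(3)])
      have d: "(energy \<Omega> l0 a \<epsilon> \<zeta> \<omega> u \<phi> \<theta> has_real_derivative (LINT x:\<Omega>|lborel. fs.rate \<zeta> \<omega> x)) (at t)"
        using der by blast
      have "energy \<Omega> l0 a \<epsilon> \<zeta> \<omega> u \<phi> \<theta> differentiable (at t)"
        using d real_differentiable_def by blast
      moreover have "deriv (energy \<Omega> l0 a \<epsilon> \<zeta> \<omega> u \<phi> \<theta>) t \<le> - (\<nu> / 2) * (L2_norm \<Omega> (vgrad (u t)))\<^sup>2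
              - a * l0 * \<gamma> * (L2_norm \<Omega> (\<lambda>x. laplacian (\<phi> t) x - deriv (FF \<epsilon>) (\<phi> t x)))\<^sup>2
              - k * \<zeta> * (L2_norm \<Omega> (laplacian (\<theta> t)))\<^sup>2"
        unfolding eqs DERIV_imp_deriv[OF d] by (rule diss)
      moreover have "- (\<nu> / 2) * (L2_norm \<Omega> (vgrad (u t)))\<^sup>2
              - a * l0 * \<gamma> * (L2_norm \<Omega> (\<lambda>x. laplacian (\<phi> t) x - deriv (FF \<epsilon>) (\<phi> t x)))\<^sup>2
              - k * \<zeta> * (L2_norm \<Omega> (laplacian (\<theta> t)))\<^sup>2 \<le> 0"
      proof -
        have nn: "0 \<le> c * X\<^sup>2" if "c > 0" for c X :: real using that by simp
        have "0 \<le> \<nu> / 2 * (L2_norm \<Omega> (vgrad (u t)))\<^sup>2"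
          "0 \<le> a * l0 * \<gamma> * (L2_norm \<Omega> (\<lambda>x. laplacian (\<phi> t) x - deriv (FF \<epsilon>) (\<phi> t x)))\<^sup>2"
          "0 \<le> k * \<zeta> * (L2_norm \<Omega> (laplacian (\<theta> t)))\<^sup>2"
          by (rule nn, use pos \<zeta> in simp)+
        then show ?thesis by linarith
      qed
      moreover have "0 \<le> energy \<Omega> l0 a \<epsilon> \<zeta> \<omega> u \<phi> \<theta> t"
        unfolding energy_def using pos \<zeta> \<omega>
        by (intro add_nonneg_nonneg mult_nonneg_nonneg integral_nonneg) (auto simp: FF_def)
      ultimately show "energy \<Omega> l0 a \<epsilon> \<zeta> \<omega> u \<phi> \<theta> differentiable (at t) \<and>
          deriv (energy \<Omega> l0 a \<epsilon> \<zeta> \<omega> u \<phi> \<theta>) t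
            \<le> - (\<nu> / 2) * (L2_norm \<Omega> (vgrad (u t)))\<^sup>2
              - a * l0 * \<gamma> * (L2_norm \<Omega> (\<lambda>x. laplacian (\<phi> t) x - deriv (FF \<epsilon>) (\<phi> t x)))\<^sup>2
              - k * \<zeta> * (L2_norm \<Omega> (laplacian (\<theta> t)))\<^sup>2 \<and>
          - (\<nu> / 2) * (L2_norm \<Omega> (vgrad (u t)))\<^sup>2
              - a * l0 * \<gamma> * (L2_norm \<Omega> (\<lambda>x. laplacian (\<phi> t) x - deriv (FF \<epsilon>) (\<phi> t x)))\<^sup>2
              - k * \<zeta> * (L2_norm \<Omega> (laplacian (\<theta> t)))\<^sup>2 \<le> 0 \<and>
          0 \<le> energy \<Omega> l0 a \<epsilon> \<zeta> \<omega> u \<phi> \<theta> t" by blast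
    qed
  qed
qed



end
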